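(* Let $k,d\geq1$, let $P\in\mathbb{R}[x_1,\dots,x_k]$, $P=P_0+P_1+\dots+P_d$ with $P_i$ homogeneous of degree $i$, and assume $P_d(x)>0$ for all nonzero $x\in\mathbb{R}^k$. Then $\{x\in\mathbb{R}^k:P(x)\le0\}$ is compact; let $F\subset\mathbb{Z}^k$ be any finite subset containing $\{n\in\mathbb{Z}^k:P(n)\leq0\}$. For $s\in\mathbb{C}$ let $G(s)$ denote the sum of the series $\sum_{n\in\mathbb{Z}^k\setminus F}P(n)^{-s}$ whenever this series is h-summable. Let $E=\{(k-j)/d:j\in2\mathbb{Z},j\geq0\}$. Then: 1. $G(s)$ is defined for all $s\notin E$, and $G|_{\mathbb{C}\setminus E}$ is holomorphic. This function has a meromorphic continuation, denoted $\tilde G(s)$, to all of $\mathbb{C}$, with at most simple poles. 2. Let $s_0\in E$. If $G(s_0)$ is defined, then $\tilde G$ is holomorphic at $s_0$. But $\tilde G(s_0)\neq G(s_0)$ in general, i.e. there exist integers $k,d\geq1$, a polynomial $P=P_0+\dots+P_d\in\mathbb{R}[x_1,\dots,x_k]$ with $P_i$ homogeneous of degree $i$ and $P_d(x)>0$ for all nonzero $x\in\mathbb{R}^k$, a finite subset $F\subset\mathbb{Z}^k$ containing $\{n\in\mathbb{Z}^k:P(n)\leq0\}$, and $s_0\in E$ such that $G(s_0)$ is defined and $\tilde G(s_0)\neq G(s_0)$. 3. If $s\in\mathbb{Z}$, $s\leq0$, then $G(s)$ is defined and equals $-\sum_{n\in F}P(n)^{-s}$. Therefore $\tilde G$ is holomorphic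 at all such $s$. 4. If $k$ is odd, then $\tilde G(s)=-\sum_{n\in F}P(n)^{-s}$ for all $s\in\mathbb{Z}$, $s\leq0$.
   Context: For $n\in\mathbb{Z}^k\setminus F$ one has $P(n)>0$ and $P(n)^{-s}=\exp(-s\log P(n))$. In 3 and 4, $P(n)^{0}=1$. t-summability: for an abelian group $\Gamma$, $a:\Gamma\to\mathbb{C}$ is t-summable if there is a finitely supported $c:\Gamma\to\mathbb{C}$ with $\sum c\neq0$ and $\sum_\gamma|(c*a)(\gamma)|<\infty$, where $(c*a)(\gamma)=\sum_{\gamma'}c(\gamma')a(\gamma-\gamma')$; its sum is then $(\sum c)^{-1}\sum_\gamma(c*a)(\gamma)$, independent of $c$. h-summability (on $\mathbb{Q}^k$): for $t\in\mathbb{Q}^\times$ and $a:\mathbb{Q}^k\to\mathbb{C}$ put $(\rho(t)a)(x)=a(t^{-1}x)$. The function $a$ is h-summable if there is a finitely supported family $(c_t)_{t\in\mathbb{Q}^\times}$ of complex numbers with $\sum_tc_t\neq0$ such that $\sum_tc_t\rho(t)a$ is t-summable on the group $\Gamma=\mathbb{Q}^k$; its sum is then defined as $(\sum_tc_t)^{-1}$ times the t-sum of $\sum_tc_t\rho(t)a$ (independent of choices). For a subset $M\subset\mathbb{Q}^k$ and $a:M\to\mathbb{C}$, the series $\sum_{n\in M}a(n)$ is h-summable if the extension of $a$ by zero to $\mathbb{Q}^k$ is h-summable, and its sum is the sum of the extension. *)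

theory Defs
  imports
    "HOL-Complex_Analysis.Complex_Analysis"
    "HOL-Library.Poly_Mapping"
    "HOL-Library.Function_Algebras"
begin

text \<open>
  In the definitions below \<open>\<Gamma>\<close> is meant to be an additive subgroup of the ambient abelian group;
  the values of \<open>c\<close> and \<open>a\<close> outside \<open>\<Gamma>\<close> are irrelevant.
\<close>

definition gsupp :: "'g set \<Rightarrow> ('g \<Rightarrow> complex) \<Rightarrow> 'g set" where
  "gsupp \<Gamma> c = {\<gamma> \<in> \<Gamma>. c \<gamma> \<noteq> 0}"

definition gconv :: "'g::ab_group_add set \<Rightarrow> ('g \<Rightarrow> complex) \<Rightarrow> ('g \<Rightarrow> complex) \<Rightarrow> 'g \<Rightarrow> complex" where
  "gconv \<Gamma> c a \<gamma> = (\<Sum>\<gamma>'\<in>gsupp \<Gamma> c. c \<gamma>' * a (\<gamma> - \<gamma>'))"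

definition t_has_sum :: "'g::ab_group_add set \<Rightarrow> ('g \<Rightarrow> complex) \<Rightarrow> complex \<Rightarrow> bool" where
  "t_has_sum \<Gamma> a S \<longleftrightarrow>
     (\<exists>c. finite (gsupp \<Gamma> c) \<and> sum c (gsupp \<Gamma> c) \<noteq> 0 \<and>
          (\<lambda>\<gamma>. norm (gconv \<Gamma> c a \<gamma>)) summable_on \<Gamma> \<and>
          S = inverse (sum c (gsupp \<Gamma> c)) * (\<Sum>\<^sub>\<infinity>\<gamma>\<in>\<Gamma>. gconv \<Gamma> c a \<gamma>))"

definition t_summable :: "'g::ab_group_add set \<Rightarrow> ('g \<Rightarrow> complex) \<Rightarrow> bool" where
  "t_summable \<Gamma> a \<longleftrightarrow> (\<exists>S. t_has_sum \<Gamma> a S)"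

definition t_sum :: "'g::ab_group_add set \<Rightarrow> ('g \<Rightarrow> complex) \<Rightarrow> complex" where
  "t_sum \<Gamma> a = (THE S. t_has_sum \<Gamma> a S)"

text \<open>
  Following \<^const>\<open>Euclidean_space\<close>, a point of a \<open>k\<close>-dimensional space is a function on the
  naturals that vanishes at all indices \<open>i \<ge> k\<close>.
\<close>

definition rat_space :: "nat \<Rightarrow> (nat \<Rightarrow> rat) set" where
  "rat_space k = {x. \<forall>i\<ge>k. x i = 0}"

definition int_lattice :: "nat \<Rightarrow> (nat \<Rightarrow> rat) set" where
  "int_lattice k = {x \<in> rat_space k. \<forall>i. x i \<in> \<int>}"

definition dilate :: "rat \<Rightarrow> ((nat \<Rightarrow> rat) \<Rightarrow> complex) \<Rightarrow> (nat \<Rightarrow> rat) \<Rightarrow> complex" where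
  "dilate t a x = a (\<lambda>i. inverse t * x i)"

definition h_has_sum :: "nat \<Rightarrow> ((nat \<Rightarrow> rat) \<Rightarrow> complex) \<Rightarrow> complex \<Rightarrow> bool" where
  "h_has_sum k a S \<longleftrightarrow>
     (\<exists>c. let T = gsupp (- {0}) c; b = (\<lambda>x. \<Sum>t\<in>T. c t * dilate t a x) in
          finite T \<and> sum c T \<noteq> 0 \<and> t_summable (rat_space k) b \<and>
          S = inverse (sum c T) * t_sum (rat_space k) b)"

definition extend_zero :: "'x set \<Rightarrow> ('x \<Rightarrow> complex) \<Rightarrow> 'x \<Rightarrow> complex" where
  "extend_zero M a x = (if x \<in> M then a x else 0)"

definition h_summable_on :: "nat \<Rightarrow> (nat \<Rightarrow> rat) set \<Rightarrow> ((nat \<Rightarrow> rat) \<Rightarrow> complex) \<Rightarrow> bool" where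
  "h_summable_on k M a \<longleftrightarrow> (\<exists>S. h_has_sum k (extend_zero M a) S)"

definition h_sum_on :: "nat \<Rightarrow> (nat \<Rightarrow> rat) set \<Rightarrow> ((nat \<Rightarrow> rat) \<Rightarrow> complex) \<Rightarrow> complex" where
  "h_sum_on k M a = (THE S. h_has_sum k (extend_zero M a) S)"

text \<open>A monomial is its exponent vector; a polynomial maps monomials to their coefficients.\<close>

type_synonym real_mpoly = "(nat \<Rightarrow>\<^sub>0 nat) \<Rightarrow>\<^sub>0 real"

definition mpolys :: "nat \<Rightarrow> real_mpoly set" where
  "mpolys k = {P. \<forall>m\<in>Poly_Mapping.keys P. Poly_Mapping.keys m \<subseteq> {..<k}}"

definition homogeneous :: "nat \<Rightarrow> real_mpoly \<Rightarrow> bool" where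
  "homogeneous e P \<longleftrightarrow>
     (\<forall>m\<in>Poly_Mapping.keys P. (\<Sum>i\<in>Poly_Mapping.keys m. Poly_Mapping.lookup m i) = e)"

definition mpoly_eval :: "real_mpoly \<Rightarrow> (nat \<Rightarrow> real) \<Rightarrow> real" where
  "mpoly_eval P x =
     (\<Sum>m\<in>Poly_Mapping.keys P. Poly_Mapping.lookup P m *
        (\<Prod>i\<in>Poly_Mapping.keys m. x i ^ Poly_Mapping.lookup m i))"

definition mpoly_at :: "real_mpoly \<Rightarrow> (nat \<Rightarrow> rat) \<Rightarrow> real" where
  "mpoly_at P n = mpoly_eval P (\<lambda>i. real_of_rat (n i))"

definition elliptic_decomp :: "nat \<Rightarrow> nat \<Rightarrow> real_mpoly \<Rightarrow> (nat \<Rightarrow> real_mpoly) \<Rightarrow> bool" where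
  "elliptic_decomp k d P Pc \<longleftrightarrow>
     k \<ge> 1 \<and> d \<ge> 1 \<and> P \<in> mpolys k \<and>
     P = (\<Sum>i\<le>d. Pc i) \<and>
     (\<forall>i\<le>d. Pc i \<in> mpolys k \<and> homogeneous i (Pc i)) \<and>
     (\<forall>x\<in>topspace (Euclidean_space k). x \<noteq> (\<lambda>_. 0) \<longrightarrow> mpoly_eval (Pc d) x > 0)"

definition excluded_set :: "nat \<Rightarrow> real_mpoly \<Rightarrow> (nat \<Rightarrow> rat) set \<Rightarrow> bool" where
  "excluded_set k P F \<longleftrightarrow>
     finite F \<and> F \<subseteq> int_lattice k \<and> {n \<in> int_lattice k. mpoly_at P n \<le> 0} \<subseteq> F"

definition G_defined :: "nat \<Rightarrow> real_mpoly \<Rightarrow> (nat \<Rightarrow> rat) set \<Rightarrow> complex \<Rightarrow> bool" where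
  "G_defined k P F s \<longleftrightarrow>
     h_summable_on k (int_lattice k - F) (\<lambda>n. complex_of_real (mpoly_at P n) powr (- s))"

definition G :: "nat \<Rightarrow> real_mpoly \<Rightarrow> (nat \<Rightarrow> rat) set \<Rightarrow> complex \<Rightarrow> complex" where
  "G k P F s =
     h_sum_on k (int_lattice k - F) (\<lambda>n. complex_of_real (mpoly_at P n) powr (- s))"

definition exc_points :: "nat \<Rightarrow> nat \<Rightarrow> complex set" where
  "exc_points k d = {(of_int (int k - j) / of_nat d) | j. even j \<and> j \<ge> 0}"

text \<open>
  \<^const>\<open>nicely_meromorphic_on\<close> normalises the values: where the function has no pole its value is the
  limit, so it is holomorphic there. Hence the continuation is determined by its values
  off the exceptional set \<open>E\<close>, and its value at a point of \<open>E\<close> that is not a pole is the intended one.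
\<close>

definition mero_continuation ::
    "complex set \<Rightarrow> (complex \<Rightarrow> complex) \<Rightarrow> (complex \<Rightarrow> complex) \<Rightarrow> bool" where
  "mero_continuation E f g \<longleftrightarrow> g nicely_meromorphic_on UNIV \<and> (\<forall>s\<in>- E. g s = f s)"

definition at_most_simple_poles :: "(complex \<Rightarrow> complex) \<Rightarrow> bool" where
  "at_most_simple_poles g \<longleftrightarrow> (\<forall>z. is_pole g z \<longrightarrow> zorder g z = -1)"

end

theory Submission
  imports Defs
begin

text \<open>
  Write \<open>p\<close> for the leading form \<open>P\<^sub>d\<close>. It is positive away from \<open>0\<close>, so \<open>d\<close> is even.

  The building blocks are the functions \<open>f(x) = \<phi>(x) p(x)\<^sup>-\<^sup>s\<close> on the nonzero lattice points, for a
  homogeneous polynomial \<open>\<phi>\<close> of degree \<open>q\<close>. Dilating \<open>f\<close> by an integer \<open>m\<close> multiplies it by a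
  power of \<open>m\<close> and moves its support to the multiples of \<open>m\<close>. Hence subtracting
  \<open>m powr (k + q - d s)\<close> times the dilated function leaves \<open>f w\<close>, where
  \<open>w = 1 - m\<^sup>k\<close> on the multiples of \<open>m\<close> and \<open>w = 1\<close> on the other lattice points. This weight has
  mean \<open>0\<close> over every cube of side \<open>m\<close> (\<open>cube_avg_mod_weight\<close>), so repeated averaging over the cube
  annihilates any polynomial times \<open>w\<close> (\<open>funpow_annihilates\<close>). Expanding \<open>p(x - y)\<^sup>-\<^sup>s\<close>
  binomially around \<open>p(x)\<close> shows that \<open>f w\<close> is near \<open>x\<close> a polynomial times \<open>w\<close>, up to an error of
  order as low as desired. Averaging often enough therefore makes \<open>f w\<close> absolutely summable, locally
  uniformly in \<open>s\<close> (\<open>cube_avg_pterm_decay\<close>), and its t-sum is an entire function of \<open>s\<close>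
  (\<open>ex_entire_t_sum\<close>). The h-sum of \<open>f\<close> arises by dividing by \<open>1 - m powr (k + q - d s)\<close>. For
  \<open>m = 2\<close> and \<open>m = 3\<close> these factors have only the common zero \<open>s = (k + q)/d\<close>, which is simple; so
  the h-sum is \<open>Y(s) / (s - (k + q)/d)\<close> with \<open>Y\<close> entire (\<open>ex_zeta_numerator\<close>). If \<open>q\<close> is
  odd, the reflection \<open>x \<mapsto> -x\<close> shows that the h-sum is \<open>0\<close> for every \<open>s\<close> (\<open>zterm_odd\<close>).

  The binomial expansion of \<open>(p + (P - p))\<^sup>-\<^sup>s\<close> turns \<open>P\<^sup>-\<^sup>s\<close> into finitely many such blocks,
  at shifted arguments \<open>s + i\<close>, plus an absolutely summable remainder that is holomorphic in \<open>s\<close>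
  (\<open>expansion\<close>). The block of degree \<open>q\<close> in the \<open>i\<close>-th binomial term has its pole at
  \<open>(k - (d i - q))/d\<close>, which for even \<open>q\<close> is a point of the exceptional set. This gives summability,
  holomorphy and the continuation with simple poles (\<open>local_structure\<close>).

  At a critical point the operator \<open>1 - dilate 2\<close> has total weight \<open>0\<close>, yet it sends the polar part of
  the series to a function whose t-sum is a nonzero multiple of the residue. If the series is h-summable
  there, an operator of weight \<open>0\<close> can only produce the sum \<open>0\<close> (\<open>h_has_sum_weight\<close>), so the
  residue vanishes and the continuation is holomorphic.

  At a nonpositive integer \<open>s\<close> the summand is a polynomial, and the same mechanism gives h-sum \<open>0\<close> for a
  polynomial over the whole lattice; only the finitely many excluded points contribute. For odd \<open>k\<close>
  these integers are not exceptional, because \<open>d\<close> is even.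

  The continuation may still differ from the sum: a block whose binomial coefficient vanishes at \<open>s\<close> does
  not contribute to the sum there, but if it also has a pole at \<open>s\<close>, the zero cancels the pole and leaves a
  finite jump. For \<open>P = x\<^sup>2 + y\<^sup>2 + 1\<close> and \<open>s = 0\<close> the jump is minus the residue at \<open>1\<close> of the Epstein zeta
  function of \<open>x\<^sup>2 + y\<^sup>2\<close>, and this residue is nonzero because the sum of \<open>1/(x\<^sup>2 + y\<^sup>2)\<close> over the
  nonzero lattice points diverges (\<open>epstein_counterexample\<close>).
\<close>


section \<open>Finite combinations of translations and of dilations\<close>

text \<open>
  A family of maps \<open>\<phi> p\<close> of the argument, indexed by \<open>p \<in> I\<close>, generates operators
  \<open>a \<mapsto> (\<Sum>p. c p * a \<circ> \<phi> p)\<close> of total weight \<open>\<Sum>p. c p\<close>. Translations and dilations are both of this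
  kind, so the algebra is done once. The inductive form turns statements about linear combination,
  composition and commutation into immediate inductions that carry the weight along.
\<close>

inductive weighted_op ::
  "'p set \<Rightarrow> ('p \<Rightarrow> 'x \<Rightarrow> 'x) \<Rightarrow> (('x \<Rightarrow> complex) \<Rightarrow> 'x \<Rightarrow> complex) \<Rightarrow> complex \<Rightarrow> bool"
  for I \<phi> where
  zero: "weighted_op I \<phi> (\<lambda>a x. 0) 0"
| move: "p \<in> I \<Longrightarrow> weighted_op I \<phi> (\<lambda>a x. a (\<phi> p x)) 1"
| add: "weighted_op I \<phi> T e \<Longrightarrow> weighted_op I \<phi> U e' \<Longrightarrow>
    weighted_op I \<phi> (\<lambda>a x. T a x + U a x) (e + e')"
| scale: "weighted_op I \<phi> T e \<Longrightarrow> weighted_op I \<phi> (\<lambda>a x. c * T a x) (c * e)"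

lemma weighted_op_sum:
  "finite A \<Longrightarrow> (\<And>i. i \<in> A \<Longrightarrow> weighted_op I \<phi> (T i) (e i)) \<Longrightarrow>
    weighted_op I \<phi> (\<lambda>a x. \<Sum>i\<in>A. T i a x) (\<Sum>i\<in>A. e i)"
  by (induction A rule: finite_induct) (simp_all add: weighted_op.zero weighted_op.add)

text \<open>
  The bridge to the definitions of the two summation methods, which are phrased with finitely supported
  coefficient functions: coefficients add up over the union of two supports.
\<close>

lemma weighted_op_explicit:
  "weighted_op I \<phi> T e \<longleftrightarrow>
    (\<exists>c. finite (gsupp I c) \<and> T = (\<lambda>a x. \<Sum>p\<in>gsupp I c. c p * a (\<phi> p x)) \<and> e = sum c (gsupp I c))"
proof
  assume "weighted_op I \<phi> T e"
  then show "\<exists>c. finite (gsupp I c) \<and> T = (\<lambda>a x. \<Sum>p\<in>gsupp I c. c p * a (\<phi> p x)) \<and>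
      e = sum c (gsupp I c)"
  proof induction
    case zero
    show ?case by (rule exI[of _ "\<lambda>_. 0"]) (auto simp: gsupp_def)
  next
    case (move p)
    define c :: "_ \<Rightarrow> complex" where "c = (\<lambda>q. if q = p then 1 else 0)"
    have "gsupp I c = {p}" using move by (auto simp: gsupp_def c_def)
    moreover have "c p = 1" by (simp add: c_def)
    ultimately show ?case by (intro exI[of _ c]) simp
  next
    case (add T e U e')
    from add.IH(1) obtain c where c: "finite (gsupp I c)"
        "T = (\<lambda>a x. \<Sum>p\<in>gsupp I c. c p * a (\<phi> p x))" "e = sum c (gsupp I c)"
      by (elim exE conjE) (rule that)
    from add.IH(2) obtain c' where c': "finite (gsupp I c')"
        "U = (\<lambda>a x. \<Sum>p\<in>gsupp I c'. c' p * a (\<phi> p x))" "e' = sum c' (gsupp I c')"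
      by (elim exE conjE) (rule that)
    let ?s = "\<lambda>p. c p + c' p"
    let ?V = "gsupp I c \<union> gsupp I c'"
    have sub: "gsupp I ?s \<subseteq> ?V" by (auto simp: gsupp_def)
    have ext: "(\<Sum>p\<in>gsupp I f. f p * g p) = (\<Sum>p\<in>?V. f p * g p)"
      if "gsupp I f \<subseteq> ?V" for f and g :: "_ \<Rightarrow> complex"
      using that c(1) c'(1) by (intro sum.mono_neutral_left) (auto simp: gsupp_def)
    have 1: "T = (\<lambda>a x. \<Sum>p\<in>?V. c p * a (\<phi> p x))" "U = (\<lambda>a x. \<Sum>p\<in>?V. c' p * a (\<phi> p x))"
      unfolding c(2) c'(2) using ext[of c] ext[of c'] by (simp_all add: fun_eq_iff)
    have 2: "e = (\<Sum>p\<in>?V. c p)" "e' = (\<Sum>p\<in>?V. c' p)" "sum ?s (gsupp I ?s) = (\<Sum>p\<in>?V. ?s p)"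
      unfolding c(3) c'(3)
      using ext[of c "\<lambda>_. 1"] ext[of c' "\<lambda>_. 1"] ext[of ?s "\<lambda>_. 1"] sub by simp_all
    show ?case
    proof (intro exI[of _ ?s] conjI)
      show "finite (gsupp I ?s)" using sub c(1) c'(1) by (meson finite_UnI finite_subset)
      show "(\<lambda>a x. T a x + U a x) = (\<lambda>a x. \<Sum>p\<in>gsupp I ?s. ?s p * a (\<phi> p x))"
        unfolding ext[OF sub] 1 by (simp add: sum.distrib ring_distribs)
      show "e + e' = sum ?s (gsupp I ?s)" unfolding 2 by (simp add: sum.distrib)
    qed
  next
    case (scale T e d)
    from scale.IH obtain c where c: "finite (gsupp I c)"
        "T = (\<lambda>a x. \<Sum>p\<in>gsupp I c. c p * a (\<phi> p x))" "e = sum c (gsupp I c)"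
      by (elim exE conjE) (rule that)
    show ?case
    proof (cases "d = 0")
      case True
      then show ?thesis by (intro exI[of _ "\<lambda>_. 0"]) (auto simp: gsupp_def)
    next
      case False
      then have "gsupp I (\<lambda>p. d * c p) = gsupp I c" by (auto simp: gsupp_def)
      with c show ?thesis
        by (intro exI[of _ "\<lambda>p. d * c p"]) (auto simp: sum_distrib_left mult.assoc)
    qed
  qed
next
  assume "\<exists>c. finite (gsupp I c) \<and> T = (\<lambda>a x. \<Sum>p\<in>gsupp I c. c p * a (\<phi> p x)) \<and>
      e = sum c (gsupp I c)"
  then obtain c where c: "finite (gsupp I c)" "T = (\<lambda>a x. \<Sum>p\<in>gsupp I c. c p * a (\<phi> p x))"
      "e = sum c (gsupp I c)" by (elim exE conjE) (rule that)
  have "weighted_op I \<phi> (\<lambda>a x. \<Sum>p\<in>gsupp I c. c p * a (\<phi> p x)) (\<Sum>p\<in>gsupp I c. c p * 1)"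
    by (rule weighted_op_sum[OF c(1)], rule weighted_op.scale, rule weighted_op.move)
      (auto simp: gsupp_def)
  then show "weighted_op I \<phi> T e" using c by simp
qed

lemma weighted_op_linear:
  assumes "weighted_op I \<phi> T e"
  shows weighted_op_plus: "T (\<lambda>x. a x + b x) = (\<lambda>x. T a x + T b x)"
    and weighted_op_mult: "T (\<lambda>x. c * a x) = (\<lambda>x. c * T a x)"
    and weighted_op_0: "T (\<lambda>x. 0) = (\<lambda>x. 0)"
  using assms by (induction arbitrary: a b c) (auto simp: algebra_simps)

lemma weighted_op_of_sum:
  assumes "weighted_op I \<phi> T e" "finite A"
  shows "T (\<lambda>x. \<Sum>i\<in>A. a i x) = (\<lambda>x. \<Sum>i\<in>A. T (a i) x)"
  using assms(2)
  by (induction A rule: finite_induct)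
    (simp_all add: weighted_op_0[OF assms(1)] weighted_op_plus[OF assms(1)])

text \<open>
  Weights multiply because the augmentation of a group algebra is a ring homomorphism.
\<close>

lemma weighted_op_comp:
  assumes "weighted_op I \<phi> T e" "weighted_op I \<phi> U e'"
    and closed: "\<And>p q. p \<in> I \<Longrightarrow> q \<in> I \<Longrightarrow> \<exists>r\<in>I. \<phi> r = \<phi> q \<circ> \<phi> p"
  shows "weighted_op I \<phi> (\<lambda>a. T (U a)) (e * e')"
  using assms(1)
proof induction
  case zero
  then show ?case using weighted_op.zero by simp
next
  case (move p)
  show ?case using assms(2)
  proof induction
    case zero
    then show ?case using weighted_op.zero by simp
  next
    case (move q)
    with \<open>p \<in> I\<close> closed obtain r where "r \<in> I" "\<phi> r = \<phi> q \<circ> \<phi> p" by blast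
    then show ?case using weighted_op.move[of r I \<phi>] by simp
  next
    case (add T e U e')
    then show ?case using weighted_op.add[OF add.IH] by simp
  next
    case (scale T e c)
    then show ?case using weighted_op.scale[OF scale.IH] by simp
  qed
next
  case (add T e U e')
  then show ?case using weighted_op.add[OF add.IH] by (simp add: ring_distribs)
next
  case (scale T e c)
  then show ?case using weighted_op.scale[OF scale.IH] by (simp add: mult.assoc)
qed

lemma weighted_op_commute:
  assumes "weighted_op I \<phi> T e" "weighted_op I \<phi> U e'"
    and comm: "\<And>p q x. p \<in> I \<Longrightarrow> q \<in> I \<Longrightarrow> \<phi> p (\<phi> q x) = \<phi> q (\<phi> p x)"
  shows "T (U a) = U (T a)"
  using assms(1)
proof (induction arbitrary: a)
  case zero
  then show ?case by (simp add: weighted_op_0[OF assms(2)])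
next
  case (move p)
  show ?case using assms(2) 
    by (induction arbitrary: a) (simp_all add: comm move fun_eq_iff)
next
  case (add T e V e')
  then show ?case by (simp add: weighted_op_plus[OF assms(2)])
next
  case (scale T e c)
  then show ?case by (simp add: weighted_op_mult[OF assms(2)])
qed

abbreviation translation_op :: "'g::ab_group_add set \<Rightarrow>
    (('g \<Rightarrow> complex) \<Rightarrow> 'g \<Rightarrow> complex) \<Rightarrow> complex \<Rightarrow> bool" where
  "translation_op \<Gamma> \<equiv> weighted_op \<Gamma> (\<lambda>\<gamma> x. x - \<gamma>)"

abbreviation dilation_op ::
  "(((nat \<Rightarrow> rat) \<Rightarrow> complex) \<Rightarrow> (nat \<Rightarrow> rat) \<Rightarrow> complex) \<Rightarrow> complex \<Rightarrow> bool" where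
  "dilation_op \<equiv> weighted_op (- {0}) (\<lambda>t x i. inverse t * x i)"

lemma dilation_op_dilate: "t \<noteq> 0 \<Longrightarrow> dilation_op (dilate t) 1"
  using weighted_op.move[of t "- {0}" "\<lambda>t x i. inverse t * x i"] by (simp add: dilate_def[abs_def])

lemma translation_op_comm:
  assumes "translation_op \<Gamma> T e" "translation_op \<Gamma> U e'"
  shows "T (U a) = U (T a)"
  by (rule weighted_op_commute[OF assms]) (simp add: algebra_simps)

lemma dilation_op_comm:
  assumes "dilation_op T e" "dilation_op U e'"
  shows "T (U a) = U (T a)"
  by (rule weighted_op_commute[OF assms]) (simp add: algebra_simps)

lemma dilation_op_comp:
  assumes "dilation_op T e" "dilation_op U e'"
  shows "dilation_op (\<lambda>a. T (U a)) (e * e')"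
  by (rule weighted_op_comp[OF assms], rule_tac x="p*q" in bexI) (auto simp: o_def fun_eq_iff)

text \<open>
  Closure under differences is exactly what makes a nonempty set an additive subgroup.
\<close>

locale subgroup_like =
  fixes \<Gamma> :: "'g::ab_group_add set"
  assumes diff_closed: "x \<in> \<Gamma> \<Longrightarrow> y \<in> \<Gamma> \<Longrightarrow> x - y \<in> \<Gamma>"
begin

lemma add_closed: "x \<in> \<Gamma> \<Longrightarrow> y \<in> \<Gamma> \<Longrightarrow> x + y \<in> \<Gamma>"
  using diff_closed[of x "(y - y) - y"] diff_closed[of y y] diff_closed[of "y - y" y] by simp

lemma translation_op_comp:
  assumes "translation_op \<Gamma> T e" "translation_op \<Gamma> U e'"
  shows "translation_op \<Gamma> (\<lambda>a. T (U a)) (e * e')"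
  by (rule weighted_op_comp[OF assms], rule_tac x="p+q" in bexI)
    (auto simp: o_def fun_eq_iff algebra_simps intro: add_closed)

lemma has_sum_shift:
  assumes "(b has_sum S) \<Gamma>" "\<gamma> \<in> \<Gamma>"
  shows "((\<lambda>x. b (x - \<gamma>)) has_sum S) \<Gamma>"
proof -
  have "bij_betw (\<lambda>x. x - \<gamma>) \<Gamma> \<Gamma>"
    by (rule bij_betwI[where g="\<lambda>x. x + \<gamma>"]) (use assms(2) in \<open>auto intro: add_closed diff_closed\<close>)
  then show ?thesis using has_sum_reindex_bij_betw[of "\<lambda>x. x - \<gamma>" \<Gamma> \<Gamma> b S] assms(1) by simp
qed

text \<open>
  A translation permutes the group and so preserves absolutely convergent sums; an operator multiplies them
  by its weight. All consistency statements about t-sums come from this.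
\<close>

lemma has_sum_translation_op:
  assumes "translation_op \<Gamma> T e" "(b has_sum S) \<Gamma>"
  shows "(T b has_sum (e * S)) \<Gamma>"
  using assms(1)
proof induction
  case zero
  then show ?case by (simp add: has_sum_0)
next
  case (move p)
  then show ?case using has_sum_shift[OF assms(2)] by simp
next
  case (add T e U e')
  then show ?case using has_sum_add[OF add.IH] by (simp add: ring_distribs)
next
  case (scale T e c)
  then show ?case using has_sum_cmult_right[OF scale.IH, of c] by (simp add: mult.assoc)
qed

end

section \<open>Uniqueness and linearity of the two sums\<close>

lemma t_has_sum_iff:
  "t_has_sum \<Gamma> a S \<longleftrightarrow> (\<exists>T e. translation_op \<Gamma> T e \<and> e \<noteq> 0 \<and> (T a has_sum (e * S)) \<Gamma>)"
proof
  assume "t_has_sum \<Gamma> a S"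
  then obtain c where c: "finite (gsupp \<Gamma> c)" "sum c (gsupp \<Gamma> c) \<noteq> 0"
      "(\<lambda>\<gamma>. norm (gconv \<Gamma> c a \<gamma>)) summable_on \<Gamma>"
      "S = inverse (sum c (gsupp \<Gamma> c)) * (\<Sum>\<^sub>\<infinity>\<gamma>\<in>\<Gamma>. gconv \<Gamma> c a \<gamma>)"
    unfolding t_has_sum_def by blast
  have "(gconv \<Gamma> c a has_sum (sum c (gsupp \<Gamma> c) * S)) \<Gamma>"
    using c has_sum_infsum[OF abs_summable_summable[OF c(3)]] by (simp add: field_simps)
  moreover have "translation_op \<Gamma> (gconv \<Gamma> c) (sum c (gsupp \<Gamma> c))"
    using c(1) weighted_op_explicit[of \<Gamma> "\<lambda>\<gamma> x. x - \<gamma>"] by (auto simp: gconv_def[abs_def])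
  ultimately show "\<exists>T e. translation_op \<Gamma> T e \<and> e \<noteq> 0 \<and> (T a has_sum (e * S)) \<Gamma>"
    using c(2) by (intro exI conjI)
next
  assume "\<exists>T e. translation_op \<Gamma> T e \<and> e \<noteq> 0 \<and> (T a has_sum (e * S)) \<Gamma>"
  then obtain T e where T: "translation_op \<Gamma> T e" "e \<noteq> 0" "(T a has_sum (e * S)) \<Gamma>"
    by (elim exE conjE) (rule that)
  from T(1) obtain c where c: "finite (gsupp \<Gamma> c)"
      "T = (\<lambda>a x. \<Sum>p\<in>gsupp \<Gamma> c. c p * a (x - p))" "e = sum c (gsupp \<Gamma> c)"
    unfolding weighted_op_explicit by (elim exE conjE) (rule that)
  have *: "T a = gconv \<Gamma> c a" by (simp add: c(2) gconv_def[abs_def])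
  have "(\<lambda>\<gamma>. norm (gconv \<Gamma> c a \<gamma>)) summable_on \<Gamma>"
    using T(3) unfolding * by (metis has_sum_imp_summable summable_on_iff_abs_summable_on_complex)
  moreover have "S = inverse e * (\<Sum>\<^sub>\<infinity>\<gamma>\<in>\<Gamma>. gconv \<Gamma> c a \<gamma>)"
    using T(2) infsumI[OF T(3)] unfolding * by simp
  ultimately show "t_has_sum \<Gamma> a S"
    unfolding t_has_sum_def using c(1,3) T(2) by (intro exI[of _ c] conjI) simp_all
qed

lemma t_has_sumI:
  assumes "translation_op \<Gamma> T e" "e \<noteq> 0" "(T a has_sum (e * S)) \<Gamma>"
  shows "t_has_sum \<Gamma> a S"
  unfolding t_has_sum_iff by (intro exI conjI) (rule assms)+

lemma t_has_sumE:
  assumes "t_has_sum \<Gamma> a S"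
  obtains T e where "translation_op \<Gamma> T e" "e \<noteq> 0" "(T a has_sum (e * S)) \<Gamma>"
  using assms unfolding t_has_sum_iff by (elim exE conjE) (rule that)

context subgroup_like
begin

text \<open>
  If \<open>T a\<close> and \<open>U a\<close> both converge absolutely, the sum of \<open>U (T a) = T (U a)\<close> can be computed in
  two ways, and comparing them identifies the two candidate values.
\<close>

lemma t_has_sum_unique:
  assumes "t_has_sum \<Gamma> a S" "t_has_sum \<Gamma> a S'"
  shows "S = S'"
proof -
  obtain T e where T: "translation_op \<Gamma> T e" "e \<noteq> 0" "(T a has_sum (e * S)) \<Gamma>"
    by (rule t_has_sumE[OF assms(1)])
  obtain U f where U: "translation_op \<Gamma> U f" "f \<noteq> 0" "(U a has_sum (f * S')) \<Gamma>"
    by (rule t_has_sumE[OF assms(2)])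
  have "(U (T a) has_sum (f * (e * S))) \<Gamma>" "(T (U a) has_sum (e * (f * S'))) \<Gamma>"
    using has_sum_translation_op[OF U(1) T(3)] has_sum_translation_op[OF T(1) U(3)] by simp_all
  then have "f * (e * S) = e * (f * S')"
    unfolding translation_op_comm[OF T(1) U(1)] by (rule has_sum_unique)
  then show ?thesis using T(2) U(2) by simp
qed

lemma t_sum_eq: "t_has_sum \<Gamma> a S \<Longrightarrow> t_sum \<Gamma> a = S"
  unfolding t_sum_def using t_has_sum_unique by blast

text \<open>
  The composition of the operators that work for the two summands works for both of them.
\<close>

lemma t_has_sum_add:
  assumes "t_has_sum \<Gamma> a S" "t_has_sum \<Gamma> b S'"
  shows "t_has_sum \<Gamma> (\<lambda>x. a x + b x) (S + S')"
proof -
  obtain T e where T: "translation_op \<Gamma> T e" "e \<noteq> 0" "(T a has_sum (e * S)) \<Gamma>"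
    by (rule t_has_sumE[OF assms(1)])
  obtain U f where U: "translation_op \<Gamma> U f" "f \<noteq> 0" "(U b has_sum (f * S')) \<Gamma>"
    by (rule t_has_sumE[OF assms(2)])
  have 1: "(U (T a) has_sum (f * (e * S))) \<Gamma>" "(T (U b) has_sum (e * (f * S'))) \<Gamma>"
    using has_sum_translation_op[OF U(1) T(3)] has_sum_translation_op[OF T(1) U(3)] by simp_all
  have "U (T (\<lambda>x. a x + b x)) = (\<lambda>x. U (T a) x + T (U b) x)"
    by (simp add: weighted_op_plus[OF T(1)] weighted_op_plus[OF U(1)] translation_op_comm[OF T(1) U(1)])
  then have "(U (T (\<lambda>x. a x + b x)) has_sum (f * e * (S + S'))) \<Gamma>"
    using has_sum_add[OF 1] by (simp add: algebra_simps)
  then show ?thesis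
    by (rule t_has_sumI[OF translation_op_comp[OF U(1) T(1)], rotated]) (use T(2) U(2) in simp)
qed

lemma t_has_sum_cmult:
  assumes "t_has_sum \<Gamma> a S"
  shows "t_has_sum \<Gamma> (\<lambda>x. c * a x) (c * S)"
proof -
  obtain T e where T: "translation_op \<Gamma> T e" "e \<noteq> 0" "(T a has_sum (e * S)) \<Gamma>"
    by (rule t_has_sumE[OF assms(1)])
  have "(T (\<lambda>x. c * a x) has_sum (e * (c * S))) \<Gamma>"
    using has_sum_cmult_right[OF T(3), of c] by (simp add: weighted_op_mult[OF T(1)] algebra_simps)
  then show ?thesis by (rule t_has_sumI[OF T(1,2)])
qed

end

lemma has_sum_imp_t_has_sum:
  assumes "0 \<in> \<Gamma>" "(a has_sum S) \<Gamma>"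
  shows "t_has_sum \<Gamma> a S"
  by (rule t_has_sumI[OF weighted_op.move[OF assms(1)]]) (use assms(2) in simp_all)

lemma subgroup_rat_space: "subgroup_like (rat_space k)"
  by unfold_locales (auto simp: rat_space_def)

interpretation RS: subgroup_like "rat_space k" for k by (rule subgroup_rat_space)

lemma zero_in_rat_space [simp]: "0 \<in> rat_space k"
  by (auto simp: rat_space_def)

lemma dilate_has_sum:
  assumes "t \<noteq> 0" "(b has_sum S) (rat_space k)"
  shows "(dilate t b has_sum S) (rat_space k)"
proof -
  have "bij_betw (\<lambda>x i. inverse t * x i) (rat_space k) (rat_space k)"
    by (rule bij_betwI[where g="\<lambda>x i. t * x i"]) (use assms(1) in \<open>auto simp: rat_space_def\<close>)
  then show ?thesis
    using has_sum_reindex_bij_betw[of "\<lambda>x i. inverse t * x i" "rat_space k" "rat_space k" b S] assms(2)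
    by (simp add: dilate_def[abs_def])
qed

text \<open>
  Conjugating the translation by \<open>\<gamma>\<close> with the dilation by \<open>t\<close> gives the translation by \<open>t \<gamma>\<close>, and
  weights are unchanged. Hence t-summability and the t-sum are invariant under dilations.
\<close>

lemma translation_op_dilate:
  assumes "translation_op (rat_space k) T e" "t \<noteq> 0"
  shows "\<exists>T'. translation_op (rat_space k) T' e \<and> (\<forall>b. T' (dilate t b) = dilate t (T b))"
  using assms(1)
proof induction
  case zero
  show ?case using weighted_op.zero by (intro exI[of _ "\<lambda>a x. 0"]) (auto simp: dilate_def)
next
  case (move p)
  define q where "q = (\<lambda>i. t * p i)"
  have "q \<in> rat_space k" using move by (auto simp: q_def rat_space_def)
  moreover have "dilate t b (x - q) = dilate t (\<lambda>x. b (x - p)) x" for b x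
  proof -
    have "(\<lambda>i. inverse t * (x - q) i) = (\<lambda>i. inverse t * x i) - p"
      using assms(2) by (auto simp: q_def fun_eq_iff field_simps)
    then show ?thesis by (simp add: dilate_def)
  qed
  ultimately show ?case using weighted_op.move[of q "rat_space k" "\<lambda>\<gamma> x. x - \<gamma>"]
    by (intro exI[of _ "\<lambda>a x. a (x - q)"] conjI allI ext) assumption+
next
  case (add T e U e')
  then obtain T' U' where T': "translation_op (rat_space k) T' e" "\<forall>b. T' (dilate t b) = dilate t (T b)"
    and U': "translation_op (rat_space k) U' e'" "\<forall>b. U' (dilate t b) = dilate t (U b)" by blast
  have "dilate t (\<lambda>x. T b x + U b x) x = dilate t (T b) x + dilate t (U b) x" for b x
    by (simp add: dilate_def)
  then show ?case using weighted_op.add[OF T'(1) U'(1)] T'(2) U'(2)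
    by (intro exI[of _ "\<lambda>a x. T' a x + U' a x"] conjI allI ext) (assumption | simp)+
next
  case (scale T e c)
  then obtain T' where T': "translation_op (rat_space k) T' e" "\<forall>b. T' (dilate t b) = dilate t (T b)"
    by blast
  have "dilate t (\<lambda>x. c * T b x) x = c * dilate t (T b) x" for b x
    by (simp add: dilate_def)
  then show ?case using weighted_op.scale[OF T'(1), of c] T'(2)
    by (intro exI[of _ "\<lambda>a x. c * T' a x"] conjI allI ext) (assumption | simp)+
qed

lemma t_has_sum_dilate:
  assumes "t_has_sum (rat_space k) b S" "t \<noteq> 0"
  shows "t_has_sum (rat_space k) (dilate t b) S"
proof -
  obtain T e where T: "translation_op (rat_space k) T e" "e \<noteq> 0" "(T b has_sum (e * S)) (rat_space k)"
    by (rule t_has_sumE[OF assms(1)])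
  obtain T' where T': "translation_op (rat_space k) T' e" "\<forall>b. T' (dilate t b) = dilate t (T b)"
    using translation_op_dilate[OF T(1) assms(2)] by blast
  have "(T' (dilate t b) has_sum (e * S)) (rat_space k)"
    using dilate_has_sum[OF assms(2) T(3)] T'(2) by simp
  then show ?thesis by (rule t_has_sumI[OF T'(1) T(2)])
qed

lemma t_has_sum_dilation_op:
  assumes "dilation_op D e" "t_has_sum (rat_space k) b S"
  shows "t_has_sum (rat_space k) (D b) (e * S)"
  using assms(1)
proof induction
  case zero
  then show ?case by (simp add: has_sum_imp_t_has_sum has_sum_0)
next
  case (move t)
  then show ?case using t_has_sum_dilate[OF assms(2), of t] by (simp add: dilate_def[abs_def])
next
  case (add T e U e')
  then show ?case using RS.t_has_sum_add[OF add.IH] by (simp add: ring_distribs)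
next
  case (scale T e c)
  then show ?case using RS.t_has_sum_cmult[OF scale.IH, of c] by (simp add: mult.assoc)
qed

lemma h_has_sum_iff:
  "h_has_sum k a S \<longleftrightarrow>
    (\<exists>D e. dilation_op D e \<and> e \<noteq> 0 \<and> t_has_sum (rat_space k) (D a) (e * S))"
proof
  assume "h_has_sum k a S"
  then obtain c where c: "finite (gsupp (- {0}) c)" "sum c (gsupp (- {0}) c) \<noteq> 0"
    "t_summable (rat_space k) (\<lambda>x. \<Sum>t\<in>gsupp (- {0}) c. c t * dilate t a x)"
    "S = inverse (sum c (gsupp (- {0}) c)) *
        t_sum (rat_space k) (\<lambda>x. \<Sum>t\<in>gsupp (- {0}) c. c t * dilate t a x)"
    unfolding h_has_sum_def Let_def by blast
  let ?D = "\<lambda>a x. \<Sum>t\<in>gsupp (- {0}) c. c t * a (\<lambda>i. inverse t * x i)"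
  have D: "dilation_op ?D (sum c (gsupp (- {0}) c))"
    unfolding weighted_op_explicit using c(1) by blast
  have "t_has_sum (rat_space k) (?D a) (sum c (gsupp (- {0}) c) * S)"
  proof -
    obtain S0 where S0: "t_has_sum (rat_space k) (?D a) S0"
      using c(3) unfolding t_summable_def dilate_def by blast
    have "S = inverse (sum c (gsupp (- {0}) c)) * S0"
      using c(4) RS.t_sum_eq[OF S0] unfolding dilate_def by simp
    with c(2) have "sum c (gsupp (- {0}) c) * S = S0" by simp
    with S0 show ?thesis by simp
  qed
  with D c(2) show "\<exists>D e. dilation_op D e \<and> e \<noteq> 0 \<and> t_has_sum (rat_space k) (D a) (e * S)"
    by (intro exI conjI)
next
  assume "\<exists>D e. dilation_op D e \<and> e \<noteq> 0 \<and> t_has_sum (rat_space k) (D a) (e * S)"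
  then obtain D e where D: "dilation_op D e" "e \<noteq> 0" "t_has_sum (rat_space k) (D a) (e * S)"
    by (elim exE conjE) (rule that)
  from D(1) obtain c where c: "finite (gsupp (- {0}) c)" "e = sum c (gsupp (- {0}) c)"
    "D = (\<lambda>a x. \<Sum>t\<in>gsupp (- {0}) c. c t * a (\<lambda>i. inverse t * x i))"
    unfolding weighted_op_explicit by (elim exE conjE) (rule that)
  have *: "D a = (\<lambda>x. \<Sum>t\<in>gsupp (- {0}) c. c t * dilate t a x)"
    by (simp add: c(3) dilate_def)
  show "h_has_sum k a S"
    unfolding h_has_sum_def Let_def
    using D(2,3) c(1,2) RS.t_sum_eq[OF D(3)] unfolding * t_summable_def
    by (intro exI[of _ c]) auto
qed

lemma h_has_sumI:
  assumes "dilation_op D e" "e \<noteq> 0" "t_has_sum (rat_space k) (D a) (e * S)"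
  shows "h_has_sum k a S"
  unfolding h_has_sum_iff by (intro exI conjI) (rule assms)+

lemma h_has_sumE:
  assumes "h_has_sum k a S"
  obtains D e where "dilation_op D e" "e \<noteq> 0" "t_has_sum (rat_space k) (D a) (e * S)"
  using assms unfolding h_has_sum_iff by (elim exE conjE) (rule that)

text \<open>
  The t-sum of \<open>D a\<close> is forced by the h-sum of \<open>a\<close>, because dilation operators commute. This contains
  the uniqueness of h-sums. Its case \<open>e = 0\<close> is the obstruction to h-summability at a pole: then the
  t-sum of \<open>D a\<close> has to vanish.
\<close>

lemma h_has_sum_weight:
  assumes "dilation_op D e" "t_has_sum (rat_space k) (D a) S" "h_has_sum k a S'"
  shows "S = e * S'"
proof -
  obtain D' e' where D': "dilation_op D' e'" "e' \<noteq> 0" "t_has_sum (rat_space k) (D' a) (e' * S')"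
    by (rule h_has_sumE[OF assms(3)])
  have "t_has_sum (rat_space k) (D' (D a)) (e' * S)" "t_has_sum (rat_space k) (D (D' a)) (e * (e' * S'))"
    using t_has_sum_dilation_op[OF D'(1) assms(2)] t_has_sum_dilation_op[OF assms(1) D'(3)] by auto
  then have "e' * S = e * (e' * S')"
    unfolding dilation_op_comm[OF assms(1) D'(1)] by (rule RS.t_has_sum_unique)
  then show ?thesis using D'(2) by simp
qed

lemma h_has_sum_unique: "h_has_sum k a S \<Longrightarrow> h_has_sum k a S' \<Longrightarrow> S = S'"
  by (erule h_has_sumE) (drule h_has_sum_weight, assumption+, simp)

lemma h_sum_on_eq: "h_has_sum k (extend_zero M a) S \<Longrightarrow> h_sum_on k M a = S"
  unfolding h_sum_on_def using h_has_sum_unique by blast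

lemma h_has_sum_add:
  assumes "h_has_sum k a S" "h_has_sum k b S'"
  shows "h_has_sum k (\<lambda>x. a x + b x) (S + S')"
proof -
  obtain T e where T: "dilation_op T e" "e \<noteq> 0" "t_has_sum (rat_space k) (T a) (e * S)"
    by (rule h_has_sumE[OF assms(1)])
  obtain U f where U: "dilation_op U f" "f \<noteq> 0" "t_has_sum (rat_space k) (U b) (f * S')"
    by (rule h_has_sumE[OF assms(2)])
  have "U (T (\<lambda>x. a x + b x)) = (\<lambda>x. U (T a) x + T (U b) x)"
    by (simp add: weighted_op_plus[OF T(1)] weighted_op_plus[OF U(1)] dilation_op_comm[OF T(1) U(1)])
  then have "t_has_sum (rat_space k) (U (T (\<lambda>x. a x + b x))) (f * e * (S + S'))"
    using RS.t_has_sum_add[OF t_has_sum_dilation_op[OF U(1) T(3)] t_has_sum_dilation_op[OF T(1) U(3)]]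
    by (simp add: algebra_simps)
  then show ?thesis
    by (rule h_has_sumI[OF dilation_op_comp[OF U(1) T(1)], rotated]) (use T(2) U(2) in simp)
qed

lemma h_has_sum_cmult:
  assumes "h_has_sum k a S"
  shows "h_has_sum k (\<lambda>x. c * a x) (c * S)"
proof -
  obtain T e where T: "dilation_op T e" "e \<noteq> 0" "t_has_sum (rat_space k) (T a) (e * S)"
    by (rule h_has_sumE[OF assms(1)])
  have "t_has_sum (rat_space k) (T (\<lambda>x. c * a x)) (e * (c * S))"
    using RS.t_has_sum_cmult[OF T(3), of c] by (simp add: weighted_op_mult[OF T(1)] algebra_simps)
  then show ?thesis by (rule h_has_sumI[OF T(1,2)])
qed

lemma t_has_sum_imp_h_has_sum:
  assumes "t_has_sum (rat_space k) a S"
  shows "h_has_sum k a S"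
proof -
  have "dilation_op (dilate 1) 1" by (rule dilation_op_dilate) simp
  moreover have "dilate 1 a = a" by (auto simp: dilate_def)
  ultimately show ?thesis using assms by (intro h_has_sumI[of "dilate 1" 1]) simp_all
qed

lemma has_sum_imp_h_has_sum: "(a has_sum S) (rat_space k) \<Longrightarrow> h_has_sum k a S"
  by (simp add: has_sum_imp_t_has_sum t_has_sum_imp_h_has_sum)

lemma h_has_sum_sum:
  assumes "finite A" "\<And>i. i \<in> A \<Longrightarrow> h_has_sum k (a i) (S i)"
  shows "h_has_sum k (\<lambda>x. \<Sum>i\<in>A. a i x) (\<Sum>i\<in>A. S i)"
  using assms by (induction A rule: finite_induct)
    (auto intro: h_has_sum_add has_sum_imp_h_has_sum has_sum_0)

lemma h_has_sum_finite_support: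
  assumes "finite F" "F \<subseteq> rat_space k" "\<And>x. x \<notin> F \<Longrightarrow> a x = 0"
  shows "h_has_sum k a (\<Sum>x\<in>F. a x)"
proof -
  have "(a has_sum (\<Sum>x\<in>F. a x)) F" using assms(1) by (rule has_sum_finite)
  then have "(a has_sum (\<Sum>x\<in>F. a x)) (rat_space k)"
    using has_sum_cong_neutral[of "rat_space k" F a a] assms(2,3) by blast
  then show ?thesis by (rule has_sum_imp_h_has_sum)
qed


section \<open>Polynomial functions and averages over a cube\<close>

text \<open>
  \<open>fdeg n \<phi>\<close> says that all iterated differences of \<open>\<phi>\<close> of order \<open>n + 1\<close> vanish. This intrinsic
  form of being a polynomial of degree at most \<open>n\<close> is the only property of polynomials that the
  cancellation argument uses.
\<close>

primrec fdeg :: "nat \<Rightarrow> ('g::ab_group_add \<Rightarrow> 'c::comm_ring_1) \<Rightarrow> bool" where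
  "fdeg 0 \<phi> \<longleftrightarrow> (\<forall>y x. \<phi> (x - y) - \<phi> x = 0)"
| "fdeg (Suc n) \<phi> \<longleftrightarrow> (\<forall>y. fdeg n (\<lambda>x. \<phi> (x - y) - \<phi> x))"

lemma fdeg_0: "fdeg n (\<lambda>_. 0)"
  by (induction n) simp_all

lemma fdeg_const: "fdeg n (\<lambda>_. c)"
  by (cases n) (simp_all add: fdeg_0)

lemma fdeg_Suc: "fdeg n \<phi> \<Longrightarrow> fdeg (Suc n) \<phi>"
proof (induction n arbitrary: \<phi>)
  case (Suc n)
  have "fdeg (Suc n) (\<lambda>x. \<phi> (x - y) - \<phi> x)" for y
    by (rule Suc.IH) (use Suc.prems in simp)
  then show ?case by (simp only: fdeg.simps(2)) blast
qed simp

lemma fdeg_mono: "n \<le> m \<Longrightarrow> fdeg n \<phi> \<Longrightarrow> fdeg m \<phi>"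
  by (induction rule: dec_induct) (auto intro: fdeg_Suc simp del: fdeg.simps)

lemma fdeg_add: "fdeg n \<phi> \<Longrightarrow> fdeg n \<psi> \<Longrightarrow> fdeg n (\<lambda>x. \<phi> x + \<psi> x)"
proof (induction n arbitrary: \<phi> \<psi>)
  case (Suc n)
  have "fdeg n (\<lambda>x. (\<phi> (x - y) - \<phi> x) + (\<psi> (x - y) - \<psi> x))" for y
    using Suc by simp
  then show ?case by (simp add: algebra_simps)
qed (simp add: algebra_simps)

lemma fdeg_cmult: "fdeg n \<phi> \<Longrightarrow> fdeg n (\<lambda>x. c * \<phi> x)"
proof (induction n arbitrary: \<phi>)
  case (Suc n)
  have "fdeg n (\<lambda>x. c * (\<phi> (x - y) - \<phi> x))" for y
    using Suc by simp
  then show ?case by (simp add: right_diff_distrib)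
qed simp

lemma fdeg_of_real: "fdeg n \<phi> \<Longrightarrow> fdeg n (\<lambda>x. of_real (\<phi> x) :: 'c::{real_algebra_1,comm_ring_1})"
proof (induction n arbitrary: \<phi>)
  case (Suc n)
  have "fdeg n (\<lambda>x. of_real (\<phi> (x - y) - \<phi> x) :: 'c)" for y
    by (rule Suc.IH) (use Suc.prems in simp)
  then show ?case by simp
qed simp

text \<open>
  The difference of a product is \<open>\<Delta>\<phi> \<psi> + \<phi> \<Delta>\<psi> + \<Delta>\<phi> \<Delta>\<psi>\<close>, so the claim follows by induction on the sum of
  the degrees.
\<close>

lemma fdeg_mult: "fdeg n \<phi> \<Longrightarrow> fdeg m \<psi> \<Longrightarrow> fdeg (n + m) (\<lambda>x. \<phi> x * \<psi> x)"
proof (induction "n + m" arbitrary: n m \<phi> \<psi>)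
  case 0
  then show ?case by simp
next
  case (Suc l)
  show ?case
  proof (cases n)
    case 0
    have const: "\<phi> (x - y) = \<phi> x" for x y using Suc.prems(1) 0 by simp
    have "\<phi> x = \<phi> 0" for x using const[of x x] by simp
    then have "(\<lambda>x. \<phi> x * \<psi> x) = (\<lambda>x. \<phi> 0 * \<psi> x)" by metis
    then show ?thesis using fdeg_cmult[OF Suc.prems(2), of "\<phi> 0"] 0 by simp
  next
    case n: (Suc n')
    show ?thesis
    proof (cases m)
      case 0
      have const: "\<psi> (x - y) = \<psi> x" for x y using Suc.prems(2) 0 by simp
      have "\<psi> x = \<psi> 0" for x using const[of x x] by simp
      then have "(\<lambda>x. \<phi> x * \<psi> x) = (\<lambda>x. \<psi> 0 * \<phi> x)" by (metis mult.commute)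
      then show ?thesis using fdeg_cmult[OF Suc.prems(1), of "\<psi> 0"] 0 by simp
    next
      case m: (Suc m')
      have "fdeg l (\<lambda>x. \<phi> (x - y) * \<psi> (x - y) - \<phi> x * \<psi> x)" for y
      proof -
        have d\<phi>: "fdeg n' (\<lambda>x. \<phi> (x - y) - \<phi> x)" and d\<psi>: "fdeg m' (\<lambda>x. \<psi> (x - y) - \<psi> x)"
          using Suc.prems n m by simp_all
        have "fdeg l (\<lambda>x. (\<phi> (x - y) - \<phi> x) * \<psi> x)"
          using Suc.hyps(1)[OF _ d\<phi> Suc.prems(2)] Suc.hyps(2) n by simp
        moreover have "fdeg l (\<lambda>x. \<phi> x * (\<psi> (x - y) - \<psi> x))"
          using Suc.hyps(1)[OF _ Suc.prems(1) d\<psi>] Suc.hyps(2) m by simp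
        moreover have "fdeg l (\<lambda>x. (\<phi> (x - y) - \<phi> x) * (\<psi> (x - y) - \<psi> x))"
        proof -
          have "fdeg (Suc n') (\<lambda>x. \<phi> (x - y) - \<phi> x)" by (rule fdeg_Suc[OF d\<phi>])
          from Suc.hyps(1)[OF _ this d\<psi>] show ?thesis using Suc.hyps(2) n m by simp
        qed
        ultimately have "fdeg l (\<lambda>x. (\<phi> (x - y) - \<phi> x) * \<psi> x + \<phi> x * (\<psi> (x - y) - \<psi> x)
            + (\<phi> (x - y) - \<phi> x) * (\<psi> (x - y) - \<psi> x))"
          by (intro fdeg_add)
        moreover have "(\<phi> (x - y) - \<phi> x) * \<psi> x + \<phi> x * (\<psi> (x - y) - \<psi> x)
            + (\<phi> (x - y) - \<phi> x) * (\<psi> (x - y) - \<psi> x) = \<phi> (x - y) * \<psi> (x - y) - \<phi> x * \<psi> x" for x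
          by (simp add: algebra_simps)
        ultimately show ?thesis by simp
      qed
      then show ?thesis by (simp flip: Suc.hyps(2))
    qed
  qed
qed

lemma fdeg_power: "fdeg n \<phi> \<Longrightarrow> fdeg (l * n) (\<lambda>x. \<phi> x ^ l)"
proof (induction l)
  case 0
  show ?case by (simp add: fdeg_const)
next
  case (Suc l)
  then show ?case using fdeg_mult[of n \<phi> "l * n" "\<lambda>x. \<phi> x ^ l"] by simp
qed

context subgroup_like begin

lemma translation_op_funpow:
  assumes "translation_op \<Gamma> T e" "0 \<in> \<Gamma>"
  shows "translation_op \<Gamma> (T ^^ n) (e ^ n)"
proof (induction n)
  case 0
  have "translation_op \<Gamma> (\<lambda>a x. a (x - 0)) 1" by (rule weighted_op.move) (rule assms(2))
  then show ?case by (simp add: id_def)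
next
  case (Suc n)
  then show ?case using translation_op_comp[OF assms(1) Suc] by (simp add: comp_def)
qed

text \<open>
  If \<open>T\<close> kills the weight \<open>w\<close>, then one application of \<open>T\<close> to \<open>\<phi> w\<close> replaces the polynomial
  \<open>\<phi>\<close> by differences of \<open>\<phi>\<close>, multiplied by translates of \<open>w\<close> that \<open>T\<close> kills as well. So
  each application lowers the degree by one.
\<close>

lemma funpow_annihilates:
  fixes w \<phi> :: "'g \<Rightarrow> complex"
  assumes T: "translation_op \<Gamma> T e" "0 \<in> \<Gamma>" and w: "T w = (\<lambda>_. 0)" and \<phi>: "fdeg n \<phi>"
  shows "(T ^^ Suc n) (\<lambda>x. \<phi> x * w x) = (\<lambda>_. 0)"
proof -
  from T(1) obtain c where c: "finite (gsupp \<Gamma> c)"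
    "T = (\<lambda>a x. \<Sum>p\<in>gsupp \<Gamma> c. c p * a (x - p))" "e = sum c (gsupp \<Gamma> c)"
    unfolding weighted_op_explicit by (elim exE conjE) (rule that)
  let ?A = "gsupp \<Gamma> c"
  have Tx: "T a x = (\<Sum>p\<in>?A. c p * a (x - p))" for a x by (simp add: c(2))
  show ?thesis using w \<phi>
  proof (induction n arbitrary: \<phi> w)
    case 0
    have const: "\<phi> (x - y) = \<phi> x" for x y using 0(2) by simp
    have "T (\<lambda>x. \<phi> x * w x) x = 0" for x
    proof -
      have "T (\<lambda>x. \<phi> x * w x) x = \<phi> x * T w x"
        by (simp add: Tx const sum_distrib_left algebra_simps)
      with 0(1) show ?thesis by simp
    qed
    then show ?case by (simp add: fun_eq_iff)
  next
    case (Suc n)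
    define g where "g p = (\<lambda>x. \<phi> (x - p) - \<phi> x)" for p
    define v where "v p = (\<lambda>x. w (x - p))" for p
    have Tv: "T (v p) = (\<lambda>_. 0)" for p
    proof
      fix x
      have "T (v p) x = T w (x - p)" by (simp add: Tx v_def algebra_simps)
      then show "T (v p) x = 0" using Suc.prems(1) by simp
    qed
    \<comment> \<open>Subtracting \<open>\<phi> x * T w x\<close>, which is \<open>0\<close>, turns values of \<open>\<phi>\<close> into differences.\<close>
    have step: "T (\<lambda>x. \<phi> x * w x) x = (\<Sum>p\<in>?A. c p * (g p x * v p x))" for x
    proof -
      have "(\<Sum>p\<in>?A. c p * (g p x * v p x))
          = (\<Sum>p\<in>?A. c p * (\<phi> (x - p) * w (x - p))) - \<phi> x * (\<Sum>p\<in>?A. c p * w (x - p))"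
        by (simp add: g_def v_def sum_distrib_left algebra_simps sum_subtractf)
      also have "\<dots> = T (\<lambda>x. \<phi> x * w x) x - \<phi> x * T w x" by (simp add: Tx)
      finally show ?thesis using Suc.prems(1) by simp
    qed
    have lin: "translation_op \<Gamma> (T ^^ Suc n) (e ^ Suc n)"
      by (rule translation_op_funpow[OF T])
    have "(T ^^ Suc (Suc n)) (\<lambda>x. \<phi> x * w x) = (T ^^ Suc n) (T (\<lambda>x. \<phi> x * w x))"
      by (simp add: funpow_swap1)
    also have "T (\<lambda>x. \<phi> x * w x) = (\<lambda>x. \<Sum>p\<in>?A. c p * (g p x * v p x))"
      using step by (rule ext)
    also have "(T ^^ Suc n) \<dots> = (\<lambda>x. \<Sum>p\<in>?A. c p * (T ^^ Suc n) (\<lambda>x. g p x * v p x) x)"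
      by (simp only: weighted_op_of_sum[OF lin c(1)] weighted_op_mult[OF lin])
    also have "\<dots> = (\<lambda>x. 0)"
    proof -
      have "(T ^^ Suc n) (\<lambda>x. g p x * v p x) = (\<lambda>_. 0)" for p
        by (rule Suc.IH[OF Tv]) (use Suc.prems(2) in \<open>simp add: g_def\<close>)
      then show ?thesis by simp
    qed
    finally show ?case .
  qed
qed

end

definition lat_ind :: "nat \<Rightarrow> (nat \<Rightarrow> rat) \<Rightarrow> complex" where
  "lat_ind k x = (if x \<in> int_lattice k then 1 else 0)"

text \<open>
  The difference between counting lattice points and counting, with multiplicity \<open>m\<^sup>k\<close>, the points of the
  sublattice of multiples of \<open>m\<close>: its mean over any cube of side \<open>m\<close> is \<open>0\<close>.
\<close>

definition mod_weight :: "nat \<Rightarrow> nat \<Rightarrow> (nat \<Rightarrow> rat) \<Rightarrow> complex" where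
  "mod_weight k m x = lat_ind k x - of_nat m ^ k * dilate (of_nat m) (lat_ind k) x"

definition cube :: "nat \<Rightarrow> nat \<Rightarrow> (nat \<Rightarrow> rat) set" where
  "cube k m = (\<lambda>g i. if i < k then of_nat (g i) else 0) ` (PiE {..<k} (\<lambda>_. {..<m}))"

definition cube_avg :: "nat \<Rightarrow> nat \<Rightarrow> ((nat \<Rightarrow> rat) \<Rightarrow> complex) \<Rightarrow> (nat \<Rightarrow> rat) \<Rightarrow> complex" where
  "cube_avg k m a x = (\<Sum>y\<in>cube k m. inverse (of_nat m ^ k) * a (x - y))"

lemma finite_cube: "finite (cube k m)"
  by (simp add: cube_def finite_PiE)

lemma card_cube: "card (cube k m) = m ^ k"
proof -
  have "inj_on (\<lambda>g i. if i < k then of_nat (g i) else (0::rat)) (PiE {..<k} (\<lambda>_. {..<m}))"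
  proof (rule inj_onI)
    fix f g assume fg: "f \<in> PiE {..<k} (\<lambda>_. {..<m})" "g \<in> PiE {..<k} (\<lambda>_. {..<m})"
      "(\<lambda>i. if i < k then of_nat (f i) else (0::rat)) = (\<lambda>i. if i < k then of_nat (g i) else 0)"
    have "f i = g i" if "i < k" for i using fun_cong[OF fg(3), of i] that by simp
    then show "f = g" by (intro PiE_ext[OF fg(1,2)]) simp
  qed
  then show ?thesis unfolding cube_def by (subst card_image) (assumption, simp add: card_PiE)
qed

lemma cube_subset: "cube k m \<subseteq> int_lattice k"
  unfolding cube_def int_lattice_def rat_space_def by (intro image_subsetI) simp

lemma int_lattice_subset: "int_lattice k \<subseteq> rat_space k"
  by (auto simp: int_lattice_def)

lemma zero_in_int_lattice [simp]: "0 \<in> int_lattice k"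
  by (auto simp: int_lattice_def rat_space_def)

lemma int_lattice_diff: "x \<in> int_lattice k \<Longrightarrow> y \<in> int_lattice k \<Longrightarrow> x - y \<in> int_lattice k"
  by (auto simp: int_lattice_def rat_space_def)

lemma int_lattice_add: "x \<in> int_lattice k \<Longrightarrow> y \<in> int_lattice k \<Longrightarrow> x + y \<in> int_lattice k"
  by (auto simp: int_lattice_def rat_space_def)

interpretation IL: subgroup_like "int_lattice k" for k
  by unfold_locales (rule int_lattice_diff)

lemma translation_op_cube_avg:
  assumes "m > 0"
  shows "translation_op (int_lattice k) (cube_avg k m) 1"
proof -
  have 1: "translation_op (int_lattice k) (\<lambda>a x. \<Sum>y\<in>cube k m. inverse (of_nat m ^ k) * a (x - y))
      (\<Sum>y\<in>cube k m. inverse (of_nat m ^ k) * 1)"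
  proof (rule weighted_op_sum[OF finite_cube])
    fix y assume "y \<in> cube k m"
    then have "y \<in> int_lattice k" using cube_subset by blast
    from weighted_op.scale[OF weighted_op.move[OF this]]
    show "translation_op (int_lattice k) (\<lambda>a x. inverse (of_nat m ^ k) * a (x - y))
      (inverse (of_nat m ^ k) * 1)" .
  qed
  have 2: "(\<Sum>y\<in>cube k m. inverse (of_nat m ^ k) * (1::complex)) = 1"
    using assms by (simp add: card_cube)
  have 3: "cube_avg k m = (\<lambda>a x. \<Sum>y\<in>cube k m. inverse (of_nat m ^ k) * a (x - y))"
    by (intro ext) (rule cube_avg_def)
  show ?thesis unfolding 3 using 1 unfolding 2 .
qed

lemma weighted_op_mono:
  assumes "weighted_op I \<phi> T e" "I \<subseteq> J"
  shows "weighted_op J \<phi> T e"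
  using assms(1)
proof induction
  case zero
  show ?case by (rule weighted_op.zero)
next
  case (move p)
  then show ?case using assms(2) by (intro weighted_op.move) blast
next
  case (add T e U e')
  then show ?case by (intro weighted_op.add)
next
  case (scale T e c)
  then show ?case by (intro weighted_op.scale)
qed

lemma translation_op_support:
  assumes "translation_op (int_lattice k) T e" "\<And>x. x \<notin> int_lattice k \<Longrightarrow> a x = 0"
    "x \<notin> int_lattice k"
  shows "T a x = 0"
  using assms(1)
proof induction
  case (move p)
  have "x - p \<notin> int_lattice k" using int_lattice_add[of "x - p" k p] move assms(3) by auto
  then show ?case by (rule assms(2))
qed simp_all

lemma ex1_cube_residue:
  assumes "x \<in> int_lattice k" "m > 0"
  shows "\<exists>!y. y \<in> cube k m \<and> (\<lambda>i. inverse (of_nat m) * (x - y) i) \<in> int_lattice k"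
proof -
  define z where "z i = \<lfloor>x i\<rfloor>" for i
  have z: "x i = of_int (z i)" for i
    using assms(1) by (auto simp: int_lattice_def z_def elim!: Ints_cases)
  have xk: "x i = 0" if "i \<ge> k" for i
    using assms(1) that by (auto simp: int_lattice_def rat_space_def)
  define y :: "nat \<Rightarrow> rat" where "y i = (if i < k then of_nat (nat (z i mod int m)) else 0)" for i
  show ?thesis
  proof (rule ex1I[of _ y], intro conjI)
    show "y \<in> cube k m" unfolding cube_def
    proof (rule image_eqI)
      show "(\<lambda>i\<in>{..<k}. nat (z i mod int m)) \<in> PiE {..<k} (\<lambda>_. {..<m})"
        using assms(2) by (auto simp: nat_less_iff)
    qed (auto simp: y_def fun_eq_iff)
    have "inverse (of_nat m) * (x i - y i) = of_int (z i div int m)" for i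
    proof (cases "i < k")
      case True
      have "y i = of_int (z i mod int m)" using True assms(2) by (simp add: y_def)
      then have "x i - y i = of_int (int m * (z i div int m))"
        unfolding z by (simp flip: of_int_diff add: minus_mod_eq_mult_div)
      then show ?thesis using assms(2) by simp
    next
      case False
      then show ?thesis using xk[of i] z[of i] by (simp add: y_def)
    qed
    moreover have "(0::rat) = of_int (z i div int m)" if "i \<ge> k" for i
      using xk[OF that] z[of i] by simp
    ultimately show "(\<lambda>i. inverse (of_nat m) * (x - y) i) \<in> int_lattice k"
      by (auto simp: int_lattice_def rat_space_def)
  next
    fix y' assume y': "y' \<in> cube k m \<and> (\<lambda>i. inverse (of_nat m) * (x - y') i) \<in> int_lattice k"
    then obtain g where g: "g \<in> PiE {..<k} (\<lambda>_. {..<m})" "y' = (\<lambda>i. if i < k then of_nat (g i) else 0)"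
      by (auto simp: cube_def)
    have "y' i = y i" for i
    proof (cases "i < k")
      case True
      have "inverse (of_nat m) * (x i - y' i) \<in> \<int>" using y' by (auto simp: int_lattice_def)
      then obtain c where "inverse (of_nat m) * (x i - y' i) = of_int c" by (auto elim: Ints_cases)
      then have "x i - y' i = of_int (int m * c)" using assms(2) by (simp add: field_simps)
      then have "(of_int (z i) :: rat) = of_int (int (g i) + int m * c)"
        using True by (simp add: g(2) z algebra_simps)
      then have "z i = int (g i) + int m * c" by (simp only: of_int_eq_iff)
      moreover have "int (g i) < int m" using g(1) True by auto
      ultimately have "z i mod int m = int (g i)" by simp
      then show ?thesis using True by (simp add: y_def g(2))
    qed (simp add: y_def g(2))
    then show "y' = y" by (rule ext)
  qed
qed

lemma mod_weight_outside:
  assumes "x \<notin> int_lattice k" "m > 0"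
  shows "mod_weight k m x = 0"
proof -
  have "(\<lambda>i. inverse (of_nat m) * x i) \<notin> int_lattice k"
  proof
    assume "(\<lambda>i. inverse (of_nat m) * x i) \<in> int_lattice k"
    then have *: "inverse (of_nat m) * x i \<in> \<int>" "i \<ge> k \<Longrightarrow> inverse (of_nat m) * x i = 0" for i
      by (auto simp: int_lattice_def rat_space_def)
    have "x i = of_nat m * (inverse (of_nat m) * x i)" for i using assms(2) by simp
    then have "x i \<in> \<int>" "i \<ge> k \<Longrightarrow> x i = 0" for i using *[of i] by (metis Ints_mult Ints_of_nat mult_zero_right)+
    then show False using assms(1) by (auto simp: int_lattice_def rat_space_def)
  qed
  with assms(1) show ?thesis by (simp add: mod_weight_def lat_ind_def dilate_def)
qed

text \<open>
  At a lattice point the average over the cube of side \<open>m\<close> is \<open>1\<close> for the indicator of the lattice, and \<open>m\<^sup>-\<^sup>k\<close> for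
  that of its multiples of \<open>m\<close>, since every residue class modulo \<open>m\<close> meets the cube once.
\<close>

lemma cube_avg_mod_weight:
  assumes "m > 0"
  shows "cube_avg k m (mod_weight k m) = (\<lambda>_. 0)"
proof
  fix x
  show "cube_avg k m (mod_weight k m) x = 0"
  proof (cases "x \<in> int_lattice k")
    case False
    show ?thesis
      by (rule translation_op_support[OF translation_op_cube_avg[OF assms] _ False])
        (rule mod_weight_outside[OF _ assms])
  next
    case True
    let ?R = "\<lambda>y. (\<lambda>i. inverse (of_nat m) * (x - y) i) \<in> int_lattice k"
    obtain y0 where y0: "y0 \<in> cube k m \<and> ?R y0" and uniq: "\<And>y. y \<in> cube k m \<and> ?R y \<Longrightarrow> y = y0"
      using ex1_cube_residue[OF True assms] by (elim ex1E) blast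
    have 1: "(\<Sum>y\<in>cube k m. lat_ind k (x - y)) = of_nat m ^ k"
    proof -
      have "(\<Sum>y\<in>cube k m. lat_ind k (x - y)) = (\<Sum>y\<in>cube k m. 1)"
        by (rule sum.cong) (use cube_subset int_lattice_diff[OF True] in \<open>auto simp: lat_ind_def\<close>)
      then show ?thesis by (simp add: card_cube)
    qed
    have 2: "(\<Sum>y\<in>cube k m. dilate (of_nat m) (lat_ind k) (x - y)) = 1"
    proof -
      have "(\<Sum>y\<in>cube k m. dilate (of_nat m) (lat_ind k) (x - y)) = (\<Sum>y\<in>cube k m. if y = y0 then 1 else 0)"
      proof (rule sum.cong[OF refl])
        fix y assume "y \<in> cube k m"
        then have "?R y \<longleftrightarrow> y = y0" using y0 uniq by blast
        then show "dilate (of_nat m) (lat_ind k) (x - y) = (if y = y0 then 1 else 0)"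
          by (simp only: dilate_def lat_ind_def)
      qed
      then show ?thesis using y0 finite_cube by simp
    qed
    have "cube_avg k m (mod_weight k m) x = inverse (of_nat m ^ k) *
        ((\<Sum>y\<in>cube k m. lat_ind k (x - y))
         - of_nat m ^ k * (\<Sum>y\<in>cube k m. dilate (of_nat m) (lat_ind k) (x - y)))"
      by (simp only: cube_avg_def mod_weight_def sum_distrib_left right_diff_distrib sum_subtractf)
    then show ?thesis by (simp add: 1 2)
  qed
qed

section \<open>Homogeneous polynomial functions on rational space\<close>

text \<open>
  The summand \<open>1\<close> makes this size submultiplicative under subtraction (\<open>lsize_diff\<close>) and bounded
  below, so powers of it serve as uniform growth bounds.
\<close>

definition lsize :: "nat \<Rightarrow> (nat \<Rightarrow> rat) \<Rightarrow> real" where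
  "lsize k x = 1 + (\<Sum>i<k. \<bar>real_of_rat (x i)\<bar>)"

lemma lsize_ge_1: "lsize k x \<ge> 1"
  by (simp add: lsize_def sum_nonneg)

lemma lsize_pos: "lsize k x > 0"
  using lsize_ge_1[of k x] by linarith

lemma lsize_diff: "lsize k (x - y) \<le> lsize k y * lsize k x"
proof -
  have "(\<Sum>i<k. \<bar>real_of_rat ((x - y) i)\<bar>) \<le> (\<Sum>i<k. \<bar>real_of_rat (x i)\<bar> + \<bar>real_of_rat (y i)\<bar>)"
    unfolding minus_apply of_rat_diff by (intro sum_mono abs_triangle_ineq4)
  moreover have "0 \<le> (\<Sum>i<k. \<bar>real_of_rat (x i)\<bar>) * (\<Sum>i<k. \<bar>real_of_rat (y i)\<bar>)"
    by (simp add: sum_nonneg)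
  ultimately show ?thesis by (simp add: lsize_def sum.distrib algebra_simps)
qed

text \<open>
  The four properties of a homogeneous polynomial of degree \<open>q\<close> that are used later: it is polynomial, it
  scales, it grows like the \<open>q\<close>-th power of the size, and a translation changes it by an order less. The
  last bound is multiplied by the size in order to cover \<open>q = 0\<close>.
\<close>

definition hpoly :: "nat \<Rightarrow> nat \<Rightarrow> ((nat \<Rightarrow> rat) \<Rightarrow> real) \<Rightarrow> bool" where
  "hpoly k q \<phi> \<longleftrightarrow>
    (\<exists>n. fdeg n \<phi>) \<and>
    (\<forall>t x. \<phi> (\<lambda>i. t * x i) = of_rat t ^ q * \<phi> x) \<and>
    (\<exists>K. \<forall>x. \<bar>\<phi> x\<bar> \<le> K * lsize k x ^ q) \<and>
    (\<forall>y. \<exists>K. \<forall>x. \<bar>\<phi> (x - y) - \<phi> x\<bar> * lsize k x \<le> K * lsize k x ^ q)"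

lemma hpoly_const: "hpoly k 0 (\<lambda>_. c)"
  unfolding hpoly_def by (auto simp: fdeg_const intro: exI[of _ 0])

lemma hpoly_0: "hpoly k q (\<lambda>_. 0)"
  unfolding hpoly_def by (auto simp: fdeg_const intro: exI[of _ 0])

lemma hpoly_coord:
  assumes "i < k"
  shows "hpoly k 1 (\<lambda>x. real_of_rat (x i))"
  unfolding hpoly_def
proof (intro conjI allI)
  show "\<exists>n. fdeg n (\<lambda>x. real_of_rat (x i))"
    by (rule exI[of _ "Suc 0"]) (simp add: of_rat_diff)
  show "real_of_rat (t * x i) = real_of_rat t ^ 1 * real_of_rat (x i)" for t x
    by (simp add: of_rat_mult)
  show "\<exists>K. \<forall>x. \<bar>real_of_rat (x i)\<bar> \<le> K * lsize k x ^ 1"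
  proof (intro exI[of _ 1] allI)
    fix x
    have "\<bar>real_of_rat (x i)\<bar> \<le> (\<Sum>i<k. \<bar>real_of_rat (x i)\<bar>)"
      by (rule member_le_sum) (use assms in auto)
    then show "\<bar>real_of_rat (x i)\<bar> \<le> 1 * lsize k x ^ 1" by (simp add: lsize_def)
  qed
  show "\<exists>K. \<forall>x. \<bar>real_of_rat ((x - y) i) - real_of_rat (x i)\<bar> * lsize k x \<le> K * lsize k x ^ 1" for y
    by (intro exI[of _ "\<bar>real_of_rat (y i)\<bar>"]) (simp add: of_rat_diff)
qed

lemma hpoly_bound:
  assumes "hpoly k q \<phi>"
  obtains K where "K \<ge> 0" "\<And>x. \<bar>\<phi> x\<bar> \<le> K * lsize k x ^ q"
proof -
  obtain K where K: "\<And>x. \<bar>\<phi> x\<bar> \<le> K * lsize k x ^ q" using assms unfolding hpoly_def by blast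
  have "\<bar>\<phi> x\<bar> \<le> max 0 K * lsize k x ^ q" for x
  proof -
    have "K * lsize k x ^ q \<le> max 0 K * lsize k x ^ q"
      using lsize_pos[of k x] by (intro mult_right_mono) auto
    with K[of x] show ?thesis by linarith
  qed
  then show ?thesis by (intro that[of "max 0 K"]) auto
qed

lemma hpoly_diff_bound:
  assumes "hpoly k q \<phi>"
  obtains K where "K \<ge> 0" "\<And>x. \<bar>\<phi> (x - y) - \<phi> x\<bar> * lsize k x \<le> K * lsize k x ^ q"
proof -
  obtain K where K: "\<And>x. \<bar>\<phi> (x - y) - \<phi> x\<bar> * lsize k x \<le> K * lsize k x ^ q"
    using assms unfolding hpoly_def by blast
  have "\<bar>\<phi> (x - y) - \<phi> x\<bar> * lsize k x \<le> max 0 K * lsize k x ^ q" for x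
  proof -
    have "K * lsize k x ^ q \<le> max 0 K * lsize k x ^ q"
      using lsize_pos[of k x] by (intro mult_right_mono) auto
    with K[of x] show ?thesis by linarith
  qed
  then show ?thesis by (intro that[of "max 0 K"]) auto
qed

lemma hpoly_homogeneous: "hpoly k q \<phi> \<Longrightarrow> \<phi> (\<lambda>i. t * x i) = of_rat t ^ q * \<phi> x"
  unfolding hpoly_def by blast

lemma hpoly_fdeg: "hpoly k q \<phi> \<Longrightarrow> \<exists>n. fdeg n \<phi>"
  unfolding hpoly_def by blast

lemma hpoly_add:
  assumes "hpoly k q \<phi>" "hpoly k q \<psi>"
  shows "hpoly k q (\<lambda>x. \<phi> x + \<psi> x)"
  unfolding hpoly_def
proof (intro conjI allI)
  obtain n m where "fdeg n \<phi>" "fdeg m \<psi>" using assms hpoly_fdeg by blast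
  then show "\<exists>n. fdeg n (\<lambda>x. \<phi> x + \<psi> x)"
    by (intro exI[of _ "max n m"] fdeg_add) (erule fdeg_mono[rotated], simp)+
  show "\<phi> (\<lambda>i. t * x i) + \<psi> (\<lambda>i. t * x i) = real_of_rat t ^ q * (\<phi> x + \<psi> x)" for t x
    by (simp add: hpoly_homogeneous[OF assms(1)] hpoly_homogeneous[OF assms(2)] ring_distribs)
  obtain K L where K: "\<And>x. \<bar>\<phi> x\<bar> \<le> K * lsize k x ^ q" and L: "\<And>x. \<bar>\<psi> x\<bar> \<le> L * lsize k x ^ q"
    using hpoly_bound[OF assms(1)] hpoly_bound[OF assms(2)] by metis
  show "\<exists>K. \<forall>x. \<bar>\<phi> x + \<psi> x\<bar> \<le> K * lsize k x ^ q"
  proof (intro exI[of _ "K + L"] allI)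
    fix x show "\<bar>\<phi> x + \<psi> x\<bar> \<le> (K + L) * lsize k x ^ q"
      using K[of x] L[of x] by (simp add: distrib_right)
  qed
  fix y
  obtain K where K: "\<And>x. \<bar>\<phi> (x - y) - \<phi> x\<bar> * lsize k x \<le> K * lsize k x ^ q"
    using hpoly_diff_bound[OF assms(1)] by metis
  obtain L where L: "\<And>x. \<bar>\<psi> (x - y) - \<psi> x\<bar> * lsize k x \<le> L * lsize k x ^ q"
    using hpoly_diff_bound[OF assms(2)] by metis
  show "\<exists>K. \<forall>x. \<bar>\<phi> (x - y) + \<psi> (x - y) - (\<phi> x + \<psi> x)\<bar> * lsize k x \<le> K * lsize k x ^ q"
  proof (intro exI[of _ "K + L"] allI)
    fix x
    have "\<bar>\<phi> (x - y) + \<psi> (x - y) - (\<phi> x + \<psi> x)\<bar> * lsize k x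
        \<le> (\<bar>\<phi> (x - y) - \<phi> x\<bar> + \<bar>\<psi> (x - y) - \<psi> x\<bar>) * lsize k x"
      using lsize_pos[of k x] by (intro mult_right_mono) auto
    also have "\<dots> \<le> (K + L) * lsize k x ^ q"
      using K[of x] L[of x] by (simp add: distrib_right)
    finally show "\<bar>\<phi> (x - y) + \<psi> (x - y) - (\<phi> x + \<psi> x)\<bar> * lsize k x \<le> (K + L) * lsize k x ^ q" .
  qed
qed

lemma hpoly_mult:
  assumes "hpoly k q \<phi>" "hpoly k r \<psi>"
  shows "hpoly k (q + r) (\<lambda>x. \<phi> x * \<psi> x)"
  unfolding hpoly_def
proof (intro conjI allI)
  obtain n m where "fdeg n \<phi>" "fdeg m \<psi>" using assms hpoly_fdeg by blast
  then show "\<exists>n. fdeg n (\<lambda>x. \<phi> x * \<psi> x)" using fdeg_mult by blast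
  show "\<phi> (\<lambda>i. t * x i) * \<psi> (\<lambda>i. t * x i) = real_of_rat t ^ (q + r) * (\<phi> x * \<psi> x)" for t x
    by (simp add: hpoly_homogeneous[OF assms(1)] hpoly_homogeneous[OF assms(2)] power_add)
  obtain K where K: "K \<ge> 0" "\<And>x. \<bar>\<phi> x\<bar> \<le> K * lsize k x ^ q"
    using hpoly_bound[OF assms(1)] by metis
  obtain L where L: "L \<ge> 0" "\<And>x. \<bar>\<psi> x\<bar> \<le> L * lsize k x ^ r"
    using hpoly_bound[OF assms(2)] by metis
  show "\<exists>K. \<forall>x. \<bar>\<phi> x * \<psi> x\<bar> \<le> K * lsize k x ^ (q + r)"
  proof (intro exI[of _ "K * L"] allI)
    fix x
    have "\<bar>\<phi> x\<bar> * \<bar>\<psi> x\<bar> \<le> (K * lsize k x ^ q) * (L * lsize k x ^ r)"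
      using K L lsize_pos[of k x] by (intro mult_mono) auto
    then show "\<bar>\<phi> x * \<psi> x\<bar> \<le> K * L * lsize k x ^ (q + r)"
      by (simp add: abs_mult power_add algebra_simps)
  qed
  fix y
  obtain K' where K': "K' \<ge> 0" "\<And>x. \<bar>\<phi> (x - y) - \<phi> x\<bar> * lsize k x \<le> K' * lsize k x ^ q"
    using hpoly_diff_bound[OF assms(1)] by metis
  obtain L' where L': "L' \<ge> 0" "\<And>x. \<bar>\<psi> (x - y) - \<psi> x\<bar> * lsize k x \<le> L' * lsize k x ^ r"
    using hpoly_diff_bound[OF assms(2)] by metis
  show "\<exists>K. \<forall>x. \<bar>\<phi> (x - y) * \<psi> (x - y) - \<phi> x * \<psi> x\<bar> * lsize k x \<le> K * lsize k x ^ (q + r)"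
  proof (intro exI[of _ "K' * (L * lsize k y ^ r) + K * L'"] allI)
    fix x
    let ?N = "lsize k x"
    have N: "?N > 0" by (rule lsize_pos)
    have "\<bar>\<psi> (x - y)\<bar> \<le> L * lsize k (x - y) ^ r" by (rule L)
    also have "\<dots> \<le> L * (lsize k y * ?N) ^ r"
      using L(1) lsize_pos[of k "x - y"] lsize_diff by (intro mult_left_mono power_mono) auto
    finally have \<psi>: "\<bar>\<psi> (x - y)\<bar> \<le> (L * lsize k y ^ r) * ?N ^ r"
      by (simp add: power_mult_distrib)
    have "\<bar>\<phi> (x - y) * \<psi> (x - y) - \<phi> x * \<psi> x\<bar>
        = \<bar>(\<phi> (x - y) - \<phi> x) * \<psi> (x - y) + \<phi> x * (\<psi> (x - y) - \<psi> x)\<bar>"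
      by (simp add: algebra_simps)
    also have "\<dots> \<le> \<bar>\<phi> (x - y) - \<phi> x\<bar> * \<bar>\<psi> (x - y)\<bar> + \<bar>\<phi> x\<bar> * \<bar>\<psi> (x - y) - \<psi> x\<bar>"
      by (metis abs_mult abs_triangle_ineq)
    finally have "\<bar>\<phi> (x - y) * \<psi> (x - y) - \<phi> x * \<psi> x\<bar> * ?N
        \<le> (\<bar>\<phi> (x - y) - \<phi> x\<bar> * \<bar>\<psi> (x - y)\<bar> + \<bar>\<phi> x\<bar> * \<bar>\<psi> (x - y) - \<psi> x\<bar>) * ?N"
      using N by (intro mult_right_mono) auto
    also have "\<dots> = (\<bar>\<phi> (x - y) - \<phi> x\<bar> * ?N) * \<bar>\<psi> (x - y)\<bar> + \<bar>\<phi> x\<bar> * (\<bar>\<psi> (x - y) - \<psi> x\<bar> * ?N)"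
      by (simp add: algebra_simps)
    also have "\<dots> \<le> (K' * ?N ^ q) * ((L * lsize k y ^ r) * ?N ^ r) + (K * ?N ^ q) * (L' * ?N ^ r)"
    proof (rule add_mono)
      show "(\<bar>\<phi> (x - y) - \<phi> x\<bar> * ?N) * \<bar>\<psi> (x - y)\<bar> \<le> (K' * ?N ^ q) * ((L * lsize k y ^ r) * ?N ^ r)"
        by (rule mult_mono[OF K'(2) \<psi>]) (use K'(1) N in auto)
      show "\<bar>\<phi> x\<bar> * (\<bar>\<psi> (x - y) - \<psi> x\<bar> * ?N) \<le> (K * ?N ^ q) * (L' * ?N ^ r)"
        by (rule mult_mono[OF K(2) L'(2)]) (use K(1) N in auto)
    qed
    also have "\<dots> = (K' * (L * lsize k y ^ r) + K * L') * ?N ^ (q + r)"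
      by (simp add: power_add algebra_simps)
    finally show "\<bar>\<phi> (x - y) * \<psi> (x - y) - \<phi> x * \<psi> x\<bar> * ?N
        \<le> (K' * (L * lsize k y ^ r) + K * L') * ?N ^ (q + r)" .
  qed
qed

lemma hpoly_sum: "(\<And>i. i \<in> A \<Longrightarrow> hpoly k q (\<phi> i)) \<Longrightarrow> hpoly k q (\<lambda>x. \<Sum>i\<in>A. \<phi> i x)"
  by (induction A rule: infinite_finite_induct) (auto simp: hpoly_0 hpoly_add)

lemma hpoly_prod:
  "(\<And>i. i \<in> A \<Longrightarrow> hpoly k (q i) (\<phi> i)) \<Longrightarrow> hpoly k (\<Sum>i\<in>A. q i) (\<lambda>x. \<Prod>i\<in>A. \<phi> i x)"
  by (induction A rule: infinite_finite_induct) (auto simp: hpoly_const hpoly_mult)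

lemma hpoly_power: "hpoly k q \<phi> \<Longrightarrow> hpoly k (q * n) (\<lambda>x. \<phi> x ^ n)"
  by (induction n) (auto simp: hpoly_const hpoly_mult)

lemma hpoly_mpoly_at:
  assumes "homogeneous e Q" "Q \<in> mpolys k"
  shows "hpoly k e (mpoly_at Q)"
proof -
  have "hpoly k e (\<lambda>x. \<Sum>m\<in>Poly_Mapping.keys Q. Poly_Mapping.lookup Q m *
      (\<Prod>i\<in>Poly_Mapping.keys m. real_of_rat (x i) ^ Poly_Mapping.lookup m i))"
  proof (rule hpoly_sum)
    fix m assume m: "m \<in> Poly_Mapping.keys Q"
    have "hpoly k (\<Sum>i\<in>Poly_Mapping.keys m. 1 * Poly_Mapping.lookup m i)
        (\<lambda>x. \<Prod>i\<in>Poly_Mapping.keys m. real_of_rat (x i) ^ Poly_Mapping.lookup m i)"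
      by (rule hpoly_prod, rule hpoly_power, rule hpoly_coord)
        (use assms(2) m in \<open>auto simp: mpolys_def\<close>)
    from hpoly_mult[OF hpoly_const this]
    show "hpoly k e (\<lambda>x. Poly_Mapping.lookup Q m *
        (\<Prod>i\<in>Poly_Mapping.keys m. real_of_rat (x i) ^ Poly_Mapping.lookup m i))"
      using assms(1) m by (simp add: homogeneous_def)
  qed
  then show ?thesis by (simp add: mpoly_at_def[abs_def] mpoly_eval_def)
qed


section \<open>Binomial remainders and sums over the lattice\<close>

lemma pochhammer_norm_le:
  fixes s :: complex
  assumes "norm s \<le> S"
  shows "norm (pochhammer s n) \<le> pochhammer S n"
proof -
  have "norm (pochhammer s n) = (\<Prod>i<n. norm (s + of_nat i))"
    by (simp add: pochhammer_prod atLeast0LessThan prod_norm)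
  also have "\<dots> \<le> (\<Prod>i<n. S + of_nat i)"
  proof (rule prod_mono)
    fix i
    have "norm (s + of_nat i) \<le> norm s + norm (of_nat i :: complex)" by (rule norm_triangle_ineq)
    then show "0 \<le> norm (s + of_nat i) \<and> norm (s + of_nat i) \<le> S + of_nat i" using assms by simp
  qed
  finally show ?thesis by (simp add: pochhammer_prod atLeast0LessThan)
qed

text \<open>
  With \<open>u = B/A\<close> and \<open>\<bar>u\<bar> \<le> 1/2\<close>, the tail of the binomial series of \<open>(1 + u)\<^sup>-\<^sup>s\<close> is at most
  \<open>\<bar>u\<bar>\<^sup>L\<close> times a convergent series that depends only on a bound for \<open>\<bar>s\<bar>\<close>: the binomial coefficients
  are dominated by those with \<open>s\<close> replaced by \<open>-\<bar>S\<bar>\<close>.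
\<close>

lemma binomial_remainder:
  fixes S :: real
  obtains K where "K \<ge> 0" "\<And>(s::complex) A B :: real. norm s \<le> S \<Longrightarrow> A > 0 \<Longrightarrow> \<bar>B\<bar> \<le> A / 2 \<Longrightarrow>
    norm (of_real (A + B) powr (-s)
      - (\<Sum>l<L. ((-s) gchoose l) * of_real B ^ l * of_real A powr (-s - of_nat l)))
    \<le> K * (A powr (- Re s) * (\<bar>B\<bar> / A) ^ L)"
proof -
  define \<beta> where "\<beta> n = pochhammer \<bar>S\<bar> n / fact n" for n
  have \<beta>_nonneg: "\<beta> n \<ge> 0" for n
    by (simp add: \<beta>_def pochhammer_nonneg pochhammer_prod prod_nonneg)
  have "(\<lambda>n. ((-\<bar>S\<bar>) gchoose n) * (-1/2) ^ n) sums (1 + (-1/2 :: real)) powr (-\<bar>S\<bar>)"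
    by (rule gen_binomial_real) simp
  moreover have "((-\<bar>S\<bar>) gchoose n) * (-1/2) ^ n = \<beta> n * (1/2) ^ n" for n
    by (simp add: gbinomial_pochhammer \<beta>_def power_divide field_simps flip: power_mult_distrib)
  ultimately have summ: "summable (\<lambda>n. \<beta> n * (1/2) ^ n)" by (simp add: sums_iff)
  define K where "K = suminf (\<lambda>n. \<beta> (n + L) * (1/2) ^ n)"
  have "summable (\<lambda>n. \<beta> (n + L) * (1/2) ^ (n + L))"
    using summable_ignore_initial_segment[OF summ, of L] by simp
  then have "summable (\<lambda>n. 2 ^ L * (\<beta> (n + L) * (1/2) ^ (n + L)))" by (rule summable_mult)
  then have summ': "summable (\<lambda>n. \<beta> (n + L) * (1/2) ^ n)"
    by (simp add: power_add power_divide field_simps)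
  show ?thesis
  proof (rule that[of K])
    show "K \<ge> 0" unfolding K_def using summ' \<beta>_nonneg by (intro suminf_nonneg) auto
    fix s :: complex and A B :: real
    assume s: "norm s \<le> S" and A: "A > 0" and B: "\<bar>B\<bar> \<le> A / 2"
    define f where "f n = ((-s) gchoose n) * of_real B ^ n * of_real A powr (-s - of_nat n)" for n
    have "\<bar>B\<bar> < \<bar>A\<bar>" using A B by linarith
    from gen_binomial_complex'[OF this, of "-s"] have f: "f sums of_real (A + B) powr (-s)"
      by (simp add: f_def[abs_def] add.commute)
    have u: "\<bar>B\<bar> / A \<le> 1/2" "\<bar>B\<bar> / A \<ge> 0" using A B by (auto simp: field_simps)
    have nf: "norm (f n) \<le> \<beta> n * (A powr (- Re s) * (\<bar>B\<bar> / A) ^ n)" for n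
    proof -
      have "norm ((-s) gchoose n) \<le> \<beta> n"
        using pochhammer_norm_le[of s "\<bar>S\<bar>" n] s
        by (simp add: gbinomial_pochhammer \<beta>_def norm_mult norm_divide norm_power divide_right_mono)
      moreover have "norm (of_real B ^ n * of_real A powr (-s - of_nat n))
          = A powr (- Re s) * (\<bar>B\<bar> / A) ^ n"
        using A by (simp add: norm_mult norm_power norm_divide norm_powr_real_powr powr_diff powr_realpow power_divide)
      ultimately show ?thesis
        unfolding f_def mult.assoc norm_mult[of "(-s) gchoose n"]
        using A by (intro mult_mono) (auto simp: \<beta>_nonneg)
    qed
    have nf': "norm (f (n + L)) \<le> (A powr (- Re s) * (\<bar>B\<bar> / A) ^ L) * (\<beta> (n + L) * (1/2) ^ n)" for n
    proof -
      have "(\<bar>B\<bar> / A) ^ n \<le> (1/2) ^ n" using u by (intro power_mono) auto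
      then have "\<beta> (n + L) * (A powr (- Re s) * ((\<bar>B\<bar> / A) ^ L * (\<bar>B\<bar> / A) ^ n))
          \<le> \<beta> (n + L) * (A powr (- Re s) * ((\<bar>B\<bar> / A) ^ L * (1/2) ^ n))"
        using u \<beta>_nonneg by (intro mult_left_mono) auto
      with nf[of "n + L"] show ?thesis by (simp add: power_add mult_ac)
    qed
    have "of_real (A + B) powr (-s) - (\<Sum>l<L. f l) = suminf (\<lambda>n. f (n + L))"
      using f suminf_minus_initial_segment[of f L] by (simp add: sums_iff)
    also have "norm \<dots> \<le> suminf (\<lambda>n. (A powr (- Re s) * (\<bar>B\<bar> / A) ^ L) * (\<beta> (n + L) * (1/2) ^ n))"
      by (rule norm_suminf_le[OF nf' summable_mult[OF summ']])
    also have "\<dots> = K * (A powr (- Re s) * (\<bar>B\<bar> / A) ^ L)"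
      unfolding suminf_mult[OF summ'] K_def by (rule mult.commute)
    finally show "norm (of_real (A + B) powr (-s)
      - (\<Sum>l<L. ((-s) gchoose l) * of_real B ^ l * of_real A powr (-s - of_nat l)))
      \<le> K * (A powr (- Re s) * (\<bar>B\<bar> / A) ^ L)" by (simp add: f_def)
  qed
qed

lemma int_lattice_bij:
  "bij_betw (\<lambda>g i. if i < k then of_int (g i) else 0) (PiE {..<k} (\<lambda>_. UNIV)) (int_lattice k)"
proof (rule bij_betwI[where g = "\<lambda>x. restrict (\<lambda>i. \<lfloor>x i\<rfloor>) {..<k}"])
  show "(\<lambda>g i. if i < k then of_int (g i) else (0::rat)) \<in> (PiE {..<k} (\<lambda>_. UNIV)) \<rightarrow> int_lattice k"
    by (auto simp: int_lattice_def rat_space_def)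
  show "(\<lambda>x. restrict (\<lambda>i. \<lfloor>x i\<rfloor>) {..<k}) \<in> int_lattice k \<rightarrow> (PiE {..<k} (\<lambda>_. UNIV))"
    by auto
  show "restrict (\<lambda>i. \<lfloor>(if i < k then of_int (g i) else 0) :: rat\<rfloor>) {..<k} = g"
    if "g \<in> PiE {..<k} (\<lambda>_. UNIV)" for g
  proof
    fix i show "restrict (\<lambda>i. \<lfloor>(if i < k then of_int (g i) else 0) :: rat\<rfloor>) {..<k} i = g i"
      using PiE_arb[OF that, of i] by simp
  qed
  show "(\<lambda>i. if i < k then of_int (restrict (\<lambda>i. \<lfloor>x i\<rfloor>) {..<k} i) else 0) = x"
    if "x \<in> int_lattice k" for x
  proof
    fix i show "(if i < k then of_int (restrict (\<lambda>i. \<lfloor>x i\<rfloor>) {..<k} i) else 0) = x i"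
      using that by (auto simp: int_lattice_def rat_space_def elim!: Ints_cases)
  qed
qed

lemma summable_on_int_powr:
  assumes "r > 1"
  shows "(\<lambda>n::int. (1 + \<bar>real_of_int n\<bar>) powr (-r)) summable_on UNIV"
proof -
  have "summable (\<lambda>n. real (Suc n) powr (-r))"
    using assms by (subst summable_Suc_iff) (simp add: summable_real_powr_iff)
  then have nat: "(\<lambda>n. (1 + real n) powr (-r)) summable_on UNIV"
    by (subst summable_on_UNIV_nonneg_real_iff) (auto simp: add.commute)
  have "(\<lambda>n::int. (1 + \<bar>real_of_int n\<bar>) powr (-r)) summable_on range int"
    by (subst summable_on_reindex) (use nat in \<open>auto simp: o_def\<close>)
  moreover have "(\<lambda>n::int. (1 + \<bar>real_of_int n\<bar>) powr (-r)) summable_on range (\<lambda>n. - int n)"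
    by (subst summable_on_reindex) (use nat in \<open>auto simp: o_def inj_def\<close>)
  ultimately have "(\<lambda>n::int. (1 + \<bar>real_of_int n\<bar>) powr (-r)) summable_on (range int \<union> range (\<lambda>n. - int n))"
    by (rule summable_on_union)
  moreover have "range int \<union> range (\<lambda>n. - int n) = UNIV"
    by (auto simp: image_iff) (metis int_cases2)
  ultimately show ?thesis by simp
qed

text \<open>
  The size to the power \<open>k\<close> dominates the product of the \<open>1 + \<bar>x\<^sub>i\<bar>\<close>, so the sum is dominated by a
  product of \<open>k\<close> convergent one-dimensional sums.
\<close>

lemma summable_on_lsize_powr:
  assumes "r > real k"
  shows "(\<lambda>x. lsize k x powr (-r)) summable_on int_lattice k"
proof (cases "k = 0")
  case True
  have "int_lattice k \<subseteq> {\<lambda>_. 0}" using True by (auto simp: int_lattice_def rat_space_def)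
  then have "finite (int_lattice k)" by (rule finite_subset) simp
  then show ?thesis by (rule summable_on_finite)
next
  case False
  define r' where "r' = r / real k"
  have r': "r' > 1" "r = real k * r'" using assms False by (auto simp: r'_def field_simps)
  let ?u = "\<lambda>n::int. (1 + \<bar>real_of_int n\<bar>) powr (-r')"
  let ?E = "PiE {..<k} (\<lambda>_. UNIV :: int set)"
  have "Infinite_Sum.abs_summable_on (\<lambda>g. \<Prod>i\<in>{..<k}. ?u (g i)) ?E"
    unfolding abs_summable_equivalent
  proof (rule abs_summable_on_prod_PiE)
    show "Infinite_Set_Sum.abs_summable_on ?u UNIV"
      unfolding abs_summable_equivalent[symmetric] using summable_on_int_powr[OF r'(1)] by simp
  qed auto
  then have *: "(\<lambda>g. \<Prod>i\<in>{..<k}. ?u (g i)) summable_on ?E"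
    by (rule Infinite_Sum.abs_summable_summable)
  have "(\<lambda>g. lsize k (\<lambda>i. if i < k then of_int (g i) else 0) powr (-r)) summable_on ?E"
  proof (rule summable_on_comparison_test[OF *])
    fix g :: "nat \<Rightarrow> int"
    let ?N = "lsize k (\<lambda>i. if i < k then of_int (g i) else 0)"
    have N: "?N = 1 + (\<Sum>i<k. \<bar>real_of_int (g i)\<bar>)" by (simp add: lsize_def)
    have "(\<Prod>i<k. 1 + \<bar>real_of_int (g i)\<bar>) \<le> (\<Prod>i<k. ?N)"
    proof (rule prod_mono)
      fix i assume "i \<in> {..<k}"
      then have "\<bar>real_of_int (g i)\<bar> \<le> (\<Sum>i<k. \<bar>real_of_int (g i)\<bar>)"
        by (intro member_le_sum) auto
      then show "0 \<le> 1 + \<bar>real_of_int (g i)\<bar> \<and> 1 + \<bar>real_of_int (g i)\<bar> \<le> ?N" by (simp add: N)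
    qed
    then have le: "(\<Prod>i<k. 1 + \<bar>real_of_int (g i)\<bar>) \<le> ?N ^ k" by simp
    have pos: "(\<Prod>i<k. 1 + \<bar>real_of_int (g i)\<bar>) > 0" by (intro prod_pos) auto
    have "?N powr (-r) = (?N ^ k) powr (-r')"
      using lsize_pos by (simp add: powr_powr r'(2) flip: powr_realpow)
    also have "\<dots> \<le> (\<Prod>i<k. 1 + \<bar>real_of_int (g i)\<bar>) powr (-r')"
      using le pos r' by (intro powr_mono2') auto
    also have "\<dots> = (\<Prod>i\<in>{..<k}. ?u (g i))"
      by (simp add: prod_powr_distrib)
    finally show "?N powr (-r) \<le> (\<Prod>i\<in>{..<k}. ?u (g i))" .
  qed auto
  then show ?thesis
    using summable_on_reindex_bij_betw[OF int_lattice_bij, of "\<lambda>x. lsize k x powr (-r)" k] by simp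
qed

lemma finite_lsize_less: "finite {x \<in> int_lattice k. lsize k x < R}"
proof -
  have "{x \<in> int_lattice k. lsize k x < R} \<subseteq>
    (\<lambda>g i. if i < k then of_int (g i) else 0) ` PiE {..<k} (\<lambda>_. {-\<lceil>R\<rceil>..\<lceil>R\<rceil>})"
  proof
    fix x assume x: "x \<in> {x \<in> int_lattice k. lsize k x < R}"
    then have "x \<in> (\<lambda>g i. if i < k then of_int (g i) else 0) ` PiE {..<k} (\<lambda>_. UNIV)"
      using bij_betw_imp_surj_on[OF int_lattice_bij, of k] by blast
    then obtain g where g: "g \<in> PiE {..<k} (\<lambda>_. UNIV)" "x = (\<lambda>i. if i < k then of_int (g i) else 0)"
      by blast
    have "g i \<in> {-\<lceil>R\<rceil>..\<lceil>R\<rceil>}" if "i < k" for i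
    proof -
      have "\<bar>real_of_rat (x i)\<bar> \<le> (\<Sum>i<k. \<bar>real_of_rat (x i)\<bar>)"
        by (rule member_le_sum) (use that in auto)
      moreover have "\<bar>real_of_rat (x i)\<bar> = \<bar>real_of_int (g i)\<bar>"
        using that by (simp add: g(2) flip: of_int_abs)
      moreover have "1 + (\<Sum>i<k. \<bar>real_of_rat (x i)\<bar>) < R" using x unfolding lsize_def by blast
      ultimately have "\<bar>real_of_int (g i)\<bar> \<le> R" by linarith
      then show ?thesis by (simp add: abs_le_iff) linarith
    qed
    then have "g \<in> PiE {..<k} (\<lambda>_. {-\<lceil>R\<rceil>..\<lceil>R\<rceil>})" using g(1) by (auto simp: PiE_iff)
    then show "x \<in> (\<lambda>g i. if i < k then of_int (g i) else 0) ` PiE {..<k} (\<lambda>_. {-\<lceil>R\<rceil>..\<lceil>R\<rceil>})"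
      unfolding g(2) by (rule imageI)
  qed
  then show ?thesis by (rule finite_subset) (intro finite_imageI finite_PiE, auto)
qed

text \<open>
  The Weierstrass test with finitely many exceptional terms, which are bounded on the compact disc by
  continuity.
\<close>

lemma holomorphic_infsum:
  fixes f :: "'x \<Rightarrow> complex \<Rightarrow> complex"
  assumes holo: "\<And>x. x \<in> A \<Longrightarrow> f x holomorphic_on UNIV"
    and M: "M summable_on A" and X: "finite X"
    and bound: "\<And>x s. x \<in> A \<Longrightarrow> x \<notin> X \<Longrightarrow> norm s \<le> S \<Longrightarrow> norm (f x s) \<le> M x"
  shows "(\<lambda>s. \<Sum>\<^sub>\<infinity>x\<in>A. f x s) holomorphic_on ball 0 S"
    and "\<And>s. norm s \<le> S \<Longrightarrow> (\<lambda>x. f x s) summable_on A"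
proof -
  have "\<exists>B. \<forall>s. norm s \<le> S \<longrightarrow> norm (f x s) \<le> B" if "x \<in> A" for x
  proof -
    have "continuous_on (cball 0 S) (f x)"
      using holo[OF that] by (meson holomorphic_on_imp_continuous_on continuous_on_subset subset_UNIV)
    then have "bounded (f x ` cball 0 S)" by (intro compact_imp_bounded compact_continuous_image) auto
    then obtain B where "\<forall>y\<in>f x ` cball 0 S. norm y \<le> B" by (auto simp: bounded_iff)
    then show ?thesis by (intro exI[of _ B]) auto
  qed
  then obtain B where B: "\<And>x s. x \<in> A \<Longrightarrow> norm s \<le> S \<Longrightarrow> norm (f x s) \<le> B x" by metis
  define M' where "M' x = (if x \<in> X then B x else M x)" for x
  have "M' summable_on ((A - X) \<union> (A \<inter> X))"
  proof (rule summable_on_union)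
    have "M summable_on (A - X)" by (rule summable_on_subset_banach[OF M]) auto
    then show "M' summable_on (A - X)"
      by (rule summable_on_cong[THEN iffD1, rotated]) (simp add: M'_def)
    show "M' summable_on (A \<inter> X)" using X by (intro summable_on_finite) auto
  qed
  moreover have "(A - X) \<union> (A \<inter> X) = A" by blast
  ultimately have M': "M' summable_on A" by simp
  have le: "norm (f x s) \<le> M' x" if "x \<in> A" "s \<in> cball 0 S" for x s
    using that B bound by (auto simp: M'_def)
  show "(\<lambda>x. f x s) summable_on A" if "norm s \<le> S" for s
    by (rule Infinite_Sum.abs_summable_summable, rule summable_on_comparison_test[OF M'])
      (use le that in auto)
  have ul: "uniform_limit (cball 0 S) (\<lambda>Y s. \<Sum>x\<in>Y. f x s) (\<lambda>s. \<Sum>\<^sub>\<infinity>x\<in>A. f x s) (finite_subsets_at_top A)"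
    by (rule Weierstrass_m_test_general[OF le M'])
  have "eventually (\<lambda>Y. finite Y \<and> Y \<subseteq> A) (finite_subsets_at_top A)"
    by (rule eventually_finite_subsets_at_top_weakI) auto
  then have ev: "eventually (\<lambda>Y. continuous_on (cball 0 S) (\<lambda>s. \<Sum>x\<in>Y. f x s)
      \<and> (\<lambda>s. \<Sum>x\<in>Y. f x s) holomorphic_on ball 0 S) (finite_subsets_at_top A)"
  proof eventually_elim
    case (elim Y)
    then have "(\<lambda>s. \<Sum>x\<in>Y. f x s) holomorphic_on UNIV"
      by (intro holomorphic_on_sum holo) auto
    then show ?case
      by (meson holomorphic_on_imp_continuous_on continuous_on_subset holomorphic_on_subset subset_UNIV)
  qed
  show "(\<lambda>s. \<Sum>\<^sub>\<infinity>x\<in>A. f x s) holomorphic_on ball 0 S"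
    by (rule holomorphic_uniform_limit[OF ev ul]) auto
qed

lemma lattice_sum_holomorphic:
  fixes f :: "(nat \<Rightarrow> rat) \<Rightarrow> complex \<Rightarrow> complex"
  assumes holo: "\<And>x. f x holomorphic_on UNIV" and X: "finite X"
    and supp: "\<And>x s. x \<notin> int_lattice k \<Longrightarrow> f x s = 0"
    and bound: "\<And>x s. x \<in> int_lattice k \<Longrightarrow> x \<notin> X \<Longrightarrow> norm s \<le> S \<Longrightarrow>
      norm (f x s) \<le> C * lsize k x powr (- (real k + 1))"
  obtains h where "h holomorphic_on ball 0 S"
    "\<forall>s\<in>ball 0 S. ((\<lambda>x. f x s) has_sum h s) (rat_space k)"
proof -
  have summ: "(\<lambda>x. C * lsize k x powr (- (real k + 1))) summable_on int_lattice k"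
    by (intro summable_on_cmult_right summable_on_lsize_powr) simp
  note H = holomorphic_infsum[OF holo summ X bound]
  show ?thesis
  proof (rule that)
    show "(\<lambda>s. \<Sum>\<^sub>\<infinity>x\<in>int_lattice k. f x s) holomorphic_on ball 0 S" by (rule H(1))
    show "\<forall>s\<in>ball 0 S. ((\<lambda>x. f x s) has_sum (\<Sum>\<^sub>\<infinity>x\<in>int_lattice k. f x s)) (rat_space k)"
    proof
      fix s :: complex assume "s \<in> ball 0 S"
      then have "((\<lambda>x. f x s) has_sum (\<Sum>\<^sub>\<infinity>x\<in>int_lattice k. f x s)) (int_lattice k)"
        using H(2)[where s = s] by (intro has_sum_infsum) simp
      then show "((\<lambda>x. f x s) has_sum (\<Sum>\<^sub>\<infinity>x\<in>int_lattice k. f x s)) (rat_space k)"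
        by (subst has_sum_cong_neutral[where T = "int_lattice k" and g = "\<lambda>x. f x s"])
          (use int_lattice_subset supp in auto)
    qed
  qed
qed


section \<open>Powers of an elliptic form on the lattice\<close>

text \<open>
  The leading form, seen only on lattice points: ellipticity enters as a lower bound of the order of the
  \<open>d\<close>-th power of the size.
\<close>

locale elliptic_form =
  fixes k d :: nat and p :: "(nat \<Rightarrow> rat) \<Rightarrow> real" and c :: real
  assumes k: "k \<ge> 1" and d: "d \<ge> 1" and d_even: "even d"
    and p: "hpoly k d p" and c: "c > 0"
    and lower: "x \<in> int_lattice k \<Longrightarrow> x \<noteq> 0 \<Longrightarrow> p x \<ge> c * lsize k x ^ d"
begin

lemma p_pos: "x \<in> int_lattice k \<Longrightarrow> x \<noteq> 0 \<Longrightarrow> p x > 0"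
  using lower[of x] c lsize_pos[of k x] by (smt (verit) mult_pos_pos zero_less_power)

lemma p_zero: "p 0 = 0"
proof -
  have "p (\<lambda>i. 0 * (0::nat \<Rightarrow> rat) i) = of_rat 0 ^ d * p 0" by (rule hpoly_homogeneous[OF p])
  then show ?thesis using d by (auto simp: zero_fun_def power_0_left)
qed

text \<open>
  Both \<open>p x\<close> and \<open>1 / p x\<close> are at most a constant times the \<open>d\<close>-th power of the size. The resulting
  bound is crude for positive exponents, but it is uniform in \<open>\<bar>\<sigma>\<bar> \<le> S\<close>, and any fixed power can be
  compensated by more terms of an expansion.
\<close>

lemma p_powr_bound:
  obtains M where "M \<ge> 1" "\<And>x \<sigma> S. x \<in> int_lattice k \<Longrightarrow> x \<noteq> 0 \<Longrightarrow> \<bar>\<sigma>\<bar> \<le> S \<Longrightarrow>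
    p x powr (- \<sigma>) \<le> M powr S * lsize k x powr (real d * S)"
proof -
  obtain K where K: "K \<ge> 0" "\<And>x. \<bar>p x\<bar> \<le> K * lsize k x ^ d" using hpoly_bound[OF p] by metis
  define M where "M = max 1 (max K (1 / c))"
  show ?thesis
  proof (rule that[of M])
    show M1: "M \<ge> 1" by (simp add: M_def)
    fix x and \<sigma> S :: real assume x: "x \<in> int_lattice k" "x \<noteq> 0" and \<sigma>: "\<bar>\<sigma>\<bar> \<le> S"
    define N where "N = lsize k x"
    have N: "N \<ge> 1" "N ^ d \<ge> 1" using lsize_ge_1[of k x] by (auto simp: N_def)
    have px: "p x > 0" using p_pos[OF x] .
    have up: "p x \<le> M * N ^ d"
    proof -
      have "p x \<le> K * N ^ d" using K(2)[of x] px by (simp add: N_def)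
      also have "\<dots> \<le> M * N ^ d" using N by (intro mult_right_mono) (auto simp: M_def)
      finally show ?thesis .
    qed
    have lo: "1 / p x \<le> M * N ^ d"
    proof -
      have "1 / p x \<le> 1 / (c * N ^ d)"
        using lower[OF x] px c N by (intro divide_left_mono mult_pos_pos) (auto simp: N_def)
      also have "\<dots> \<le> 1 / c * 1" using c N by (simp add: field_simps)
      also have "\<dots> \<le> M * N ^ d" using N c M1 by (intro mult_mono) (auto simp: M_def)
      finally show ?thesis .
    qed
    have MN: "M * N ^ d \<ge> 1" using M1 N mult_mono[of 1 M 1 "N ^ d"] by simp
    have "p x powr (- \<sigma>) \<le> (M * N ^ d) powr \<bar>\<sigma>\<bar>"
    proof (cases "\<sigma> \<ge> 0")
      case True
      have "p x powr (- \<sigma>) = (1 / p x) powr \<sigma>" using px by (simp add: powr_minus_divide powr_divide)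
      also have "\<dots> \<le> (M * N ^ d) powr \<sigma>" using lo px True by (intro powr_mono2) auto
      finally show ?thesis using True by simp
    next
      case False
      then show ?thesis using up px powr_mono2[of "- \<sigma>" "p x" "M * N ^ d"] by simp
    qed
    also have "\<dots> \<le> (M * N ^ d) powr S" using MN \<sigma> by (intro powr_mono) auto
    also have "\<dots> = M powr S * N powr (real d * S)"
      using M1 N by (simp add: powr_mult powr_powr flip: powr_realpow)
    finally show "p x powr (- \<sigma>) \<le> M powr S * lsize k x powr (real d * S)" by (simp add: N_def)
  qed
qed

text \<open>
  A perturbation \<open>B\<close> of order \<open>d - 1\<close> is small compared to \<open>p x\<close> far out, so every further term of the
  binomial expansion gains one power of the size. This serves twice: for translations, with
  \<open>B = p (x - y) - p x\<close>, and for the lower order terms of a polynomial.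
\<close>

lemma perturbed_power_expansion:
  fixes S K1 :: real and L :: nat
  assumes K1: "K1 \<ge> 0"
  obtains C R where "C \<ge> 0"
    "\<forall>x B. x \<in> int_lattice k \<and> x \<noteq> 0 \<and> lsize k x \<ge> R \<and> \<bar>B\<bar> * lsize k x \<le> K1 * lsize k x ^ d \<longrightarrow>
      \<bar>B\<bar> \<le> p x / 2 \<and> (\<forall>s::complex. norm s \<le> S \<longrightarrow>
        norm (of_real (p x + B) powr (-s)
          - (\<Sum>l<L. ((-s) gchoose l) * of_real B ^ l * of_real (p x) powr (-s - of_nat l)))
        \<le> C * lsize k x powr (real d * S - real L))"
proof -
  obtain Kb where Kb: "Kb \<ge> 0" "\<And>(s::complex) A B :: real. norm s \<le> S \<Longrightarrow> A > 0 \<Longrightarrow> \<bar>B\<bar> \<le> A / 2 \<Longrightarrow>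
    norm (of_real (A + B) powr (-s)
      - (\<Sum>l<L. ((-s) gchoose l) * of_real B ^ l * of_real A powr (-s - of_nat l)))
    \<le> Kb * (A powr (- Re s) * (\<bar>B\<bar> / A) ^ L)"
    using binomial_remainder[of S L] by blast
  obtain M where M: "M \<ge> 1" "\<And>x \<sigma> S. x \<in> int_lattice k \<Longrightarrow> x \<noteq> 0 \<Longrightarrow> \<bar>\<sigma>\<bar> \<le> S \<Longrightarrow>
    p x powr (- \<sigma>) \<le> M powr S * lsize k x powr (real d * S)"
    using p_powr_bound by blast
  have ratio: "\<bar>B\<bar> / p x \<le> K1 / c * (1 / lsize k x)"
    if "x \<in> int_lattice k" "x \<noteq> 0" "\<bar>B\<bar> * lsize k x \<le> K1 * lsize k x ^ d" for x B
  proof -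
    let ?N = "lsize k x"
    have N: "?N > 0" by (rule lsize_pos)
    have "\<bar>B\<bar> \<le> K1 * ?N ^ d / ?N" using N that(3) by (simp add: field_simps)
    then have "\<bar>B\<bar> / p x \<le> (K1 * ?N ^ d / ?N) / (c * ?N ^ d)"
      using p_pos[OF that(1,2)] lower[OF that(1,2)] c N K1 by (intro frac_le) auto
    also have "\<dots> = K1 / c * (1 / ?N)" using N c by (simp add: field_simps)
    finally show ?thesis .
  qed
  have half: "\<bar>B\<bar> \<le> p x / 2"
    if "x \<in> int_lattice k" "x \<noteq> 0" "lsize k x \<ge> 2 * K1 / c" "\<bar>B\<bar> * lsize k x \<le> K1 * lsize k x ^ d" for x B
  proof -
    have "K1 / c * (1 / lsize k x) \<le> 1 / 2" using that(3) c lsize_pos[of k x] by (simp add: field_simps)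
    then have "\<bar>B\<bar> / p x \<le> 1 / 2" using ratio[OF that(1,2,4)] by linarith
    then show ?thesis using p_pos[OF that(1,2)] by (simp add: field_simps)
  qed
  show ?thesis
  proof (rule that[of "Kb * (M powr S * (K1 / c) ^ L)" "2 * K1 / c"])
    show "0 \<le> Kb * (M powr S * (K1 / c) ^ L)" using Kb(1) K1 c by simp
    let ?C = "Kb * (M powr S * (K1 / c) ^ L)"
    show "\<forall>x B. x \<in> int_lattice k \<and> x \<noteq> 0 \<and> lsize k x \<ge> 2 * K1 / c \<and> \<bar>B\<bar> * lsize k x \<le> K1 * lsize k x ^ d \<longrightarrow>
      \<bar>B\<bar> \<le> p x / 2 \<and> (\<forall>s::complex. norm s \<le> S \<longrightarrow>
        norm (of_real (p x + B) powr (-s)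
          - (\<Sum>l<L. ((-s) gchoose l) * of_real B ^ l * of_real (p x) powr (-s - of_nat l)))
        \<le> ?C * lsize k x powr (real d * S - real L))"
    proof (intro allI impI, elim conjE, intro conjI allI impI)
      fix x B and s :: complex
      assume x: "x \<in> int_lattice k" "x \<noteq> 0" and R: "lsize k x \<ge> 2 * K1 / c"
        and B: "\<bar>B\<bar> * lsize k x \<le> K1 * lsize k x ^ d"
      show "\<bar>B\<bar> \<le> p x / 2" by (rule half[OF x R B])
      assume s: "norm s \<le> S"
      let ?N = "lsize k x"
      have N: "?N > 0" by (rule lsize_pos)
      have px: "p x > 0" by (rule p_pos[OF x])
      have "norm (of_real (p x + B) powr (-s)
          - (\<Sum>l<L. ((-s) gchoose l) * of_real B ^ l * of_real (p x) powr (-s - of_nat l)))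
        \<le> Kb * (p x powr (- Re s) * (\<bar>B\<bar> / p x) ^ L)"
        by (rule Kb(2)[OF s px half[OF x R B]])
      also have "\<dots> \<le> Kb * (M powr S * ?N powr (real d * S) * (K1 / c * (1 / ?N)) ^ L)"
      proof (intro mult_left_mono mult_mono power_mono)
        show "p x powr (- Re s) \<le> M powr S * ?N powr (real d * S)"
          using abs_Re_le_cmod[of s] s by (intro M(2)[OF x]) linarith
      qed (use ratio[OF x B] Kb px in auto)
      also have "(K1 / c * (1 / ?N)) ^ L = (K1 / c) ^ L * ?N powr (- real L)"
        using N by (simp add: power_mult_distrib power_one_over powr_minus powr_realpow field_simps)
      also have "Kb * (M powr S * ?N powr (real d * S) * ((K1 / c) ^ L * ?N powr (- real L)))
          = Kb * (M powr S * (K1 / c) ^ L) * ?N powr (real d * S - real L)"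
        by (simp add: powr_diff powr_minus divide_inverse)
      finally show "norm (of_real (p x + B) powr (-s)
          - (\<Sum>l<L. ((-s) gchoose l) * of_real B ^ l * of_real (p x) powr (-s - of_nat l)))
        \<le> ?C * ?N powr (real d * S - real L)" .
    qed
  qed
qed

text \<open>
  The value \<open>0\<close> at the origin keeps the relation under dilations valid there.
\<close>

definition pterm :: "((nat \<Rightarrow> rat) \<Rightarrow> real) \<Rightarrow> complex \<Rightarrow> (nat \<Rightarrow> rat) \<Rightarrow> complex" where
  "pterm \<phi> s x = (if x = 0 then 0 else of_real (\<phi> x) * of_real (p x) powr (- s))"

definition zterm :: "((nat \<Rightarrow> rat) \<Rightarrow> real) \<Rightarrow> complex \<Rightarrow> (nat \<Rightarrow> rat) \<Rightarrow> complex" where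
  "zterm \<phi> s x = pterm \<phi> s x * lat_ind k x"

text \<open>
  Expand \<open>p (x - y) powr (-s)\<close> around \<open>p x\<close> for the finitely many translations \<open>y\<close> in the
  iterated average. For fixed \<open>x\<close> the terms of the expansion are, as functions of \<open>z = x - y\<close>, the polynomials
  \<open>\<phi> z * (p z - p x) ^ l\<close> times \<open>w z\<close>, and the average annihilates them exactly. What
  remains is the binomial remainder, which is of order \<open>L\<close> below the leading one.
\<close>

lemma cube_avg_pterm_decay:
  fixes S :: real and L :: nat
  assumes \<phi>: "hpoly k q \<phi>" and m: "m > 0" and w0: "cube_avg k m w = (\<lambda>_. 0)"
    and W: "\<And>x. norm (w x) \<le> W"
  obtains N K X where "finite X"
    "\<forall>s x. norm s \<le> S \<and> x \<in> int_lattice k \<and> x \<notin> X \<longrightarrow>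
      norm ((cube_avg k m ^^ N) (\<lambda>x. pterm \<phi> s x * w x) x)
        \<le> K * lsize k x powr (real q + real d * S - real L)"
proof -
  obtain n1 where n1: "fdeg n1 \<phi>" using hpoly_fdeg[OF \<phi>] by blast
  obtain n2 where n2: "fdeg n2 p" using hpoly_fdeg[OF p] by blast
  \<comment> \<open>A bound for the degrees of \<open>\<phi> z * (p z - a) ^ l\<close> with \<open>l < L\<close>, uniform in \<open>a\<close>.\<close>
  define n where "n = n1 + L * n2"
  define T where "T = cube_avg k m ^^ Suc n"
  have deg: "fdeg n (\<lambda>z. complex_of_real (\<phi> z * (p z - a) ^ l))" if "l < L" for l a
  proof (rule fdeg_of_real)
    have "fdeg n2 (\<lambda>z. p z + - a)" by (intro fdeg_add n2 fdeg_const)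
    from fdeg_mult[OF n1 fdeg_power[OF this, of l]]
    have "fdeg (n1 + l * n2) (\<lambda>z. \<phi> z * (p z - a) ^ l)" by simp
    moreover have "n1 + l * n2 \<le> n" using that by (simp add: n_def mult_right_mono)
    ultimately show "fdeg n (\<lambda>z. \<phi> z * (p z - a) ^ l)" by (blast intro: fdeg_mono)
  qed
  have B: "translation_op (int_lattice k) (cube_avg k m) 1" by (rule translation_op_cube_avg[OF m])
  have kill: "T (\<lambda>z. of_real (\<phi> z * (p z - a) ^ l) * w z) = (\<lambda>_. 0)" if "l < L" for l a
    unfolding T_def by (rule IL.funpow_annihilates[OF B _ w0 deg[OF that]]) simp
  have "translation_op (int_lattice k) T (1 ^ Suc n)"
    unfolding T_def by (rule IL.translation_op_funpow[OF B]) simp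
  then obtain co where "finite (gsupp (int_lattice k) co)"
    and Tco: "T = (\<lambda>a x. \<Sum>y\<in>gsupp (int_lattice k) co. co y * a (x - y))"
    unfolding weighted_op_explicit by (elim exE conjE) (rule that)
  define Y where "Y = gsupp (int_lattice k) co"
  have Y: "finite Y" "\<And>y. y \<in> Y \<Longrightarrow> y \<in> int_lattice k"
    using \<open>finite (gsupp (int_lattice k) co)\<close> by (auto simp: Y_def gsupp_def)
  have Tx: "T a x = (\<Sum>y\<in>Y. co y * a (x - y))" for a x by (simp add: Tco Y_def)

  have "\<forall>y. \<exists>K\<ge>0. \<forall>x. \<bar>p (x - y) - p x\<bar> * lsize k x \<le> K * lsize k x ^ d"
    using hpoly_diff_bound[OF p] by metis
  then obtain Ky where Ky: "\<And>y. Ky y \<ge> 0" "\<And>x y. \<bar>p (x - y) - p x\<bar> * lsize k x \<le> Ky y * lsize k x ^ d"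
    by metis
  define K1 where "K1 = (\<Sum>y\<in>Y. Ky y)"
  have K1: "K1 \<ge> 0" "\<And>y. y \<in> Y \<Longrightarrow> Ky y \<le> K1"
    using Ky(1) Y(1) by (auto simp: K1_def intro: sum_nonneg member_le_sum)
  obtain K\<phi> where K\<phi>: "K\<phi> \<ge> 0" "\<And>x. \<bar>\<phi> x\<bar> \<le> K\<phi> * lsize k x ^ q" using hpoly_bound[OF \<phi>] by metis
  obtain C R where C: "C \<ge> 0" and
    expand: "\<forall>x B. x \<in> int_lattice k \<and> x \<noteq> 0 \<and> lsize k x \<ge> R \<and> \<bar>B\<bar> * lsize k x \<le> K1 * lsize k x ^ d \<longrightarrow>
      \<bar>B\<bar> \<le> p x / 2 \<and> (\<forall>s::complex. norm s \<le> S \<longrightarrow>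
        norm (of_real (p x + B) powr (-s)
          - (\<Sum>l<L. ((-s) gchoose l) * of_real B ^ l * of_real (p x) powr (-s - of_nat l)))
        \<le> C * lsize k x powr (real d * S - real L))"
    by (rule perturbed_power_expansion[OF K1(1), of S L]) (rule that)
  have W0: "W \<ge> 0" by (rule order_trans[OF norm_ge_zero W[of 0]])
  define X where "X = insert 0 {x \<in> int_lattice k. lsize k x < R}"
  define Ct where "Ct y = norm (co y) * (K\<phi> * lsize k y ^ q) * C * W" for y
  show ?thesis
  proof (rule that[of X "Suc n" "\<Sum>y\<in>Y. Ct y"])
    show "finite X" by (simp add: X_def finite_lsize_less)
    show "\<forall>s x. norm s \<le> S \<and> x \<in> int_lattice k \<and> x \<notin> X \<longrightarrow>
      norm ((cube_avg k m ^^ Suc n) (\<lambda>x. pterm \<phi> s x * w x) x)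
        \<le> (\<Sum>y\<in>Y. Ct y) * lsize k x powr (real q + real d * S - real L)"
    proof (intro allI impI, elim conjE)
      fix s :: complex and x
      assume s: "norm s \<le> S" and x: "x \<in> int_lattice k" "x \<notin> X"
      define N where "N = lsize k x"
      have x0: "x \<noteq> 0" and N: "N \<ge> R" "N \<ge> 1" using x lsize_ge_1[of k x] by (auto simp: X_def N_def)
      define \<Delta> where "\<Delta> y = p (x - y) - p x" for y
      have \<Delta>: "\<bar>\<Delta> y\<bar> * N \<le> K1 * N ^ d" if "y \<in> Y" for y
      proof -
        have "\<bar>\<Delta> y\<bar> * N \<le> Ky y * N ^ d" using Ky(2)[of x y] by (simp add: N_def \<Delta>_def)
        also have "\<dots> \<le> K1 * N ^ d" using K1(2)[OF that] N by (intro mult_right_mono) auto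
        finally show ?thesis .
      qed
      define Er where "Er y = of_real (p x + \<Delta> y) powr (-s)
        - (\<Sum>l<L. ((-s) gchoose l) * of_real (\<Delta> y) ^ l * of_real (p x) powr (-s - of_nat l))" for y
      have pt: "pterm \<phi> s (x - y) = of_real (\<phi> (x - y)) *
          (Er y + (\<Sum>l<L. ((-s) gchoose l) * of_real (\<Delta> y) ^ l * of_real (p x) powr (-s - of_nat l)))"
        if "y \<in> Y" for y
      proof -
        have pxy: "p (x - y) = p x + \<Delta> y" by (simp add: \<Delta>_def)
        \<comment> \<open>The origin, where \<open>pterm\<close> has an exceptional value, is not reached: \<open>p (x - y)\<close> is at least \<open>p x / 2\<close>.\<close>
      have "x - y \<noteq> 0"
        proof
          assume "x - y = 0"
          then have "p (x - y) = 0" by (simp only: p_zero)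
          then show False
            using pxy expand x(1) x0 \<Delta>[OF that] N p_pos[OF x(1) x0] unfolding N_def by fastforce
        qed
        then show ?thesis unfolding pterm_def pxy Er_def by simp
      qed
      \<comment> \<open>For each \<open>l\<close> the sum over \<open>y\<close> is \<open>T\<close> applied to a polynomial times \<open>w\<close>, evaluated at \<open>x\<close>.\<close>
    have main: "(\<Sum>y\<in>Y. co y * (of_real (\<phi> (x - y)) *
          (\<Sum>l<L. ((-s) gchoose l) * of_real (\<Delta> y) ^ l * of_real (p x) powr (-s - of_nat l)) * w (x - y))) = 0"
      proof -
        have "(\<Sum>y\<in>Y. co y * (of_real (\<phi> (x - y)) *
          (\<Sum>l<L. ((-s) gchoose l) * of_real (\<Delta> y) ^ l * of_real (p x) powr (-s - of_nat l)) * w (x - y)))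
          = (\<Sum>y\<in>Y. \<Sum>l<L. ((-s) gchoose l) * of_real (p x) powr (-s - of_nat l) *
              (co y * (of_real (\<phi> (x - y) * (p (x - y) - p x) ^ l) * w (x - y))))"
          by (simp add: sum_distrib_left sum_distrib_right \<Delta>_def mult_ac)
        also have "\<dots> = (\<Sum>l<L. ((-s) gchoose l) * of_real (p x) powr (-s - of_nat l) *
              T (\<lambda>z. of_real (\<phi> z * (p z - p x) ^ l) * w z) x)"
          unfolding Tx sum_distrib_left by (rule sum.swap)
        also have "\<dots> = 0"
        proof (intro sum.neutral ballI)
          fix l assume "l \<in> {..<L}"
          then have "l < L" by simp
          show "((-s) gchoose l) * of_real (p x) powr (-s - of_nat l) *
              T (\<lambda>z. of_real (\<phi> z * (p z - p x) ^ l) * w z) x = 0"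
            unfolding kill[OF \<open>l < L\<close>] by simp
        qed
        finally show ?thesis .
      qed
      have "T (\<lambda>x. pterm \<phi> s x * w x) x = (\<Sum>y\<in>Y. co y * (of_real (\<phi> (x - y)) * Er y * w (x - y)))
         + (\<Sum>y\<in>Y. co y * (of_real (\<phi> (x - y)) *
          (\<Sum>l<L. ((-s) gchoose l) * of_real (\<Delta> y) ^ l * of_real (p x) powr (-s - of_nat l)) * w (x - y)))"
        unfolding Tx sum.distrib[symmetric]
        by (rule sum.cong[OF refl]) (simp only: pt ring_distribs)
      then have "norm (T (\<lambda>x. pterm \<phi> s x * w x) x)
          = norm (\<Sum>y\<in>Y. co y * (of_real (\<phi> (x - y)) * Er y * w (x - y)))"
        unfolding main by simp
      also have "\<dots> \<le> (\<Sum>y\<in>Y. Ct y * N powr (real q + real d * S - real L))"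
      proof (rule sum_norm_le)
        fix y assume y: "y \<in> Y"
        have "\<bar>\<phi> (x - y)\<bar> \<le> K\<phi> * lsize k (x - y) ^ q" by (rule K\<phi>(2))
        also have "\<dots> \<le> K\<phi> * (lsize k y * N) ^ q"
          using K\<phi>(1) lsize_pos[of k "x - y"] lsize_diff[of k x y]
          by (intro mult_left_mono power_mono) (auto simp: N_def)
        finally have b1: "\<bar>\<phi> (x - y)\<bar> \<le> K\<phi> * lsize k y ^ q * N powr real q"
          using N by (simp add: power_mult_distrib powr_realpow)
        have b2: "norm (Er y) \<le> C * N powr (real d * S - real L)"
          unfolding Er_def using expand x(1) x0 \<Delta>[OF y] N(1) s unfolding N_def by blast
        have "norm (co y * (of_real (\<phi> (x - y)) * Er y * w (x - y)))
            = norm (co y) * (\<bar>\<phi> (x - y)\<bar> * norm (Er y) * norm (w (x - y)))"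
          by (simp add: norm_mult)
        also have "\<dots> \<le> norm (co y) * ((K\<phi> * lsize k y ^ q * N powr real q) *
            (C * N powr (real d * S - real L)) * W)"
          using b1 b2 W[of "x - y"] W0 K\<phi>(1) C lsize_pos[of k y]
          by (intro mult_left_mono mult_mono mult_nonneg_nonneg) auto
        also have "\<dots> = Ct y * (N powr real q * N powr (real d * S - real L))"
          by (simp add: Ct_def mult_ac)
        also have "N powr real q * N powr (real d * S - real L) = N powr (real q + real d * S - real L)"
          by (simp add: add_diff_eq flip: powr_add)
        finally show "norm (co y * (of_real (\<phi> (x - y)) * Er y * w (x - y)))
            \<le> Ct y * N powr (real q + real d * S - real L)" .
      qed
      finally show "norm ((cube_avg k m ^^ Suc n) (\<lambda>x. pterm \<phi> s x * w x) x)
          \<le> (\<Sum>y\<in>Y. Ct y) * lsize k x powr (real q + real d * S - real L)"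
        by (simp add: T_def N_def sum_distrib_right)
    qed
  qed
qed

lemma pterm_holomorphic: "x \<in> int_lattice k \<Longrightarrow> (\<lambda>s. pterm \<phi> s x) holomorphic_on UNIV"
proof (cases "x = 0")
  case True
  then show ?thesis by (simp add: pterm_def)
next
  case False
  assume "x \<in> int_lattice k"
  then have "p x > 0" using p_pos False by blast
  then have "(\<lambda>s. of_real (\<phi> x) * exp (- s * of_real (ln (p x)))) holomorphic_on UNIV"
    by (intro holomorphic_intros)
  then show ?thesis using False \<open>p x > 0\<close> by (simp add: pterm_def powr_def Ln_of_real)
qed

text \<open>
  On the disc of radius \<open>S\<close> choose the order of the expansion so large that the averaged function decays like
  the power \<open>-(k + 1)\<close> of the size. The number of averages depends on \<open>S\<close>, but the t-sums do
  not, so the holomorphic functions on the various discs fit together.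
\<close>

lemma ex_entire_t_sum:
  assumes \<phi>: "hpoly k q \<phi>" and m: "m > 0" and w0: "cube_avg k m w = (\<lambda>_. 0)"
    and W: "\<And>x. norm (w x) \<le> W" and supp: "\<And>x. x \<notin> int_lattice k \<Longrightarrow> w x = 0"
  obtains H where "H holomorphic_on UNIV"
    "\<And>s. t_has_sum (rat_space k) (\<lambda>x. pterm \<phi> s x * w x) (H s)"
proof -
  have loc: "\<exists>h. h holomorphic_on ball 0 S \<and>
    (\<forall>s\<in>ball 0 S. t_has_sum (rat_space k) (\<lambda>x. pterm \<phi> s x * w x) (h s))" for S :: real
  proof -
    define L where "L = nat \<lceil>real q + real d * S + real k + 1\<rceil>"
    have L: "real q + real d * S - real L \<le> - (real k + 1)" unfolding L_def by linarith
    obtain N K X where X: "finite X" and est: "\<forall>s x. norm s \<le> S \<and> x \<in> int_lattice k \<and> x \<notin> X \<longrightarrow>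
      norm ((cube_avg k m ^^ N) (\<lambda>x. pterm \<phi> s x * w x) x)
        \<le> K * lsize k x powr (real q + real d * S - real L)"
      by (rule cube_avg_pterm_decay[OF \<phi> m w0 W, of S L]) (rule that)
    define T where "T = cube_avg k m ^^ N"
    have T: "translation_op (int_lattice k) T 1"
      using IL.translation_op_funpow[OF translation_op_cube_avg[OF m], of k N] by (simp add: T_def)
    have T': "translation_op (rat_space k) T 1"
      by (rule weighted_op_mono[OF T int_lattice_subset])
    define f where "f x s = T (\<lambda>x. pterm \<phi> s x * w x) x" for x s
    have est': "norm (f x s) \<le> \<bar>K\<bar> * lsize k x powr (- (real k + 1))"
      if "x \<in> int_lattice k" "x \<notin> X" "norm s \<le> S" for x s
    proof -
      have "norm (f x s) \<le> K * lsize k x powr (real q + real d * S - real L)"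
        unfolding f_def T_def using est that by simp
      also have "\<dots> \<le> \<bar>K\<bar> * lsize k x powr (real q + real d * S - real L)"
        by (intro mult_right_mono) auto
      also have "\<dots> \<le> \<bar>K\<bar> * lsize k x powr (- (real k + 1))"
        using L lsize_ge_1[of k x] by (intro mult_left_mono powr_mono) auto
      finally show ?thesis .
    qed
    have holo: "f x holomorphic_on UNIV" for x
    proof -
      have hz: "(\<lambda>s. pterm \<phi> s z * w z) holomorphic_on UNIV" for z
        by (cases "z \<in> int_lattice k") (auto simp: supp intro!: holomorphic_intros pterm_holomorphic)
      obtain co where "T = (\<lambda>a x. \<Sum>y\<in>gsupp (int_lattice k) co. co y * a (x - y))"
        using T unfolding weighted_op_explicit by (elim exE conjE) (rule that)
      then have "f x = (\<lambda>s. \<Sum>y\<in>gsupp (int_lattice k) co. co y * (pterm \<phi> s (x - y) * w (x - y)))"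
        by (intro ext) (simp only: f_def)
      then show ?thesis
        by (simp only:) (intro holomorphic_on_sum holomorphic_on_mult[OF holomorphic_on_const hz])
    qed
    have supp': "f x s = 0" if "x \<notin> int_lattice k" for x s
      unfolding f_def by (rule translation_op_support[OF T _ that]) (simp add: supp)
    obtain h where h: "h holomorphic_on ball 0 S"
      "\<forall>s\<in>ball 0 S. ((\<lambda>x. f x s) has_sum h s) (rat_space k)"
      by (rule lattice_sum_holomorphic[OF holo X supp' est']) (assumption | rule that)+
    have "t_has_sum (rat_space k) (\<lambda>x. pterm \<phi> s x * w x) (h s)" if "s \<in> ball 0 S" for s
      using bspec[OF h(2) that] by (intro t_has_sumI[OF T']) (simp_all add: f_def)
    then show ?thesis by (intro exI[of _ h] conjI ballI h(1))
  qed
  define H where "H s = t_sum (rat_space k) (\<lambda>x. pterm \<phi> s x * w x)" for s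
  have eq: "H s = v" if "t_has_sum (rat_space k) (\<lambda>x. pterm \<phi> s x * w x) v" for v s
    unfolding H_def by (rule RS.t_sum_eq[OF that])
  show ?thesis
  proof (rule that[of H])
    have "H analytic_on UNIV"
    proof (subst analytic_on_analytic_at, intro ballI)
      fix z :: complex
      obtain h where h: "h holomorphic_on ball 0 (norm z + 1)"
        "\<forall>s\<in>ball 0 (norm z + 1). t_has_sum (rat_space k) (\<lambda>x. pterm \<phi> s x * w x) (h s)"
        using loc[of "norm z + 1"] by (elim exE conjE) (rule that)
      have "H holomorphic_on ball 0 (norm z + 1)"
      proof (rule holomorphic_transform[OF h(1)])
        fix s :: complex assume "s \<in> ball 0 (norm z + 1)"
        then show "h s = H s" by (rule eq[OF bspec[OF h(2)], symmetric])
      qed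
      then show "H analytic_on {z}" 
        by (intro analytic_at[THEN iffD2] exI[of _ "ball 0 (norm z + 1)"]) auto
    qed
    then show "H holomorphic_on UNIV" by (rule analytic_imp_holomorphic)
    fix s :: complex
    obtain h where "h holomorphic_on ball 0 (norm s + 1)"
      and h: "\<forall>s\<in>ball 0 (norm s + 1). t_has_sum (rat_space k) (\<lambda>x. pterm \<phi> s x * w x) (h s)"
      using loc[of "norm s + 1"] by (elim exE conjE) (rule that)
    have "t_has_sum (rat_space k) (\<lambda>x. pterm \<phi> s x * w x) (h s)" by (rule bspec[OF h]) simp
    then show "t_has_sum (rat_space k) (\<lambda>x. pterm \<phi> s x * w x) (H s)" by (simp add: eq)
  qed
qed

end


section \<open>Sums of homogeneous terms\<close>

text \<open>
  The numbers \<open>ln 2\<close> and \<open>ln 3\<close> are linearly independent over the rationals, because a power of \<open>3\<close> is odd.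
\<close>

lemma exp_ln2_ln3_eq_1:
  assumes "exp (z * of_real (ln 2)) = (1::complex)" "exp (z * of_real (ln 3)) = 1"
  shows "z = 0"
proof (rule ccontr)
  assume z: "z \<noteq> 0"
  obtain n where n: "Re z * ln 2 = 0" "Im z * ln 2 = of_int (2 * n) * pi"
    using assms(1) by (auto simp: exp_eq_1)
  obtain m where m: "Im z * ln 3 = of_int (2 * m) * pi"
    using assms(2) by (auto simp: exp_eq_1)
  have im: "Im z \<noteq> 0" using z n(1) by (auto simp: complex_eq_iff)
  have "(Im z * ln 2) * (of_int (2 * m) * pi) = (Im z * ln 3) * (of_int (2 * n) * pi)"
    unfolding n(2) m by simp
  then have "real_of_int m * ln 2 = real_of_int n * ln 3" using im by (simp add: mult.commute)
  then have "\<bar>real_of_int m * ln 2\<bar> = \<bar>real_of_int n * ln 3\<bar>" by (rule arg_cong)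
  then have "real (nat \<bar>m\<bar>) * ln 2 = real (nat \<bar>n\<bar>) * ln 3" by (simp add: abs_mult)
  then have "ln (2 ^ nat \<bar>m\<bar> :: real) = ln (3 ^ nat \<bar>n\<bar>)" by (simp add: ln_realpow)
  then have "(2::real) ^ nat \<bar>m\<bar> = 3 ^ nat \<bar>n\<bar>" by simp
  then have "real (2 ^ nat \<bar>m\<bar>) = real (3 ^ nat \<bar>n\<bar>)" by simp
  then have eq: "(2::nat) ^ nat \<bar>m\<bar> = 3 ^ nat \<bar>n\<bar>" by (simp only: of_nat_eq_iff)
  have "odd ((3::nat) ^ nat \<bar>n\<bar>)" by simp
  then have "nat \<bar>m\<bar> = 0" unfolding eq[symmetric] by simp
  with m im show False by simp
qed

lemma dilate_lat_ind_imp: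
  assumes "(\<lambda>i. inverse (of_nat m) * x i) \<in> int_lattice k" "m > 0"
  shows "x \<in> int_lattice k"
  using mod_weight_outside[of x k m] assms
  by (cases "x \<in> int_lattice k") (auto simp: mod_weight_def lat_ind_def dilate_def)

lemma mod_weight_bounded: "norm (mod_weight k m x) \<le> 1 + real m ^ k"
proof -
  have "norm (mod_weight k m x) \<le> norm (lat_ind k x) + norm (of_nat m ^ k * dilate (of_nat m) (lat_ind k) x)"
    unfolding mod_weight_def by (rule norm_triangle_ineq4)
  also have "\<dots> \<le> 1 + real m ^ k"
    by (intro add_mono) (auto simp: lat_ind_def dilate_def norm_mult norm_power)
  finally show ?thesis .
qed

lemma dilation_op_one_minus:
  assumes "t \<noteq> 0"
  shows "dilation_op (\<lambda>a x. a x - c * dilate t a x) (1 - c)"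
proof -
  have "dilation_op (dilate 1) 1" by (rule dilation_op_dilate) simp
  moreover have "dilate 1 = (\<lambda>a :: (nat \<Rightarrow> rat) \<Rightarrow> complex. a)" by (auto simp: dilate_def fun_eq_iff)
  ultimately have id: "dilation_op (\<lambda>a. a) 1" by simp
  have "dilation_op (\<lambda>a x. a x + (- c) * dilate t a x) (1 + (- c) * 1)"
    by (rule weighted_op.add[OF id weighted_op.scale[OF dilation_op_dilate[OF assms]]])
  then show ?thesis by simp
qed

text \<open>
  For a polynomial the averaged function vanishes identically, and the weight
  \<open>1 - 2 ^ (k + q)\<close> is nonzero since \<open>k \<ge> 1\<close>.
\<close>

lemma h_has_sum_polynomial:
  assumes "hpoly k q \<phi>" "k \<ge> 1"
  shows "h_has_sum k (\<lambda>x. of_real (\<phi> x) * lat_ind k x) 0"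
proof -
  let ?a = "\<lambda>x. complex_of_real (\<phi> x) * lat_ind k x"
  obtain n where n: "fdeg n \<phi>" using hpoly_fdeg[OF assms(1)] by blast
  have D: "dilation_op (\<lambda>a x. a x - 2 ^ (k + q) * dilate 2 a x) (1 - 2 ^ (k + q))"
    by (rule dilation_op_one_minus) simp
  have hom: "\<phi> (\<lambda>i. x i / 2) = \<phi> x / 2 ^ q" for x
    using hpoly_homogeneous[OF assms(1), of "1/2" x] by (simp add: of_rat_divide power_divide)
  have Da: "?a x - 2 ^ (k + q) * dilate 2 ?a x = of_real (\<phi> x) * mod_weight k 2 x" for x
    by (simp add: dilate_def mod_weight_def hom power_add algebra_simps)
  have B: "translation_op (int_lattice k) (cube_avg k 2) 1" by (rule translation_op_cube_avg) simp
  define T where "T = cube_avg k 2 ^^ Suc n"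
  have T: "translation_op (rat_space k) T 1"
    using weighted_op_mono[OF IL.translation_op_funpow[OF B, of "Suc n"] int_lattice_subset]
    by (simp add: T_def)
  have "T (\<lambda>x. of_real (\<phi> x) * mod_weight k 2 x) = (\<lambda>_. 0)"
    unfolding T_def
    by (rule IL.funpow_annihilates[OF B _ cube_avg_mod_weight fdeg_of_real[OF n]]) simp_all
  then have "(T (\<lambda>x. of_real (\<phi> x) * mod_weight k 2 x) has_sum (1 * 0)) (rat_space k)"
    by (simp add: has_sum_0)
  then have t: "t_has_sum (rat_space k) (\<lambda>x. of_real (\<phi> x) * mod_weight k 2 x) 0"
    by (intro t_has_sumI[OF T]) simp_all
  have "(2::complex) ^ (k + q) \<noteq> 1"
  proof
    assume "(2::complex) ^ (k + q) = 1"
    then have "(2::nat) ^ (k + q) = 1" by (metis of_nat_eq_1_iff of_nat_numeral of_nat_power)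
    then show False using assms(2) by simp
  qed
  then show ?thesis using t by (intro h_has_sumI[OF D]) (simp_all add: Da)
qed

context elliptic_form
begin

text \<open>
  The exponent at which \<open>\<phi>(x) p(x)\<^sup>-\<^sup>s\<close>, with \<open>\<phi>\<close> of degree \<open>q\<close>, is homogeneous of degree \<open>-k\<close>.
\<close>

definition crit_point :: "nat \<Rightarrow> complex" where
  "crit_point q = of_nat (k + q) / of_nat d"

text \<open>
  This is \<open>m powr (k + q - d s)\<close>, written relative to the critical point where it equals \<open>1\<close>.
\<close>

definition euler_factor :: "nat \<Rightarrow> nat \<Rightarrow> complex \<Rightarrow> complex" where
  "euler_factor m q s = exp (- (of_nat d * (s - crit_point q)) * of_real (ln (real m)))"

text \<open>
  By homogeneity the dilated function is \<open>m powr (d s - q)\<close> times the original one on the multiples of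
  \<open>m\<close>; the chosen factor turns this into \<open>m\<^sup>k\<close>.
\<close>

lemma zterm_minus_dilate:
  assumes \<phi>: "hpoly k q \<phi>" and m: "m > 0"
  shows "zterm \<phi> s x - euler_factor m q s * dilate (of_nat m) (zterm \<phi> s) x = pterm \<phi> s x * mod_weight k m x"
proof -
  define y where "y = (\<lambda>i. inverse (of_nat m) * x i)"
  have dil: "dilate (of_nat m) a x = a y" for a by (simp only: dilate_def y_def)
  have y0: "y = 0 \<longleftrightarrow> x = 0" using m by (auto simp: y_def fun_eq_iff)
  have "euler_factor m q s * zterm \<phi> s y = pterm \<phi> s x * (of_nat m ^ k * lat_ind k y)"
  proof (cases "y \<in> int_lattice k \<and> x \<noteq> 0")
    case False
    with y0 show ?thesis by (auto simp: zterm_def lat_ind_def pterm_def)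
  next
    case True
    then have xL: "x \<in> int_lattice k" using dilate_lat_ind_imp m unfolding y_def by blast
    then have px: "p x > 0" using True p_pos by blast
    have scale: "\<psi> y = \<psi> x / real m ^ j" if "hpoly k j \<psi>" for j \<psi>
    proof -
      have "\<psi> y = of_rat (inverse (of_nat m)) ^ j * \<psi> x"
        unfolding y_def by (rule hpoly_homogeneous[OF that])
      also have "\<dots> = \<psi> x / real m ^ j" by (simp add: of_rat_inverse power_inverse divide_inverse)
      finally show ?thesis .
    qed
    note py = scale[OF p] scale[OF \<phi>]
    have ln: "ln (p y) = ln (p x) - real d * ln (real m)"
      using px m by (simp add: py ln_div ln_realpow)
    have "p y > 0" using px m by (simp add: py)
    define l :: complex where "l = of_real (ln (real m))"
    have lnc: "- s * of_real (ln (p y)) = - s * of_real (ln (p x)) + s * (of_nat d * l)"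
      by (simp add: ln l_def algebra_simps)
    have e: "of_real (p y) powr (-s) = of_real (p x) powr (-s) * exp (s * (of_nat d * l))"
    proof -
      have "of_real (p y) powr (-s) = exp (- s * of_real (ln (p y)))"
        using \<open>p y > 0\<close> by (simp add: powr_def Ln_of_real)
      also have "\<dots> = exp (- s * of_real (ln (p x))) * exp (s * (of_nat d * l))"
        unfolding lnc by (rule exp_add)
      finally show ?thesis using px by (simp add: powr_def Ln_of_real)
    qed
    have "exp l = of_nat m" using m by (simp add: l_def exp_of_real)
    then have pw: "of_nat m ^ j = exp (of_nat j * l)" for j
      by (simp add: exp_of_nat_mult)
    have "of_nat d * crit_point q = of_nat k + of_nat q" using d by (simp add: crit_point_def)
    then have "- (of_nat d * (s - crit_point q)) * l + s * (of_nat d * l) = of_nat k * l + of_nat q * l"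
      by (simp add: right_diff_distrib ring_distribs)
    then have "euler_factor m q s * exp (s * (of_nat d * l)) = of_nat m ^ k * of_nat m ^ q"
      unfolding euler_factor_def pw l_def[symmetric] exp_add[symmetric] by (rule arg_cong)
    then have "euler_factor m q s * (exp (s * (of_nat d * l)) / of_nat m ^ q) = of_nat m ^ k"
      using m by simp
    then have "euler_factor m q s * (of_real (\<phi> x) * of_real (p x) powr (-s) *
        (exp (s * (of_nat d * l)) / of_nat m ^ q))
      = of_real (\<phi> x) * of_real (p x) powr (-s) * of_nat m ^ k"
      by (simp only: mult.left_commute[of "euler_factor m q s"])
    then show ?thesis
      using True y0 by (simp add: zterm_def pterm_def lat_ind_def e py(2) mult.assoc)
  qed
  then show ?thesis unfolding mod_weight_def dil by (auto simp: zterm_def algebra_simps)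
qed

lemma ex_quotient:
  assumes "m \<ge> 2"
  obtains E where "E holomorphic_on UNIV" "\<And>s. 1 - euler_factor m q s = (s - crit_point q) * E s"
    "E (crit_point q) = of_nat d * of_real (ln (real m))"
proof -
  let ?u = "\<lambda>s. 1 - euler_factor m q s"
  have der: "(?u has_field_derivative (of_nat d * of_real (ln (real m)))) (at (crit_point q))"
    unfolding euler_factor_def by (auto intro!: derivative_eq_intros)
  have "?u holomorphic_on UNIV" unfolding euler_factor_def by (intro holomorphic_intros)
  then have "(\<lambda>s. if s = crit_point q then deriv ?u (crit_point q) else (?u s - ?u (crit_point q)) / (s - crit_point q)) holomorphic_on UNIV"
    by (rule pole_lemma) simp
  moreover have "?u (crit_point q) = 0" by (simp add: euler_factor_def)
  ultimately show ?thesis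
    by (intro that[of "\<lambda>s. if s = crit_point q then deriv ?u (crit_point q) else (?u s - ?u (crit_point q)) / (s - crit_point q)"])
      (auto simp: DERIV_imp_deriv[OF der])
qed

text \<open>
  Division of the entire t-sum by \<open>1 - euler_factor m q s\<close> introduces, besides the critical point,
  spurious poles at the other zeros of that factor. They depend on \<open>m\<close>, and the quotients for
  \<open>m = 2\<close> and \<open>m = 3\<close> agree by uniqueness of h-sums, so each supplies the value where the other
  fails. The last conclusion records the t-sum at the critical point, where \<open>1 - dilate 2\<close> has weight \<open>0\<close>.
\<close>

lemma ex_zeta_numerator:
  assumes \<phi>: "hpoly k q \<phi>"
  shows "\<exists>Y. Y holomorphic_on UNIV \<and>
    (\<forall>s. s \<noteq> crit_point q \<longrightarrow> h_has_sum k (zterm \<phi> s) (Y s / (s - crit_point q))) \<and>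
    t_has_sum (rat_space k) (\<lambda>x. zterm \<phi> (crit_point q) x - 1 * dilate 2 (zterm \<phi> (crit_point q)) x)
      (of_nat d * of_real (ln 2) * Y (crit_point q))"
proof -
  have "\<exists>H E. H holomorphic_on UNIV \<and> E holomorphic_on UNIV \<and>
      (\<forall>s. t_has_sum (rat_space k) (\<lambda>x. zterm \<phi> s x - euler_factor m q s * dilate (of_nat m) (zterm \<phi> s) x) (H s)) \<and>
      (\<forall>s. 1 - euler_factor m q s = (s - crit_point q) * E s) \<and> E (crit_point q) = of_nat d * of_real (ln (real m))"
    if m: "m \<ge> 2" for m
  proof -
    have m0: "m > 0" using m by simp
    obtain H where "H holomorphic_on UNIV"
      "\<And>s. t_has_sum (rat_space k) (\<lambda>x. pterm \<phi> s x * mod_weight k m x) (H s)"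
      using ex_entire_t_sum[OF \<phi> m0 cube_avg_mod_weight[OF m0] mod_weight_bounded mod_weight_outside[OF _ m0]]
      by metis
    moreover obtain E where "E holomorphic_on UNIV" "\<And>s. 1 - euler_factor m q s = (s - crit_point q) * E s"
      "E (crit_point q) = of_nat d * of_real (ln (real m))"
      using ex_quotient[OF m] by metis
    ultimately show ?thesis unfolding zterm_minus_dilate[OF \<phi> m0] by blast
  qed
  note * = this
  obtain H2 E2 where 2: "H2 holomorphic_on UNIV" "E2 holomorphic_on UNIV"
    "\<And>s. t_has_sum (rat_space k) (\<lambda>x. zterm \<phi> s x - euler_factor 2 q s * dilate (of_nat 2) (zterm \<phi> s) x) (H2 s)"
    "\<And>s. 1 - euler_factor 2 q s = (s - crit_point q) * E2 s" "E2 (crit_point q) = of_nat d * of_real (ln (real 2))"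
    using *[of 2] by auto
  obtain H3 E3 where 3: "H3 holomorphic_on UNIV" "E3 holomorphic_on UNIV"
    "\<And>s. t_has_sum (rat_space k) (\<lambda>x. zterm \<phi> s x - euler_factor 3 q s * dilate (of_nat 3) (zterm \<phi> s) x) (H3 s)"
    "\<And>s. 1 - euler_factor 3 q s = (s - crit_point q) * E3 s" "E3 (crit_point q) = of_nat d * of_real (ln (real 3))"
    using *[of 3] by auto
  have E2c: "E2 (crit_point q) \<noteq> 0" using d 2(5) by simp
  have h: "h_has_sum k (zterm \<phi> s) (H s / E s / (s - crit_point q))"
    if t: "t_has_sum (rat_space k) (\<lambda>x. zterm \<phi> s x - euler_factor m q s * dilate (of_nat m) (zterm \<phi> s) x) (H s)"
      and e: "1 - euler_factor m q s = (s - crit_point q) * E s" and nz: "E s \<noteq> 0" "s \<noteq> crit_point q" and m: "m \<ge> 2"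
    for s m and H E :: "complex \<Rightarrow> complex"
  proof -
    have D: "dilation_op (\<lambda>a x. a x - euler_factor m q s * dilate (of_nat m) a x) (1 - euler_factor m q s)"
      by (rule dilation_op_one_minus) (use m in simp)
    have ne: "1 - euler_factor m q s \<noteq> 0" unfolding e using nz by simp
    have eq: "(1 - euler_factor m q s) * (H s / E s / (s - crit_point q)) = H s" unfolding e using nz by simp
    show ?thesis by (rule h_has_sumI[OF D ne]) (simp only: eq t)
  qed
  define Y where "Y s = (if E2 s \<noteq> 0 then H2 s / E2 s else H3 s / E3 s)" for s
  have nz: "E2 s \<noteq> 0 \<or> (E3 s \<noteq> 0 \<and> s \<noteq> crit_point q)" for s
  proof (rule ccontr)
    assume a: "\<not> ?thesis"
    then have s: "s \<noteq> crit_point q" "E2 s = 0" "E3 s = 0" using E2c by auto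
    then have "euler_factor 2 q s = 1" "euler_factor 3 q s = 1" using 2(4)[of s] 3(4)[of s] by simp_all
    then have "- (of_nat d * (s - crit_point q)) = 0"
      using exp_ln2_ln3_eq_1[of "- (of_nat d * (s - crit_point q))"] unfolding euler_factor_def by simp
    then show False using s d by simp
  qed
  have both: "H2 s / E2 s = H3 s / E3 s" if "E2 s \<noteq> 0" "E3 s \<noteq> 0" "s \<noteq> crit_point q" for s
  proof -
    have "H2 s / E2 s / (s - crit_point q) = H3 s / E3 s / (s - crit_point q)"
      by (rule h_has_sum_unique[OF h[where m=2 and s=s and H=H2 and E=E2, OF 2(3) 2(4)] h[where m=3 and s=s and H=H3 and E=E3, OF 3(3) 3(4)]])
        (use that in auto)
    then show ?thesis using that(3) by (simp only: divide_cancel_right) simp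
  qed
  have op: "open {s. E2 s \<noteq> 0}" "open ({s. E3 s \<noteq> 0} - {crit_point q})"
  proof -
    have "continuous_on UNIV E2" "continuous_on UNIV E3"
      using 2(2) 3(2) by (auto intro: holomorphic_on_imp_continuous_on)
    then have "open (E2 -` (- {0}))" "open (E3 -` (- {0}))"
      by (auto intro: open_vimage)
    then show "open {s. E2 s \<noteq> 0}" "open ({s. E3 s \<noteq> 0} - {crit_point q})"
      by (auto simp: vimage_def intro: open_delete)
  qed
  have "Y holomorphic_on {s. E2 s \<noteq> 0}"
  proof (rule holomorphic_transform)
    show "(\<lambda>s. H2 s / E2 s) holomorphic_on {s. E2 s \<noteq> 0}"
      by (intro holomorphic_on_divide holomorphic_on_subset[OF 2(1)] holomorphic_on_subset[OF 2(2)]) auto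
  qed (simp add: Y_def)
  moreover have "Y holomorphic_on ({s. E3 s \<noteq> 0} - {crit_point q})"
  proof (rule holomorphic_transform)
    show "(\<lambda>s. H3 s / E3 s) holomorphic_on ({s. E3 s \<noteq> 0} - {crit_point q})"
      by (intro holomorphic_on_divide holomorphic_on_subset[OF 3(1)] holomorphic_on_subset[OF 3(2)]) auto
  qed (use both in \<open>auto simp: Y_def\<close>)
  ultimately have "Y holomorphic_on ({s. E2 s \<noteq> 0} \<union> ({s. E3 s \<noteq> 0} - {crit_point q}))"
    using op by (rule holomorphic_on_Un)
  moreover have "{s. E2 s \<noteq> 0} \<union> ({s. E3 s \<noteq> 0} - {crit_point q}) = UNIV" using nz by blast
  ultimately have holo: "Y holomorphic_on UNIV" by simp
  have hs: "h_has_sum k (zterm \<phi> s) (Y s / (s - crit_point q))" if "s \<noteq> crit_point q" for s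
  proof (cases "E2 s = 0")
    case True
    then have "E3 s \<noteq> 0" using nz by blast
    then show ?thesis using True h[where m=3 and s=s and H=H3 and E=E3, OF 3(3) 3(4)] that by (simp add: Y_def)
  next
    case False
    then show ?thesis using h[where m=2 and s=s and H=H2 and E=E2, OF 2(3) 2(4)] that by (simp add: Y_def)
  qed
  have "euler_factor 2 q (crit_point q) = 1" by (simp add: euler_factor_def)
  moreover have "of_nat d * of_real (ln 2) * Y (crit_point q) = H2 (crit_point q)"
    using E2c 2(5) by (simp add: Y_def)
  ultimately have "t_has_sum (rat_space k) (\<lambda>x. zterm \<phi> (crit_point q) x - 1 * dilate 2 (zterm \<phi> (crit_point q)) x)
      (of_nat d * of_real (ln 2) * Y (crit_point q))"
    using 2(3)[of "crit_point q"] by simp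
  with holo hs show ?thesis by (intro exI[of _ Y] conjI allI impI)
qed

text \<open>
  Adding the reflected function, an operator of weight \<open>2\<close>, gives \<open>0\<close>, since \<open>\<phi>\<close> is odd and \<open>p\<close> is
  even.
\<close>

lemma zterm_odd:
  assumes \<phi>: "hpoly k q \<phi>" and q: "odd q"
  shows "h_has_sum k (zterm \<phi> s) 0"
proof -
  have D: "dilation_op (\<lambda>a x. a x - (-1) * dilate (-1) a x) (1 - (-1))"
    by (rule dilation_op_one_minus) simp
  have "zterm \<phi> s x - (-1) * dilate (-1) (zterm \<phi> s) x = 0" for x
  proof -
    let ?y = "\<lambda>i. inverse (-1) * x i"
    have "\<phi> ?y = - \<phi> x" "p ?y = p x"
      using q d_even by (simp_all only: hpoly_homogeneous[OF p] hpoly_homogeneous[OF \<phi>]) simp_all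
    moreover have "?y \<in> int_lattice k \<longleftrightarrow> x \<in> int_lattice k"
      by (auto simp: int_lattice_def rat_space_def minus_in_Ints_iff)
    moreover have "?y = 0 \<longleftrightarrow> x = 0" by (auto simp: fun_eq_iff)
    ultimately show ?thesis unfolding dilate_def zterm_def pterm_def lat_ind_def by simp
  qed
  moreover have "t_has_sum (rat_space k) (\<lambda>_. 0) 0"
    by (rule has_sum_imp_t_has_sum) (simp_all add: has_sum_0)
  ultimately have "t_has_sum (rat_space k) (\<lambda>x. zterm \<phi> s x - (-1) * dilate (-1) (zterm \<phi> s) x) 0"
    by simp
  then show ?thesis by (intro h_has_sumI[OF D]) simp_all
qed

end


section \<open>Expansion of the powers of an elliptic polynomial\<close>

lemma holomorphic_on_shift:
  assumes "f holomorphic_on UNIV"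
  shows "(\<lambda>s. f (s + c)) holomorphic_on UNIV"
proof -
  have "(f \<circ> (\<lambda>s. s + c)) holomorphic_on UNIV"
    by (rule holomorphic_on_compose_gen[OF _ assms]) (auto intro!: holomorphic_intros)
  then show ?thesis by (simp add: o_def)
qed

context elliptic_form
begin

text \<open>
  A fixed choice of the numerator, so that residues and jumps can be written as formulas.
\<close>

definition zeta_num :: "nat \<Rightarrow> ((nat \<Rightarrow> rat) \<Rightarrow> real) \<Rightarrow> complex \<Rightarrow> complex" where
  "zeta_num q \<phi> = (SOME Y. Y holomorphic_on UNIV \<and>
    (\<forall>s. s \<noteq> crit_point q \<longrightarrow> h_has_sum k (zterm \<phi> s) (Y s / (s - crit_point q))) \<and>
    t_has_sum (rat_space k) (\<lambda>x. zterm \<phi> (crit_point q) x - 1 * dilate 2 (zterm \<phi> (crit_point q)) x)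
      (of_nat d * of_real (ln 2) * Y (crit_point q)))"

lemma zeta_num:
  assumes "hpoly k q \<phi>"
  shows "zeta_num q \<phi> holomorphic_on UNIV"
    and "s \<noteq> crit_point q \<Longrightarrow> h_has_sum k (zterm \<phi> s) (zeta_num q \<phi> s / (s - crit_point q))"
    and "t_has_sum (rat_space k) (\<lambda>x. zterm \<phi> (crit_point q) x - 1 * dilate 2 (zterm \<phi> (crit_point q)) x)
      (of_nat d * of_real (ln 2) * zeta_num q \<phi> (crit_point q))"
  using someI_ex[OF ex_zeta_numerator[OF assms]] unfolding zeta_num_def[symmetric] by blast+

end

locale elliptic_poly = elliptic_form +
  fixes P :: "(nat \<Rightarrow> rat) \<Rightarrow> real" and \<phi> :: "nat \<Rightarrow> (nat \<Rightarrow> rat) \<Rightarrow> real" and F :: "(nat \<Rightarrow> rat) set"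
  assumes P: "\<And>x. P x = p x + (\<Sum>r<d. \<phi> r x)" and \<phi>: "\<And>r. r < d \<Longrightarrow> hpoly k r (\<phi> r)"
    and F: "finite F" "F \<subseteq> int_lattice k" and P_pos: "x \<in> int_lattice k \<Longrightarrow> x \<notin> F \<Longrightarrow> P x > 0"
begin

text \<open>
  The summand of the series, extended by zero to rational space.
\<close>

definition series_term :: "complex \<Rightarrow> (nat \<Rightarrow> rat) \<Rightarrow> complex" where
  "series_term s = extend_zero (int_lattice k - F) (\<lambda>n. of_real (P n) powr (- s))"

text \<open>
  Expanding \<open>((-s) gchoose i) * (\<Sum>r<d. \<phi> r) ^ i * p powr (-s - i)\<close> gives one term for each
  \<open>i\<close> and each choice \<open>g\<close> of a degree \<open>g l < d\<close> for every factor \<open>l < i\<close>. Below, \<open>tdeg\<close> is the degree of the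
  resulting polynomial \<open>tpoly\<close>, \<open>tcoef\<close> its binomial coefficient, and \<open>tfun\<close> the whole term.
  Its h-sum is \<open>tnum \<tau> s / (s - tpole \<tau>)\<close>; setting \<open>tnum\<close> to \<open>0\<close> for odd degrees
  records that these terms have no pole.
\<close>

definition terms :: "nat \<Rightarrow> (nat \<times> (nat \<Rightarrow> nat)) set" where
  "terms I = Sigma {..<I} (\<lambda>i. PiE {..<i} (\<lambda>_. {..<d}))"

definition tdeg :: "nat \<times> (nat \<Rightarrow> nat) \<Rightarrow> nat" where
  "tdeg \<tau> = (\<Sum>l<fst \<tau>. snd \<tau> l)"

definition tpoly :: "nat \<times> (nat \<Rightarrow> nat) \<Rightarrow> (nat \<Rightarrow> rat) \<Rightarrow> real" where
  "tpoly \<tau> x = (\<Prod>l<fst \<tau>. \<phi> (snd \<tau> l) x)"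

definition tcoef :: "nat \<times> (nat \<Rightarrow> nat) \<Rightarrow> complex \<Rightarrow> complex" where
  "tcoef \<tau> s = (- s) gchoose fst \<tau>"

definition tpole :: "nat \<times> (nat \<Rightarrow> nat) \<Rightarrow> complex" where
  "tpole \<tau> = crit_point (tdeg \<tau>) - of_nat (fst \<tau>)"

definition tnum :: "nat \<times> (nat \<Rightarrow> nat) \<Rightarrow> complex \<Rightarrow> complex" where
  "tnum \<tau> s = (if odd (tdeg \<tau>) then 0
     else tcoef \<tau> s * zeta_num (tdeg \<tau>) (tpoly \<tau>) (s + of_nat (fst \<tau>)))"

definition tfun :: "nat \<times> (nat \<Rightarrow> nat) \<Rightarrow> complex \<Rightarrow> (nat \<Rightarrow> rat) \<Rightarrow> complex" where
  "tfun \<tau> s x = tcoef \<tau> s * zterm (tpoly \<tau>) (s + of_nat (fst \<tau>)) x"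

lemma finite_terms: "finite (terms I)"
  unfolding terms_def by (intro finite_SigmaI finite_PiE) auto

lemma terms_memD:
  assumes "\<tau> \<in> terms I" "l < fst \<tau>"
  shows "snd \<tau> l < d"
proof -
  have "snd \<tau> \<in> PiE {..<fst \<tau>} (\<lambda>_. {..<d})"
    using assms(1) by (cases \<tau>) (simp add: terms_def)
  from PiE_mem[OF this, of l] show ?thesis using assms(2) by simp
qed

lemma hpoly_tpoly:
  assumes "\<tau> \<in> terms I"
  shows "hpoly k (tdeg \<tau>) (tpoly \<tau>)"
proof -
  have "hpoly k (\<Sum>l<fst \<tau>. snd \<tau> l) (\<lambda>x. \<Prod>l<fst \<tau>. \<phi> (snd \<tau> l) x)"
  proof (rule hpoly_prod)
    fix l assume "l \<in> {..<fst \<tau>}"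
    then show "hpoly k (snd \<tau> l) (\<phi> (snd \<tau> l))" by (intro \<phi> terms_memD[OF assms]) simp
  qed
  then show ?thesis by (simp only: tdeg_def tpoly_def[abs_def])
qed

lemma tdeg_le:
  assumes "\<tau> \<in> terms I"
  shows "tdeg \<tau> \<le> d * fst \<tau>"
proof -
  have "tdeg \<tau> \<le> (\<Sum>l<fst \<tau>. d)"
    unfolding tdeg_def
  proof (rule sum_mono)
    fix l assume "l \<in> {..<fst \<tau>}"
    then show "snd \<tau> l \<le> d" using terms_memD[OF assms, of l] by simp
  qed
  then show ?thesis by (simp add: mult.commute)
qed

lemma tcoef_holomorphic [holomorphic_intros]: "tcoef \<tau> holomorphic_on A"
  unfolding tcoef_def[abs_def] gbinomial_prod_rev by (intro holomorphic_intros) auto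

lemma tnum_holomorphic:
  assumes "\<tau> \<in> terms I"
  shows "tnum \<tau> holomorphic_on UNIV"
proof (cases "odd (tdeg \<tau>)")
  case False
  have "(\<lambda>s. zeta_num (tdeg \<tau>) (tpoly \<tau>) (s + of_nat (fst \<tau>))) holomorphic_on UNIV"
    by (rule holomorphic_on_shift[OF zeta_num(1)[OF hpoly_tpoly[OF assms]]])
  then have "(\<lambda>s. tcoef \<tau> s * zeta_num (tdeg \<tau>) (tpoly \<tau>) (s + of_nat (fst \<tau>))) holomorphic_on UNIV"
    by (rule holomorphic_on_mult[OF tcoef_holomorphic])
  then show ?thesis using False by (simp add: tnum_def[abs_def])
qed (simp add: tnum_def[abs_def])

lemma tfun_h_has_sum:
  assumes "\<tau> \<in> terms I" "s \<noteq> tpole \<tau> \<or> odd (tdeg \<tau>)"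
  shows "h_has_sum k (tfun \<tau> s) (tnum \<tau> s / (s - tpole \<tau>))"
proof (cases "odd (tdeg \<tau>)")
  case True
  have "h_has_sum k (zterm (tpoly \<tau>) (s + of_nat (fst \<tau>))) 0"
    by (rule zterm_odd[OF hpoly_tpoly[OF assms(1)] True])
  from h_has_sum_cmult[OF this, of "tcoef \<tau> s"] show ?thesis
    using True by (simp add: tfun_def[abs_def] tnum_def)
next
  case False
  have eq: "s + of_nat (fst \<tau>) - crit_point (tdeg \<tau>) = s - tpole \<tau>"
    by (simp add: tpole_def)
  have "s - tpole \<tau> \<noteq> 0" using False assms(2) by simp
  then have "s + of_nat (fst \<tau>) \<noteq> crit_point (tdeg \<tau>)" unfolding eq[symmetric] by simp
  from h_has_sum_cmult[OF zeta_num(2)[OF hpoly_tpoly[OF assms(1)] this], of "tcoef \<tau> s"]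
  show ?thesis using False unfolding eq by (simp add: tfun_def[abs_def] tnum_def)
qed

lemma terms_expand: "(\<Sum>r<d. \<phi> r x) ^ i = (\<Sum>g\<in>PiE {..<i} (\<lambda>_. {..<d}). tpoly (i, g) x)"
proof -
  have "(\<Sum>r<d. \<phi> r x) ^ i = (\<Prod>l<i. \<Sum>r<d. \<phi> r x)" by simp
  also have "\<dots> = (\<Sum>g\<in>PiE {..<i} (\<lambda>_. {..<d}). \<Prod>l<i. \<phi> (g l) x)"
    by (rule prod_sum_PiE) auto
  finally show ?thesis by (simp add: tpoly_def)
qed

lemma lower_terms_bound:
  obtains K where "K \<ge> 0" "\<And>x. \<bar>\<Sum>r<d. \<phi> r x\<bar> * lsize k x \<le> K * lsize k x ^ d"
proof -
  have "\<forall>r. \<exists>K. r < d \<longrightarrow> K \<ge> 0 \<and> (\<forall>x. \<bar>\<phi> r x\<bar> \<le> K * lsize k x ^ r)"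
    using hpoly_bound[OF \<phi>] by metis
  then obtain K where K: "\<And>r. r < d \<Longrightarrow> K r \<ge> 0" "\<And>r x. r < d \<Longrightarrow> \<bar>\<phi> r x\<bar> \<le> K r * lsize k x ^ r"
    by metis
  show ?thesis
  proof (rule that[of "\<Sum>r<d. K r"])
    show "(\<Sum>r<d. K r) \<ge> 0" by (intro sum_nonneg) (use K in auto)
    fix x
    let ?N = "lsize k x"
    have "\<bar>\<phi> r x\<bar> * ?N \<le> K r * ?N ^ d" if "r < d" for r
    proof -
      have "\<bar>\<phi> r x\<bar> * ?N \<le> K r * ?N ^ r * ?N"
        using K(2)[OF that] lsize_pos[of k x] by (intro mult_right_mono) auto
      also have "\<dots> = K r * ?N ^ Suc r" by simp
      also have "\<dots> \<le> K r * ?N ^ d"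
        using K(1)[OF that] that lsize_ge_1[of k x] by (intro mult_left_mono power_increasing) auto
      finally show ?thesis .
    qed
    then have "(\<Sum>r<d. \<bar>\<phi> r x\<bar> * ?N) \<le> (\<Sum>r<d. K r * ?N ^ d)" by (intro sum_mono) auto
    moreover have "\<bar>\<Sum>r<d. \<phi> r x\<bar> * ?N \<le> (\<Sum>r<d. \<bar>\<phi> r x\<bar>) * ?N"
      using lsize_pos[of k x] by (intro mult_right_mono sum_abs) auto
    ultimately show "\<bar>\<Sum>r<d. \<phi> r x\<bar> * ?N \<le> (\<Sum>r<d. K r) * ?N ^ d"
      by (simp add: sum_distrib_right)
  qed
qed

lemma series_term_holomorphic: "(\<lambda>s. series_term s x) holomorphic_on UNIV"
proof (cases "x \<in> int_lattice k - F")
  case True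
  then have "P x > 0" using P_pos by blast
  have "(\<lambda>s. exp (- s * of_real (ln (P x)))) holomorphic_on UNIV"
    by (intro holomorphic_intros)
  then show ?thesis using True \<open>P x > 0\<close> by (simp add: series_term_def extend_zero_def powr_def Ln_of_real)
qed (simp only: series_term_def extend_zero_def if_False holomorphic_on_const)

lemma tfun_holomorphic: "(\<lambda>s. tfun \<tau> s x) holomorphic_on UNIV"
proof (cases "x \<in> int_lattice k")
  case True
  have "(\<lambda>s. pterm (tpoly \<tau>) (s + of_nat (fst \<tau>)) x) holomorphic_on UNIV"
    by (rule holomorphic_on_shift[OF pterm_holomorphic[OF True]])
  then show ?thesis unfolding tfun_def zterm_def by (intro holomorphic_intros)
qed (simp add: tfun_def zterm_def lat_ind_def)

text \<open>
  Outside a finite set of lattice points the difference is the remainder of the binomial expansion, of order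
  \<open>I\<close> below the leading one, hence absolutely summable for large \<open>I\<close>. The bound \<open>I \<ge> 2\<close> makes sure
  that the linear term is among the expanded ones.
\<close>

lemma expansion:
  fixes S :: real
  obtains I R where "I \<ge> 2" "R holomorphic_on ball 0 S"
    "\<And>s. s \<in> ball 0 S \<Longrightarrow> h_has_sum k (\<lambda>x. series_term s x - (\<Sum>\<tau>\<in>terms I. tfun \<tau> s x)) (R s)"
proof -
  define I where "I = 2 + nat \<lceil>real d * S + real k + 1\<rceil>"
  have I: "real d * S - real I \<le> - (real k + 1)" unfolding I_def by linarith
  define Q where "Q x = (\<Sum>r<d. \<phi> r x)" for x
  obtain K1 where K1: "K1 \<ge> 0" "\<And>x. \<bar>Q x\<bar> * lsize k x \<le> K1 * lsize k x ^ d"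
    using lower_terms_bound unfolding Q_def by metis
  obtain C R where C: "C \<ge> 0" and
    expand: "\<forall>x B. x \<in> int_lattice k \<and> x \<noteq> 0 \<and> lsize k x \<ge> R \<and> \<bar>B\<bar> * lsize k x \<le> K1 * lsize k x ^ d \<longrightarrow>
      \<bar>B\<bar> \<le> p x / 2 \<and> (\<forall>s::complex. norm s \<le> S \<longrightarrow>
        norm (of_real (p x + B) powr (-s)
          - (\<Sum>l<I. ((-s) gchoose l) * of_real B ^ l * of_real (p x) powr (-s - of_nat l)))
        \<le> C * lsize k x powr (real d * S - real I))"
    by (rule perturbed_power_expansion[OF K1(1), of S I]) (rule that)
  define f where "f x s = series_term s x - (\<Sum>\<tau>\<in>terms I. tfun \<tau> s x)" for x s
  define X where "X = insert 0 (F \<union> {x \<in> int_lattice k. lsize k x < R})"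
  have X: "finite X" using F by (simp add: X_def finite_lsize_less)
  have est: "norm (f x s) \<le> C * lsize k x powr (- (real k + 1))"
    if x: "x \<in> int_lattice k" "x \<notin> X" and s: "norm s \<le> S" for x s
  proof -
    have x0: "x \<noteq> 0" and xF: "x \<notin> F" and N: "lsize k x \<ge> R"
      using x by (auto simp: X_def)
    have "(\<Sum>\<tau>\<in>terms I. tfun \<tau> s x)
        = (\<Sum>i<I. \<Sum>g\<in>PiE {..<i} (\<lambda>_. {..<d}). tfun (i, g) s x)"
      unfolding terms_def by (subst sum.Sigma) (auto intro!: finite_PiE)
    also have "\<dots> = (\<Sum>i<I. ((-s) gchoose i) * of_real (Q x) ^ i * of_real (p x) powr (-s - of_nat i))"
    proof (rule sum.cong[OF refl])
      fix i
      have "(\<Sum>g\<in>PiE {..<i} (\<lambda>_. {..<d}). tfun (i, g) s x)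
         = ((-s) gchoose i) * of_real (\<Sum>g\<in>PiE {..<i} (\<lambda>_. {..<d}). tpoly (i, g) x)
            * of_real (p x) powr (- (s + of_nat i))"
        using x(1) x0 unfolding tfun_def zterm_def pterm_def lat_ind_def tcoef_def
        by (simp add: sum_distrib_left sum_distrib_right mult.assoc)
      also have "\<dots> = ((-s) gchoose i) * of_real (Q x) ^ i * of_real (p x) powr (-s - of_nat i)"
        unfolding terms_expand[symmetric] Q_def by simp
      finally show "(\<Sum>g\<in>PiE {..<i} (\<lambda>_. {..<d}). tfun (i, g) s x)
        = ((-s) gchoose i) * of_real (Q x) ^ i * of_real (p x) powr (-s - of_nat i)" .
    qed
    finally have "f x s = of_real (p x + Q x) powr (-s) -
        (\<Sum>i<I. ((-s) gchoose i) * of_real (Q x) ^ i * of_real (p x) powr (-s - of_nat i))"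
      using x(1) xF by (simp add: f_def series_term_def extend_zero_def P Q_def)
    then have "norm (f x s) \<le> C * lsize k x powr (real d * S - real I)"
      using expand x(1) x0 N K1(2)[of x] s by simp
    also have "\<dots> \<le> C * lsize k x powr (- (real k + 1))"
      using I C lsize_ge_1[of k x] by (intro mult_left_mono powr_mono) auto
    finally show ?thesis .
  qed
  have holo: "f x holomorphic_on UNIV" for x
    unfolding f_def[abs_def] by (intro holomorphic_on_diff holomorphic_on_sum series_term_holomorphic tfun_holomorphic)
  have supp: "f x s = 0" if "x \<notin> int_lattice k" for x s
    using that by (simp add: f_def series_term_def extend_zero_def tfun_def zterm_def lat_ind_def)
  obtain h where h: "h holomorphic_on ball 0 S"
    "\<forall>s\<in>ball 0 S. ((\<lambda>x. f x s) has_sum h s) (rat_space k)"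
    by (rule lattice_sum_holomorphic[OF holo X supp est]) (assumption | rule that)+
  show ?thesis
  proof (rule that[of I h])
    show "I \<ge> 2" by (simp add: I_def)
    show "h holomorphic_on ball 0 S" by (rule h(1))
    show "h_has_sum k (\<lambda>x. series_term s x - (\<Sum>\<tau>\<in>terms I. tfun \<tau> s x)) (h s)" if "s \<in> ball 0 S" for s
      using has_sum_imp_h_has_sum[OF bspec[OF h(2) that]] by (simp add: f_def)
  qed
qed

text \<open>
  Near \<open>z0\<close> only the terms in \<open>B\<close>, those with a pole at \<open>z0\<close>, are singular. Splitting
  \<open>tnum \<tau> s / (s - z0)\<close> into a constant over \<open>s - z0\<close> and a difference quotient isolates the
  polar part. If the series is h-summable at \<open>z0\<close>, then so is the sum of the terms in \<open>B\<close> at \<open>z0\<close>,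
  being the series minus h-summable functions; applying \<open>1 - dilate 2\<close>, of weight \<open>0\<close>, then forces the
  residue to vanish. If moreover the coefficients of these terms vanish at \<open>z0\<close>, they contribute
  nothing to the h-sum at \<open>z0\<close>, whereas they contribute the derivatives of the numerators to the
  analytic part: this is the jump.
\<close>

lemma local_structure:
  fixes z0 :: complex
  obtains A \<rho> I B where "I \<ge> 2" "B \<subseteq> terms I" "\<forall>\<tau>. \<tau> \<in> B \<longleftrightarrow> \<tau> \<in> terms I \<and> tpole \<tau> = z0 \<and> even (tdeg \<tau>)"
    "A analytic_on {z0}" "\<rho> = (\<Sum>\<tau>\<in>B. tnum \<tau> z0)"
    "\<forall>\<^sub>F s in at z0. h_has_sum k (series_term s) (A s + \<rho> / (s - z0))"
    "B = {} \<longrightarrow> h_has_sum k (series_term z0) (A z0)"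
    "\<forall>V. h_has_sum k (series_term z0) V \<longrightarrow> \<rho> = 0"
    "\<forall>V. h_has_sum k (series_term z0) V \<and> (\<forall>\<tau>\<in>B. tcoef \<tau> z0 = 0) \<longrightarrow>
       A z0 - V = (\<Sum>\<tau>\<in>B. deriv (tnum \<tau>) z0)"
proof -
  define S where "S = norm z0 + 1"
  obtain I R where I: "I \<ge> 2" and R: "R holomorphic_on ball 0 S"
    "\<And>s. s \<in> ball 0 S \<Longrightarrow> h_has_sum k (\<lambda>x. series_term s x - (\<Sum>\<tau>\<in>terms I. tfun \<tau> s x)) (R s)"
    using expansion[of S] by blast
  define B where "B = {\<tau> \<in> terms I. tpole \<tau> = z0 \<and> even (tdeg \<tau>)}"
  define C where "C = terms I - B"
  have BI: "B \<subseteq> terms I" and finB: "finite B" and finC: "finite C" and CI: "C \<subseteq> terms I"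
    using finite_terms by (auto simp: B_def C_def)
  have split: "(\<Sum>\<tau>\<in>terms I. h \<tau>) = (\<Sum>\<tau>\<in>C. h \<tau>) + (\<Sum>\<tau>\<in>B. h \<tau>)" for h :: "_ \<Rightarrow> complex"
    unfolding C_def by (rule sum.subset_diff[OF BI finite_terms])
  define D where "D \<tau> s = (if s = z0 then deriv (tnum \<tau>) z0 else (tnum \<tau> s - tnum \<tau> z0) / (s - z0))" for \<tau> s
  define \<rho> where "\<rho> = (\<Sum>\<tau>\<in>B. tnum \<tau> z0)"
  define A where "A s = R s + (\<Sum>\<tau>\<in>C. tnum \<tau> s / (s - tpole \<tau>)) + (\<Sum>\<tau>\<in>B. D \<tau> s)" for s
  have z0S: "z0 \<in> ball 0 S" by (simp add: S_def)
  have C_good: "z0 \<noteq> tpole \<tau> \<or> odd (tdeg \<tau>)" if "\<tau> \<in> C" for \<tau>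
    using that by (auto simp: C_def B_def)
  have C_sum: "h_has_sum k (\<lambda>x. \<Sum>\<tau>\<in>C. tfun \<tau> s x) (\<Sum>\<tau>\<in>C. tnum \<tau> s / (s - tpole \<tau>))"
    if "\<And>\<tau>. \<tau> \<in> C \<Longrightarrow> s \<noteq> tpole \<tau> \<or> odd (tdeg \<tau>)" for s
    by (rule h_has_sum_sum[OF finC tfun_h_has_sum]) (use that CI in auto)
  have A_an: "A analytic_on {z0}"
  proof -
    have "R analytic_on {z0}"
      using R(1) z0S by (intro analytic_at[THEN iffD2] exI[of _ "ball 0 S"]) auto
    moreover have "(\<lambda>s. tnum \<tau> s / (s - tpole \<tau>)) analytic_on {z0}" if "\<tau> \<in> C" for \<tau>
    proof (cases "odd (tdeg \<tau>)")
      case True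
      then show ?thesis by (simp add: tnum_def)
    next
      case False
      then have "z0 - tpole \<tau> \<noteq> 0" using C_good[OF that] by simp
      moreover have "tnum \<tau> holomorphic_on UNIV"
        using that CI by (intro tnum_holomorphic) blast
      then have "tnum \<tau> analytic_on {z0}"
        by (intro analytic_at[THEN iffD2] exI[of _ UNIV]) auto
      ultimately show ?thesis by (intro analytic_on_divide) (auto intro!: analytic_intros)
    qed
    moreover have "D \<tau> analytic_on {z0}" if "\<tau> \<in> B" for \<tau>
    proof -
      have "D \<tau> holomorphic_on UNIV"
      proof -
        have "tnum \<tau> holomorphic_on UNIV"
          using that BI by (intro tnum_holomorphic) blast
        then show ?thesis unfolding D_def[abs_def] by (rule pole_lemma) simp
      qed
      then show ?thesis by (intro analytic_at[THEN iffD2] exI[of _ UNIV]) auto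
    qed
    ultimately show ?thesis unfolding A_def[abs_def] by (intro analytic_on_add analytic_on_sum)
  qed
  show ?thesis
  proof (rule that[of I B A \<rho>, OF I BI _ A_an \<rho>_def])
    show "\<forall>\<tau>. \<tau> \<in> B \<longleftrightarrow> \<tau> \<in> terms I \<and> tpole \<tau> = z0 \<and> even (tdeg \<tau>)" by (simp add: B_def)
    have "\<forall>\<^sub>F s in at z0. \<forall>\<tau>\<in>terms I. s \<noteq> tpole \<tau>"
      by (intro eventually_ball_finite finite_terms ballI eventually_neq_at_within)
    moreover have "\<forall>\<^sub>F s in at z0. s \<in> ball 0 S"
      using z0S by (intro eventually_at_in_open') auto
    moreover have "\<forall>\<^sub>F s in at z0. s \<noteq> z0" by (rule eventually_neq_at_within)
    ultimately show "\<forall>\<^sub>F s in at z0. h_has_sum k (series_term s) (A s + \<rho> / (s - z0))"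
    proof eventually_elim
      case (elim s)
      have "h_has_sum k (\<lambda>x. \<Sum>\<tau>\<in>terms I. tfun \<tau> s x) (\<Sum>\<tau>\<in>terms I. tnum \<tau> s / (s - tpole \<tau>))"
        by (rule h_has_sum_sum[OF finite_terms tfun_h_has_sum]) (use elim in auto)
      from h_has_sum_add[OF R(2)[OF elim(2)] this]
      have "h_has_sum k (series_term s) (R s + (\<Sum>\<tau>\<in>terms I. tnum \<tau> s / (s - tpole \<tau>)))" by simp
      moreover have "(\<Sum>\<tau>\<in>B. tnum \<tau> s / (s - tpole \<tau>)) = (\<Sum>\<tau>\<in>B. D \<tau> s + tnum \<tau> z0 / (s - z0))"
        by (rule sum.cong[OF refl]) (use elim(3) in \<open>simp add: B_def D_def diff_divide_distrib\<close>)
      ultimately show ?case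
        by (simp add: split A_def \<rho>_def sum.distrib sum_divide_distrib add.assoc)
    qed
    show "B = {} \<longrightarrow> h_has_sum k (series_term z0) (A z0)"
      using h_has_sum_add[OF R(2)[OF z0S] C_sum[OF C_good]] by (intro impI) (simp add: split A_def)
    \<comment> \<open>The series minus its summable parts is the polar part.\<close>
    have f0: "h_has_sum k (\<lambda>x. \<Sum>\<tau>\<in>B. tfun \<tau> z0 x) (V - (R z0 + (\<Sum>\<tau>\<in>C. tnum \<tau> z0 / (z0 - tpole \<tau>))))"
      if "h_has_sum k (series_term z0) V" for V
      using h_has_sum_add[OF that h_has_sum_cmult[OF h_has_sum_add[OF R(2)[OF z0S] C_sum[OF C_good]], of "-1"]]
      by (simp add: split algebra_simps)
    show "\<forall>V. h_has_sum k (series_term z0) V \<longrightarrow> \<rho> = 0"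
    proof (intro allI impI)
      fix V assume V: "h_has_sum k (series_term z0) V"
      let ?D = "\<lambda>a x. a x - 1 * dilate 2 a x"
      have D: "dilation_op ?D (1 - 1)" by (rule dilation_op_one_minus) simp
      have "t_has_sum (rat_space k) (?D (tfun \<tau> z0)) (of_nat d * of_real (ln 2) * tnum \<tau> z0)" if "\<tau> \<in> B" for \<tau>
      proof -
        have \<tau>: "\<tau> \<in> terms I" "even (tdeg \<tau>)" "z0 + of_nat (fst \<tau>) = crit_point (tdeg \<tau>)"
          using that by (auto simp: B_def tpole_def)
        from RS.t_has_sum_cmult[OF zeta_num(3)[OF hpoly_tpoly[OF \<tau>(1)]], of "tcoef \<tau> z0"]
        show ?thesis unfolding \<tau>(3)[symmetric] using \<tau>(2)
          by (simp add: tfun_def[abs_def] tnum_def dilate_def algebra_simps)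
      qed
      then have "t_has_sum (rat_space k) (\<lambda>x. \<Sum>\<tau>\<in>B. ?D (tfun \<tau> z0) x) (\<Sum>\<tau>\<in>B. of_nat d * of_real (ln 2) * tnum \<tau> z0)"
        using finB
      proof (induction B rule: infinite_finite_induct)
        case empty
        then show ?case by (simp add: has_sum_imp_t_has_sum has_sum_0)
      next
        case (insert \<tau> B)
        then show ?case using RS.t_has_sum_add by simp
      qed simp
      moreover have "(\<lambda>x. \<Sum>\<tau>\<in>B. ?D (tfun \<tau> z0) x) = ?D (\<lambda>x. \<Sum>\<tau>\<in>B. tfun \<tau> z0 x)"
        by (rule weighted_op_of_sum[OF D finB, symmetric])
      ultimately have "t_has_sum (rat_space k) (?D (\<lambda>x. \<Sum>\<tau>\<in>B. tfun \<tau> z0 x)) (of_nat d * of_real (ln 2) * \<rho>)"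
        by (simp add: \<rho>_def sum_distrib_left)
      from h_has_sum_weight[OF D this f0[OF V]] show "\<rho> = 0" using d by simp
    qed
    show "\<forall>V. h_has_sum k (series_term z0) V \<and> (\<forall>\<tau>\<in>B. tcoef \<tau> z0 = 0) \<longrightarrow>
       A z0 - V = (\<Sum>\<tau>\<in>B. deriv (tnum \<tau>) z0)"
    proof (intro allI impI, elim conjE)
      fix V assume V: "h_has_sum k (series_term z0) V" and B0: "\<forall>\<tau>\<in>B. tcoef \<tau> z0 = 0"
      have "(\<lambda>x. \<Sum>\<tau>\<in>B. tfun \<tau> z0 x) = (\<lambda>x. 0)" by (simp add: tfun_def B0)
      with f0[OF V] have "h_has_sum k (\<lambda>x. 0) (V - (R z0 + (\<Sum>\<tau>\<in>C. tnum \<tau> z0 / (z0 - tpole \<tau>))))" by simp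
      moreover have "h_has_sum k (\<lambda>x. 0) 0" by (rule has_sum_imp_h_has_sum) (simp add: has_sum_0)
      ultimately have "V - (R z0 + (\<Sum>\<tau>\<in>C. tnum \<tau> z0 / (z0 - tpole \<tau>))) = 0" by (rule h_has_sum_unique)
      then show "A z0 - V = (\<Sum>\<tau>\<in>B. deriv (tnum \<tau>) z0)" by (simp add: A_def D_def)
    qed
  qed
qed

end


section \<open>Elliptic polynomials on real space\<close>

lemma mpoly_eval_superset:
  assumes "finite A" "Poly_Mapping.keys Q \<subseteq> A"
  shows "mpoly_eval Q x = (\<Sum>m\<in>A. Poly_Mapping.lookup Q m *
    (\<Prod>i\<in>Poly_Mapping.keys m. x i ^ Poly_Mapping.lookup m i))"
  unfolding mpoly_eval_def
  by (rule sum.mono_neutral_left) (use assms in \<open>auto simp: in_keys_iff\<close>)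

lemma mpoly_eval_add: "mpoly_eval (Q + R) x = mpoly_eval Q x + mpoly_eval R x"
proof -
  let ?A = "Poly_Mapping.keys Q \<union> Poly_Mapping.keys R"
  have A: "finite ?A" by simp
  show ?thesis
    unfolding mpoly_eval_superset[OF A Poly_Mapping.keys_add]
      mpoly_eval_superset[OF A Un_upper1[of "Poly_Mapping.keys Q"]]
      mpoly_eval_superset[OF A Un_upper2[of "Poly_Mapping.keys R"]]
    by (simp add: lookup_add ring_distribs sum.distrib)
qed

lemma mpoly_eval_0: "mpoly_eval 0 x = 0"
  by (simp add: mpoly_eval_def)

lemma mpoly_eval_sum: "mpoly_eval (\<Sum>i\<in>A. Q i) x = (\<Sum>i\<in>A. mpoly_eval (Q i) x)"
  by (induction A rule: infinite_finite_induct) (simp_all add: mpoly_eval_0 mpoly_eval_add)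

lemma mpoly_eval_homogeneous:
  assumes "homogeneous e Q"
  shows "mpoly_eval Q (\<lambda>i. t * x i) = t ^ e * mpoly_eval Q x"
  unfolding mpoly_eval_def sum_distrib_left
proof (rule sum.cong[OF refl])
  fix m assume "m \<in> Poly_Mapping.keys Q"
  then have "(\<Sum>i\<in>Poly_Mapping.keys m. Poly_Mapping.lookup m i) = e"
    using assms by (simp add: homogeneous_def)
  then show "Poly_Mapping.lookup Q m * (\<Prod>i\<in>Poly_Mapping.keys m. (t * x i) ^ Poly_Mapping.lookup m i)
    = t ^ e * (Poly_Mapping.lookup Q m * (\<Prod>i\<in>Poly_Mapping.keys m. x i ^ Poly_Mapping.lookup m i))"
    by (simp add: power_mult_distrib prod.distrib power_sum[symmetric])
qed

lemma continuous_on_mpoly_eval: "continuous_on UNIV (mpoly_eval Q)"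
  unfolding mpoly_eval_def[abs_def]
  by (intro continuous_on_sum continuous_on_mult continuous_on_prod continuous_on_power
      continuous_on_const continuous_on_product_coordinates)

definition rsize :: "nat \<Rightarrow> (nat \<Rightarrow> real) \<Rightarrow> real" where
  "rsize k x = (\<Sum>i<k. \<bar>x i\<bar>)"

lemma abs_le_rsize: "i < k \<Longrightarrow> \<bar>x i\<bar> \<le> rsize k x"
  unfolding rsize_def by (rule member_le_sum) auto

lemma continuous_on_rsize: "continuous_on UNIV (rsize k)"
  unfolding rsize_def[abs_def]
  by (intro continuous_on_sum continuous_on_rabs continuous_on_product_coordinates)

lemma mpoly_eval_bound:
  assumes "homogeneous e Q" "Q \<in> mpolys k"
  shows "\<bar>mpoly_eval Q x\<bar> \<le> (\<Sum>m\<in>Poly_Mapping.keys Q. \<bar>Poly_Mapping.lookup Q m\<bar>) * rsize k x ^ e"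
proof -
  have "\<bar>mpoly_eval Q x\<bar> \<le> (\<Sum>m\<in>Poly_Mapping.keys Q. \<bar>Poly_Mapping.lookup Q m *
      (\<Prod>i\<in>Poly_Mapping.keys m. x i ^ Poly_Mapping.lookup m i)\<bar>)"
    unfolding mpoly_eval_def by (rule sum_abs)
  also have "\<dots> \<le> (\<Sum>m\<in>Poly_Mapping.keys Q. \<bar>Poly_Mapping.lookup Q m\<bar> * rsize k x ^ e)"
  proof (rule sum_mono)
    fix m assume m: "m \<in> Poly_Mapping.keys Q"
    have "(\<Prod>i\<in>Poly_Mapping.keys m. \<bar>x i\<bar> ^ Poly_Mapping.lookup m i)
        \<le> (\<Prod>i\<in>Poly_Mapping.keys m. rsize k x ^ Poly_Mapping.lookup m i)"
    proof (rule prod_mono)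
      fix i assume "i \<in> Poly_Mapping.keys m"
      then have "i < k" using assms(2) m by (auto simp: mpolys_def)
      then show "0 \<le> \<bar>x i\<bar> ^ Poly_Mapping.lookup m i \<and>
          \<bar>x i\<bar> ^ Poly_Mapping.lookup m i \<le> rsize k x ^ Poly_Mapping.lookup m i"
        by (intro conjI power_mono abs_le_rsize) auto
    qed
    also have "\<dots> = rsize k x ^ e"
      using assms(1) m by (simp add: homogeneous_def power_sum[symmetric])
    finally show "\<bar>Poly_Mapping.lookup Q m * (\<Prod>i\<in>Poly_Mapping.keys m. x i ^ Poly_Mapping.lookup m i)\<bar>
        \<le> \<bar>Poly_Mapping.lookup Q m\<bar> * rsize k x ^ e"
      by (simp add: abs_mult abs_prod power_abs mult_left_mono)
  qed
  finally show ?thesis by (simp add: sum_distrib_right)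
qed

lemma compact_coordinate_box: "compact {x :: nat \<Rightarrow> real. \<forall>i. \<bar>x i\<bar> \<le> b}"
proof -
  have "compactin (product_topology (\<lambda>i. euclidean) UNIV) (PiE UNIV (\<lambda>i::nat. {-b..b}))"
    unfolding compactin_PiE by simp
  moreover have "PiE UNIV (\<lambda>i::nat. {-b..b}) = {x. \<forall>i. \<bar>x i\<bar> \<le> b}"
    by (auto simp: PiE_def Pi_def abs_le_iff minus_le_iff)
  ultimately show ?thesis unfolding euclidean_product_topology by simp
qed

lemma closed_Euclidean_topspace: "closed (topspace (Euclidean_space k))"
proof -
  have "closed {x :: nat \<Rightarrow> real. \<forall>i. k \<le> i \<longrightarrow> x i = 0}"
    by (intro closed_Collect_all closed_Collect_imp open_Collect_const closed_Collect_eq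
        continuous_on_product_coordinates continuous_on_const)
  then show ?thesis by (simp add: topspace_Euclidean_space)
qed

text \<open>
  A point of the space is determined by its first \<open>k\<close> coordinates, so a bound on them confines the set to a
  product of compact intervals.
\<close>

lemma compact_rsize_le:
  assumes "closed S" "S \<subseteq> topspace (Euclidean_space k)" "\<And>x. x \<in> S \<Longrightarrow> rsize k x \<le> b"
  shows "compact S"
proof -
  have "S \<subseteq> {x. \<forall>i. \<bar>x i\<bar> \<le> \<bar>b\<bar>}"
  proof (intro subsetI CollectI allI)
    fix x i assume x: "x \<in> S"
    show "\<bar>x i\<bar> \<le> \<bar>b\<bar>"
    proof (cases "i < k")
      case True
      then show ?thesis using abs_le_rsize[OF True, of x] assms(3)[OF x] by linarith
    next
      case False
      then show ?thesis using x assms(2) by (auto simp: topspace_Euclidean_space)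
    qed
  qed
  then have "S = S \<inter> {x. \<forall>i. \<bar>x i\<bar> \<le> \<bar>b\<bar>}" by blast
  also have "compact \<dots>" by (rule closed_Int_compact[OF assms(1) compact_coordinate_box])
  finally show ?thesis .
qed

text \<open>
  The form has a positive minimum on the compact set of points of size \<open>1\<close>, and homogeneity extends the bound
  to all points.
\<close>

lemma elliptic_lower_bound:
  assumes "k \<ge> 1" "homogeneous d Q"
    "\<forall>x\<in>topspace (Euclidean_space k). x \<noteq> (\<lambda>_. 0) \<longrightarrow> mpoly_eval Q x > 0"
  obtains c where "c > 0"
    "\<And>x. x \<in> topspace (Euclidean_space k) \<Longrightarrow> x \<noteq> (\<lambda>_. 0) \<Longrightarrow> mpoly_eval Q x \<ge> c * rsize k x ^ d"
proof -
  define S where "S = topspace (Euclidean_space k) \<inter> {x. rsize k x = 1}"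
  have "closed S" unfolding S_def
    by (intro closed_Int closed_Euclidean_topspace closed_Collect_eq continuous_on_rsize continuous_on_const)
  then have "compact S" by (rule compact_rsize_le[of S k 1]) (auto simp: S_def)
  moreover have "(\<lambda>i. if i = 0 then 1 else 0) \<in> S"
    using assms(1) by (auto simp: S_def topspace_Euclidean_space rsize_def if_distrib[of abs] cong: if_cong)
  then have "S \<noteq> {}" by blast
  ultimately obtain y where y: "y \<in> S" "\<And>x. x \<in> S \<Longrightarrow> mpoly_eval Q y \<le> mpoly_eval Q x"
    using continuous_attains_inf[of S "mpoly_eval Q"] continuous_on_mpoly_eval
    by (meson continuous_on_subset subset_UNIV)
  have "y \<noteq> (\<lambda>_. 0)" using y(1) by (auto simp: S_def rsize_def)
  then have pos: "mpoly_eval Q y > 0" using assms(3) y(1) by (simp add: S_def)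
  show ?thesis
  proof (rule that[OF pos])
    fix x assume x: "x \<in> topspace (Euclidean_space k)" "x \<noteq> (\<lambda>_. 0)"
    obtain i where "x i \<noteq> 0" using x(2) by auto
    moreover have "i < k"
    proof (rule ccontr)
      assume "\<not> i < k"
      then have "x i = 0" using x(1) by (simp add: topspace_Euclidean_space)
      with \<open>x i \<noteq> 0\<close> show False by simp
    qed
    ultimately have R: "rsize k x > 0" using abs_le_rsize[of i k x] by auto
    define z where "z = (\<lambda>i. inverse (rsize k x) * x i)"
    have "rsize k z = inverse (rsize k x) * rsize k x"
      using R by (simp add: z_def rsize_def abs_mult sum_distrib_left)
    then have "z \<in> S" using R x(1) by (auto simp: S_def z_def topspace_Euclidean_space)
    then have "mpoly_eval Q y \<le> inverse (rsize k x) ^ d * mpoly_eval Q x"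
      using y(2)[of z] by (simp only: z_def mpoly_eval_homogeneous[OF assms(2)])
    then show "mpoly_eval Q x \<ge> mpoly_eval Q y * rsize k x ^ d"
      using R by (simp add: power_inverse field_simps)
  qed
qed

lemma of_rat_in_Euclidean: "x \<in> rat_space k \<Longrightarrow> (\<lambda>i. real_of_rat (x i)) \<in> topspace (Euclidean_space k)"
  by (auto simp: rat_space_def topspace_Euclidean_space)

text \<open>
  The form takes positive values both at a unit vector and at its negative.
\<close>

lemma even_degree:
  assumes "elliptic_decomp k d P Pc"
  shows "even d"
proof (rule ccontr)
  assume "odd d"
  define x :: "nat \<Rightarrow> real" where "x = (\<lambda>i. if i = 0 then 1 else 0)"
  have hom: "homogeneous d (Pc d)" and pos: "\<forall>x\<in>topspace (Euclidean_space k). x \<noteq> (\<lambda>_. 0) \<longrightarrow> mpoly_eval (Pc d) x > 0"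
    and k: "k \<ge> 1" using assms by (auto simp: elliptic_decomp_def)
  have x: "x \<in> topspace (Euclidean_space k)" "(\<lambda>i. - 1 * x i) \<in> topspace (Euclidean_space k)"
    using k by (auto simp: x_def topspace_Euclidean_space)
  have "x \<noteq> (\<lambda>_. 0)" "(\<lambda>i. - 1 * x i) \<noteq> (\<lambda>_. 0)" by (auto simp: x_def fun_eq_iff)
  with pos x have "mpoly_eval (Pc d) x > 0" "mpoly_eval (Pc d) (\<lambda>i. - 1 * x i) > 0" by blast+
  then show False using \<open>odd d\<close> unfolding mpoly_eval_homogeneous[OF hom] by simp
qed

lemma mpoly_eval_decomp:
  assumes "elliptic_decomp k d P Pc"
  shows "mpoly_eval P x = mpoly_eval (Pc d) x + (\<Sum>r<d. mpoly_eval (Pc r) x)"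
proof -
  have "P = (\<Sum>i\<le>d. Pc i)" using assms by (simp add: elliptic_decomp_def)
  then have "mpoly_eval P x = (\<Sum>i\<le>d. mpoly_eval (Pc i) x)" by (simp add: mpoly_eval_sum)
  then show ?thesis by (simp add: lessThan_Suc_atMost[symmetric])
qed

lemma compact_nonpositive_set:
  assumes "elliptic_decomp k d P Pc"
  shows "compactin (Euclidean_space k) {x \<in> topspace (Euclidean_space k). mpoly_eval P x \<le> 0}"
proof -
  let ?S = "{x \<in> topspace (Euclidean_space k). mpoly_eval P x \<le> 0}"
  have k: "k \<ge> 1" and d: "d \<ge> 1" and Pc: "\<And>i. i \<le> d \<Longrightarrow> Pc i \<in> mpolys k \<and> homogeneous i (Pc i)"
    and pos: "\<forall>x\<in>topspace (Euclidean_space k). x \<noteq> (\<lambda>_. 0) \<longrightarrow> mpoly_eval (Pc d) x > 0"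
    using assms by (auto simp: elliptic_decomp_def)
  have hd: "homogeneous d (Pc d)" using Pc by blast
  obtain c where c: "c > 0" "\<And>x. x \<in> topspace (Euclidean_space k) \<Longrightarrow> x \<noteq> (\<lambda>_. 0) \<Longrightarrow>
      mpoly_eval (Pc d) x \<ge> c * rsize k x ^ d"
    using elliptic_lower_bound[OF k hd pos] by metis
  define C where "C r = (\<Sum>m\<in>Poly_Mapping.keys (Pc r). \<bar>Poly_Mapping.lookup (Pc r) m\<bar>)" for r
  define b where "b = max 1 ((\<Sum>r<d. C r) / c)"
  have "rsize k x \<le> b" if x: "x \<in> ?S" for x
  proof (rule ccontr)
    let ?R = "rsize k x"
    assume "\<not> ?thesis"
    then have R: "?R > 1" "?R > (\<Sum>r<d. C r) / c" by (auto simp: b_def)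
    have x0: "x \<noteq> (\<lambda>_. 0)" using R(1) by (auto simp: rsize_def)
    have "\<bar>\<Sum>r<d. mpoly_eval (Pc r) x\<bar> \<le> (\<Sum>r<d. \<bar>mpoly_eval (Pc r) x\<bar>)" by (rule sum_abs)
    also have "\<dots> \<le> (\<Sum>r<d. C r * ?R ^ (d - 1))"
    proof (rule sum_mono)
      fix r assume "r \<in> {..<d}"
      then have r: "r < d" by simp
      have "\<bar>mpoly_eval (Pc r) x\<bar> \<le> C r * ?R ^ r"
        unfolding C_def using Pc[of r] r by (intro mpoly_eval_bound) auto
      also have "\<dots> \<le> C r * ?R ^ (d - 1)"
        using r R(1) by (intro mult_left_mono power_increasing) (auto simp: C_def intro: sum_nonneg)
      finally show "\<bar>mpoly_eval (Pc r) x\<bar> \<le> C r * ?R ^ (d - 1)" .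
    qed
    also have "\<dots> = (\<Sum>r<d. C r) * ?R ^ (d - 1)" by (simp add: sum_distrib_right)
    also have "\<dots> < (c * ?R) * ?R ^ (d - 1)"
      using R c(1) by (intro mult_strict_right_mono) (auto simp: field_simps)
    also have "\<dots> = c * ?R ^ d" using d by (cases d) auto
    also have "\<dots> \<le> mpoly_eval (Pc d) x" using c(2) x x0 by blast
    finally have "mpoly_eval P x > 0" unfolding mpoly_eval_decomp[OF assms] by linarith
    with x show False by simp
  qed
  moreover have "closed ?S"
  proof -
    have "closed {x. mpoly_eval P x \<le> 0}"
      by (intro closed_Collect_le continuous_on_mpoly_eval continuous_on_const)
    then have "closed (topspace (Euclidean_space k) \<inter> {x. mpoly_eval P x \<le> 0})"
      by (intro closed_Int closed_Euclidean_topspace)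
    moreover have "topspace (Euclidean_space k) \<inter> {x. mpoly_eval P x \<le> 0} = ?S" by blast
    ultimately show ?thesis by simp
  qed
  ultimately have "compact ?S" by (intro compact_rsize_le[of ?S k b]) auto
  then have "compactin (powertop_real UNIV) ?S" by (simp add: euclidean_product_topology)
  then show ?thesis unfolding Euclidean_space_def compactin_subtopology by auto
qed

text \<open>
  On nonzero lattice points one has \<open>lsize \<le> 2 * rsize\<close>, which accounts for the factor \<open>2 ^ d\<close>.
\<close>

lemma elliptic_poly_of_decomp:
  assumes dec: "elliptic_decomp k d P Pc" and exc: "excluded_set k P F"
  obtains c where "elliptic_poly k d (mpoly_at (Pc d)) c (mpoly_at P) (\<lambda>r. mpoly_at (Pc r)) F"
proof -
  have k: "k \<ge> 1" and d: "d \<ge> 1" and Pc: "\<And>i. i \<le> d \<Longrightarrow> Pc i \<in> mpolys k \<and> homogeneous i (Pc i)"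
    and pos: "\<forall>x\<in>topspace (Euclidean_space k). x \<noteq> (\<lambda>_. 0) \<longrightarrow> mpoly_eval (Pc d) x > 0"
    using dec by (auto simp: elliptic_decomp_def)
  have hd: "homogeneous d (Pc d)" using Pc by blast
  obtain c where c: "c > 0" "\<And>x. x \<in> topspace (Euclidean_space k) \<Longrightarrow> x \<noteq> (\<lambda>_. 0) \<Longrightarrow>
      mpoly_eval (Pc d) x \<ge> c * rsize k x ^ d"
    using elliptic_lower_bound[OF k hd pos] by metis
  have low: "mpoly_at (Pc d) x \<ge> (c / 2 ^ d) * lsize k x ^ d" if x: "x \<in> int_lattice k" "x \<noteq> 0" for x
  proof -
    let ?x = "\<lambda>i. real_of_rat (x i)"
    have sz: "lsize k x = 1 + rsize k ?x" by (simp only: lsize_def rsize_def)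
    obtain i where i: "x i \<noteq> 0" using x(2) by (auto simp: fun_eq_iff)
    have xr: "x \<in> rat_space k" using x(1) int_lattice_subset by blast
    have "i < k"
    proof (rule ccontr)
      assume "\<not> i < k"
      then have "x i = 0" using xr by (simp add: rat_space_def)
      with i show False by simp
    qed
    have "x i \<in> \<int>" using x(1) by (simp add: int_lattice_def)
    then obtain n where n: "x i = of_int n" by (auto elim: Ints_cases)
    have "\<bar>?x i\<bar> \<ge> 1" using i n by (simp flip: of_int_abs)
    then have R1: "rsize k ?x \<ge> 1" using abs_le_rsize[OF \<open>i < k\<close>, of ?x] by linarith
    have "?x \<noteq> (\<lambda>_. 0)" using i by (auto simp: fun_eq_iff)
    then have "c * rsize k ?x ^ d \<le> mpoly_at (Pc d) x"
      unfolding mpoly_at_def using c(2)[OF of_rat_in_Euclidean[OF xr]] by blast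
    moreover have "(c / 2 ^ d) * lsize k x ^ d = c * (lsize k x / 2) ^ d" by (simp add: power_divide)
    moreover have "\<dots> \<le> c * rsize k ?x ^ d"
      using R1 c(1) by (intro mult_left_mono power_mono) (auto simp: sz)
    ultimately show ?thesis by linarith
  qed
  have "elliptic_poly k d (mpoly_at (Pc d)) (c / 2 ^ d) (mpoly_at P) (\<lambda>r. mpoly_at (Pc r)) F"
  proof
    show "hpoly k d (mpoly_at (Pc d))" using Pc[of d] by (intro hpoly_mpoly_at) auto
    show "mpoly_at P x = mpoly_at (Pc d) x + (\<Sum>r<d. mpoly_at (Pc r) x)" for x
      unfolding mpoly_at_def by (rule mpoly_eval_decomp[OF dec])
    show "hpoly k r (mpoly_at (Pc r))" if "r < d" for r
      using Pc[of r] that by (intro hpoly_mpoly_at) auto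
    show "mpoly_at P x > 0" if "x \<in> int_lattice k" "x \<notin> F" for x
    proof (rule ccontr)
      assume "\<not> ?thesis"
      then have "x \<in> {n \<in> int_lattice k. mpoly_at P n \<le> 0}" using that(1) by simp
      then show False using exc that(2) unfolding excluded_set_def by blast
    qed
    show "finite F" "F \<subseteq> int_lattice k" using exc by (simp_all add: excluded_set_def)
    show "c / 2 ^ d > 0" using c(1) by simp
  qed (rule k d even_degree[OF dec] low, assumption?)+
  then show ?thesis by (rule that)
qed

text \<open>
  Distinct exceptional points have distance at least \<open>1 / d\<close>.
\<close>

lemma exc_points_not_islimpt:
  assumes "d \<ge> 1"
  shows "\<not> z islimpt exc_points k d"
proof (rule discrete_imp_not_islimpt[of "1 / real d"])
  show "1 / real d > 0" using assms by simp
  fix x y assume "x \<in> exc_points k d" "y \<in> exc_points k d" and xy: "dist y x < 1 / real d"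
  then obtain i j where x: "x = of_int (int k - i) / of_nat d" and y: "y = of_int (int k - j) / of_nat d"
    unfolding exc_points_def by blast
  have "y - x = of_int (i - j) / of_nat d" by (simp add: x y flip: diff_divide_distrib)
  then have "norm (y - x) = \<bar>real_of_int (i - j)\<bar> / real d"
    by (simp only: norm_divide norm_of_int norm_of_nat)
  then have "\<bar>real_of_int (i - j)\<bar> < 1" using xy assms by (simp add: dist_norm field_simps)
  then have "i = j" by linarith
  then show "y = x" by (simp add: x y)
qed

section \<open>The sum of the series and its continuation\<close>

context elliptic_poly
begin

definition series_sum :: "complex \<Rightarrow> complex" where
  "series_sum s = h_sum_on k (int_lattice k - F) (\<lambda>n. of_real (P n) powr (- s))"

definition series_summable :: "complex \<Rightarrow> bool" where
  "series_summable s \<longleftrightarrow> h_summable_on k (int_lattice k - F) (\<lambda>n. of_real (P n) powr (- s))"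

lemma series_summable_iff: "series_summable s \<longleftrightarrow> (\<exists>V. h_has_sum k (series_term s) V)"
  by (simp add: series_summable_def h_summable_on_def series_term_def)

lemma series_sum_eq: "h_has_sum k (series_term s) V \<Longrightarrow> series_sum s = V"
  unfolding series_sum_def by (rule h_sum_on_eq) (simp add: series_term_def)

text \<open>
  The pole is \<open>(k - j)/d\<close> with \<open>j = d * i - q\<close>, where \<open>q \<le> d * i\<close> is the degree of the term; \<open>j\<close> is even
  because \<open>d\<close> and \<open>q\<close> are.
\<close>

lemma tpole_exc_points:
  assumes "\<tau> \<in> terms I" "even (tdeg \<tau>)"
  shows "tpole \<tau> \<in> exc_points k d"
proof -
  let ?j = "int (d * fst \<tau>) - int (tdeg \<tau>)"
  have "?j \<ge> 0" using tdeg_le[OF assms(1)] by linarith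
  moreover have "even ?j" using assms(2) d_even by simp
  moreover have "tpole \<tau> = of_int (int k - ?j) / of_nat d"
    using d by (simp add: tpole_def crit_point_def field_simps)
  ultimately show ?thesis unfolding exc_points_def by blast
qed

lemma series_sum_local:
  obtains A \<rho> where "A analytic_on {z0}" "\<forall>\<^sub>F s in at z0. series_sum s = A s + \<rho> / (s - z0)"
    "z0 \<notin> exc_points k d \<longrightarrow> series_summable z0 \<and> series_sum z0 = A z0" "series_summable z0 \<longrightarrow> \<rho> = 0"
proof -
  obtain A \<rho> I B where "I \<ge> 2" and L: "B \<subseteq> terms I"
    "\<forall>\<tau>. \<tau> \<in> B \<longleftrightarrow> \<tau> \<in> terms I \<and> tpole \<tau> = z0 \<and> even (tdeg \<tau>)"
    "A analytic_on {z0}" "\<rho> = (\<Sum>\<tau>\<in>B. tnum \<tau> z0)"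
    "\<forall>\<^sub>F s in at z0. h_has_sum k (series_term s) (A s + \<rho> / (s - z0))"
    "B = {} \<longrightarrow> h_has_sum k (series_term z0) (A z0)"
    "\<forall>V. h_has_sum k (series_term z0) V \<longrightarrow> \<rho> = 0"
    "\<forall>V. h_has_sum k (series_term z0) V \<and> (\<forall>\<tau>\<in>B. tcoef \<tau> z0 = 0) \<longrightarrow>
       A z0 - V = (\<Sum>\<tau>\<in>B. deriv (tnum \<tau>) z0)"
    by (rule local_structure[of z0]) (rule that)
  show ?thesis
  proof (rule that[OF L(3)])
    show "\<forall>\<^sub>F s in at z0. series_sum s = A s + \<rho> / (s - z0)"
      using L(5) by eventually_elim (rule series_sum_eq)
    show "series_summable z0 \<longrightarrow> \<rho> = 0" 
    proof
      assume "series_summable z0"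
      then obtain V where "h_has_sum k (series_term z0) V" unfolding series_summable_iff ..
      then show "\<rho> = 0" by (rule L(7)[rule_format])
    qed
    show "z0 \<notin> exc_points k d \<longrightarrow> series_summable z0 \<and> series_sum z0 = A z0"
    proof
      assume "z0 \<notin> exc_points k d"
      have "\<tau> \<notin> B" for \<tau>
      proof
        assume "\<tau> \<in> B"
        then have "\<tau> \<in> terms I \<and> tpole \<tau> = z0 \<and> even (tdeg \<tau>)" using L(2) by simp
        then show False using tpole_exc_points[of \<tau> I] \<open>z0 \<notin> exc_points k d\<close> by simp
      qed
      then have "B = {}" by (simp add: set_eq_iff)
      then have V: "h_has_sum k (series_term z0) (A z0)" by (rule L(6)[rule_format])
      then have "series_summable z0" unfolding series_summable_iff ..
      with series_sum_eq[OF V] show "series_summable z0 \<and> series_sum z0 = A z0" by simp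
    qed
  qed
qed

lemma series_summable_off_exc: "s \<notin> exc_points k d \<Longrightarrow> series_summable s"
  by (rule series_sum_local[of s]) blast

lemma series_sum_analytic:
  assumes "z \<notin> exc_points k d"
  shows "series_sum analytic_on {z}"
proof -
  obtain A \<rho> where A: "A analytic_on {z}" "\<forall>\<^sub>F s in at z. series_sum s = A s + \<rho> / (s - z)"
    "z \<notin> exc_points k d \<longrightarrow> series_summable z \<and> series_sum z = A z" "series_summable z \<longrightarrow> \<rho> = 0"
    by (rule series_sum_local[of z]) (rule that)
  moreover have "series_sum z = A z" "\<rho> = 0" using A(3,4) assms by blast+
  ultimately have "\<forall>\<^sub>F s in nhds z. series_sum s = A s" by (simp add: eventually_nhds_conv_at)
  then show ?thesis using analytic_at_cong[of series_sum A z z] A(1) by simp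
qed

lemma series_sum_holomorphic: "series_sum holomorphic_on (- exc_points k d)"
proof -
  have "\<forall>z\<in>- exc_points k d. series_sum analytic_on {z}" using series_sum_analytic by simp
  then have "series_sum analytic_on (- exc_points k d)" unfolding analytic_on_analytic_at[of series_sum "- exc_points k d"] .
  then show ?thesis by (rule analytic_imp_holomorphic)
qed

lemma series_sum_meromorphic: "series_sum meromorphic_on UNIV"
proof (subst meromorphic_on_meromorphic_at, intro ballI)
  fix z
  obtain A \<rho> where A: "A analytic_on {z}" "\<forall>\<^sub>F s in at z. series_sum s = A s + \<rho> / (s - z)"
    "z \<notin> exc_points k d \<longrightarrow> series_summable z \<and> series_sum z = A z" "series_summable z \<longrightarrow> \<rho> = 0"
    by (rule series_sum_local[of z]) (rule that)
  have "(\<lambda>s. A s + \<rho> / (s - z)) meromorphic_on {z}"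
    using analytic_on_imp_meromorphic_on[OF A(1)] by (intro meromorphic_intros)
  then show "series_sum meromorphic_on {z}"
    by (subst meromorphic_on_cong[where g="\<lambda>s. A s + \<rho> / (s - z)" and B="{z}"]) (use A(2) in auto)
qed

lemma simple_pole_zorder:
  assumes "A analytic_on {z}" "\<forall>\<^sub>F s in at z. g s = A s + \<rho> / (s - z)" "is_pole g z"
  shows "zorder g z = -1"
proof -
  have pole: "is_pole (\<lambda>s. A s + \<rho> / (s - z)) z"
    using assms(3) is_pole_cong[OF assms(2) refl] by simp
  have "\<rho> \<noteq> 0"
  proof
    assume "\<rho> = 0"
    with pole have "is_pole A z" by simp
    then show False using assms(1) analytic_at_imp_no_pole by blast
  qed
  obtain S where S: "open S" "z \<in> S" "A holomorphic_on S" using assms(1) unfolding analytic_at by blast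
  obtain T where T: "open T" "z \<in> T" "\<And>s. s \<in> T \<Longrightarrow> s \<noteq> z \<Longrightarrow> g s = A s + \<rho> / (s - z)"
    using assms(2) unfolding eventually_at_topological by blast
  show ?thesis
  proof (rule zorder_eqI[of "S \<inter> T" z "\<lambda>s. A s * (s - z) + \<rho>"])
    show "(\<lambda>s. A s * (s - z) + \<rho>) holomorphic_on S \<inter> T"
      using S(3) by (intro holomorphic_intros) (auto intro: holomorphic_on_subset)
    fix s assume "s \<in> S \<inter> T" "s \<noteq> z"
    then show "g s = (A s * (s - z) + \<rho>) * (s - z) powi (- 1)"
      using T(3)[of s] by (simp add: field_simps power_int_minus)
  qed (use S T \<open>\<rho> \<noteq> 0\<close> in auto)
qed

lemma ex_continuation:
  "\<exists>Gt. mero_continuation (exc_points k d) series_sum Gt \<and> at_most_simple_poles Gt"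
proof (intro exI conjI)
  let ?Gt = "remove_sings series_sum"
  show "mero_continuation (exc_points k d) series_sum ?Gt"
    unfolding mero_continuation_def
    using remove_sings_nicely_meromorphic[OF series_sum_meromorphic] series_sum_analytic by auto
  show "at_most_simple_poles ?Gt"
    unfolding at_most_simple_poles_def
  proof (intro allI impI)
    fix z assume pole: "is_pole ?Gt z"
  obtain A \<rho> where A: "A analytic_on {z}" "\<forall>\<^sub>F s in at z. series_sum s = A s + \<rho> / (s - z)"
    "z \<notin> exc_points k d \<longrightarrow> series_summable z \<and> series_sum z = A z" "series_summable z \<longrightarrow> \<rho> = 0"
    by (rule series_sum_local[of z]) (rule that)
    have "isolated_singularity_at series_sum z"
      using series_sum_meromorphic by (simp add: meromorphic_on_altdef)
    from eventually_remove_sings_eq_at[OF this] A(2)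
    have "\<forall>\<^sub>F s in at z. ?Gt s = A s + \<rho> / (s - z)" by eventually_elim simp
    from simple_pole_zorder[OF A(1) this pole] show "zorder ?Gt z = -1" .
  qed
qed

text \<open>
  Exceptional points are isolated, so near \<open>z\<close> the continuation agrees with the sum and hence with \<open>A\<close>;
  being nicely meromorphic it takes the limit as its value.
\<close>

lemma continuation_value:
  assumes cont: "mero_continuation (exc_points k d) series_sum Gt"
    and A: "A analytic_on {z}" "\<forall>\<^sub>F s in at z. series_sum s = A s"
  shows "Gt analytic_on {z}" "Gt z = A z"
proof -
  have "\<forall>\<^sub>F s in at z. s \<notin> exc_points k d"
    using exc_points_not_islimpt[OF d] by (simp add: islimpt_iff_eventually)
  with A(2) have ev: "\<forall>\<^sub>F s in at z. Gt s = A s"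
    by eventually_elim (use cont in \<open>auto simp: mero_continuation_def\<close>)
  have "A \<midarrow>z\<rightarrow> A z" using A(1) by (intro isContD analytic_at_imp_isCont)
  then have lim: "Gt \<midarrow>z\<rightarrow> A z" using tendsto_cong[OF ev] by simp
  then have np: "\<not> is_pole Gt z"
    unfolding is_pole_def using not_tendsto_and_filterlim_at_infinity[of "at z"] by auto
  show an: "Gt analytic_on {z}"
    by (rule nicely_meromorphic_on_imp_analytic_at[of Gt UNIV]) (use cont np in \<open>auto simp: mero_continuation_def\<close>)
  have "Gt \<midarrow>z\<rightarrow> Gt z" using an by (intro isContD analytic_at_imp_isCont)
  then show "Gt z = A z" using lim by (rule tendsto_unique[OF at_neq_bot])
qed

lemma continuation_analytic:
  assumes "mero_continuation (exc_points k d) series_sum Gt" "series_summable z"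
  shows "Gt analytic_on {z}"
proof -
  obtain A \<rho> where A: "A analytic_on {z}" "\<forall>\<^sub>F s in at z. series_sum s = A s + \<rho> / (s - z)"
    "z \<notin> exc_points k d \<longrightarrow> series_summable z \<and> series_sum z = A z" "series_summable z \<longrightarrow> \<rho> = 0"
    by (rule series_sum_local[of z]) (rule that)
  have "\<rho> = 0" using A(4) assms(2) by blast
  with A(1,2) show ?thesis by (intro continuation_value(1)[OF assms(1), of A]) simp_all
qed

text \<open>
  Expand the power into products of the homogeneous parts, each of which has h-sum \<open>0\<close>.
\<close>

lemma P_power_h_sum: "h_has_sum k (\<lambda>x. of_real (P x ^ n) * lat_ind k x) 0"
proof -
  define \<psi> where "\<psi> r = (if r = d then p else \<phi> r)" for r
  have \<psi>: "hpoly k r (\<psi> r)" if "r \<le> d" for r using that p \<phi> by (auto simp: \<psi>_def)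
  have P\<psi>: "P x = (\<Sum>r\<le>d. \<psi> r x)" for x
  proof -
    have "(\<Sum>r\<le>d. \<psi> r x) = (\<Sum>r<d. \<phi> r x) + p x"
      unfolding lessThan_Suc_atMost[symmetric] by (simp add: \<psi>_def)
    then show ?thesis by (simp add: P)
  qed
  let ?E = "PiE {..<n} (\<lambda>_. {..d})"
  have "P x ^ n = (\<Sum>g\<in>?E. \<Prod>l<n. \<psi> (g l) x)" for x
  proof -
    have "P x ^ n = (\<Prod>l<n. \<Sum>r\<le>d. \<psi> r x)" by (simp add: P\<psi>)
    also have "\<dots> = (\<Sum>g\<in>?E. \<Prod>l<n. \<psi> (g l) x)" by (rule prod_sum_PiE) auto
    finally show ?thesis .
  qed
  then have eq: "(\<lambda>x. of_real (P x ^ n) * lat_ind k x)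
      = (\<lambda>x. \<Sum>g\<in>?E. of_real (\<Prod>l<n. \<psi> (g l) x) * lat_ind k x)"
    by (simp add: sum_distrib_right fun_eq_iff)
  have "h_has_sum k (\<lambda>x. of_real (\<Prod>l<n. \<psi> (g l) x) * lat_ind k x) 0" if g: "g \<in> ?E" for g
  proof (rule h_has_sum_polynomial[OF _ k])
    show "hpoly k (\<Sum>l<n. g l) (\<lambda>x. \<Prod>l<n. \<psi> (g l) x)"
    proof (rule hpoly_prod)
      fix l assume "l \<in> {..<n}"
      then have "g l \<le> d" using PiE_mem[OF g, of l] by simp
      then show "hpoly k (g l) (\<psi> (g l))" by (rule \<psi>)
    qed
  qed
  then have "h_has_sum k (\<lambda>x. \<Sum>g\<in>?E. of_real (\<Prod>l<n. \<psi> (g l) x) * lat_ind k x) (\<Sum>g\<in>?E. 0)"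
    by (intro h_has_sum_sum finite_PiE) auto
  then show ?thesis unfolding eq by simp
qed

lemma series_term_nonpos_int:
  fixes s :: int
  assumes "s \<le> 0"
  shows "h_has_sum k (series_term (of_int s)) (- (\<Sum>n\<in>F. of_real (P n) ^ nat (- s)))"
proof -
  define N where "N = nat (- s)"
  have s: "- (of_int s :: complex) = of_nat N" using assms by (simp add: N_def)
  define b where "b x = (if x \<in> F then complex_of_real (P x) ^ N else 0)" for x
  have "h_has_sum k b (\<Sum>x\<in>F. b x)"
    by (rule h_has_sum_finite_support) (use F int_lattice_subset in \<open>auto simp: b_def\<close>)
  from h_has_sum_add[OF P_power_h_sum[of N] h_has_sum_cmult[OF this, of "-1"]]
  have "h_has_sum k (\<lambda>x. of_real (P x ^ N) * lat_ind k x + - 1 * b x) (- (\<Sum>x\<in>F. b x))" by simp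
  moreover have "of_real (P x ^ N) * lat_ind k x + - 1 * b x = series_term (of_int s) x" for x
  proof (cases "x \<in> F")
    case True
    then show ?thesis using F(2) by (auto simp: b_def lat_ind_def series_term_def extend_zero_def)
  next
    case False
    then show ?thesis
      using P_pos[of x] unfolding series_term_def extend_zero_def s b_def lat_ind_def
      by (auto simp: powr_nat')
  qed
  moreover have "(\<Sum>x\<in>F. b x) = (\<Sum>n\<in>F. of_real (P n) ^ nat (- s))"
    by (simp add: b_def N_def)
  ultimately show ?thesis by simp
qed

lemma nonpos_int_not_exc:
  fixes s :: int
  assumes "odd k"
  shows "of_int s \<notin> exc_points k d"
proof
  assume "of_int s \<in> exc_points k d"
  then obtain j where j: "even j" "(of_int s :: complex) = of_int (int k - j) / of_nat d"
    unfolding exc_points_def by blast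
  then have "(of_int (s * int d) :: complex) = of_int (int k - j)" using d by (simp add: field_simps)
  then have "s * int d = int k - j" by (simp only: of_int_eq_iff)
  moreover have "even (s * int d)" using d_even by simp
  ultimately show False using j(1) assms by simp
qed

end


section \<open>A sum that differs from the continuation\<close>

context elliptic_form
begin

lemma zeta_num_zero: "zeta_num q (\<lambda>_. 0) (crit_point q) = 0"
proof -
  have "zterm (\<lambda>_. 0) s = (\<lambda>_. 0)" for s by (simp add: zterm_def pterm_def fun_eq_iff)
  with zeta_num(3)[OF hpoly_0[of k q]]
  have "t_has_sum (rat_space k) (\<lambda>_. 0) (of_nat d * of_real (ln 2) * zeta_num q (\<lambda>_. 0) (crit_point q))"
    by (simp add: dilate_def)
  moreover have "t_has_sum (rat_space k) (\<lambda>_. 0) 0"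
    by (rule has_sum_imp_t_has_sum) (simp_all add: has_sum_0)
  ultimately have "of_nat d * of_real (ln 2) * zeta_num q (\<lambda>_. 0) (crit_point q) = 0"
    by (rule RS.t_has_sum_unique)
  then show ?thesis using d by simp
qed

lemma zterm_one_has_sum:
  fixes t :: real
  assumes t: "t > 0"
  shows "zterm (\<lambda>_. 1) (of_real (real k / real d + t)) summable_on rat_space k"
proof -
  define \<sigma> where "\<sigma> = real k / real d + t"
  have \<sigma>: "\<sigma> > 0" unfolding \<sigma>_def using t by (intro add_nonneg_pos) auto
  have d\<sigma>: "real d * \<sigma> > real k" using t d by (simp add: \<sigma>_def field_simps)
  have "(\<lambda>x. c powr (- \<sigma>) * lsize k x powr (- (real d * \<sigma>))) summable_on int_lattice k"
    using d\<sigma> by (intro summable_on_cmult_right summable_on_lsize_powr)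
  then have "(\<lambda>x. norm (zterm (\<lambda>_. 1) (of_real \<sigma>) x)) summable_on int_lattice k"
  proof (rule summable_on_comparison_test)
    fix x assume x: "x \<in> int_lattice k"
    show "norm (zterm (\<lambda>_. 1) (of_real \<sigma>) x) \<le> c powr (- \<sigma>) * lsize k x powr (- (real d * \<sigma>))"
    proof (cases "x = 0")
      case False
      have px: "p x > 0" using p_pos[OF x False] .
      have "norm (zterm (\<lambda>_. 1) (of_real \<sigma>) x) = p x powr (- \<sigma>)"
        using False x px by (simp add: zterm_def pterm_def lat_ind_def norm_powr_real_powr)
      also have "\<dots> \<le> (c * lsize k x ^ d) powr (- \<sigma>)"
        using lower[OF x False] c lsize_pos[of k x] \<sigma> by (intro powr_mono2') auto
      also have "\<dots> = c powr (- \<sigma>) * lsize k x powr (- (real d * \<sigma>))"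
        using c lsize_pos[of k x] by (simp add: powr_mult powr_powr flip: powr_realpow)
      finally show ?thesis .
    qed (simp add: zterm_def pterm_def)
  qed auto
  then have "zterm (\<lambda>_. 1) (of_real \<sigma>) summable_on int_lattice k"
    by (rule Infinite_Sum.abs_summable_summable)
  then show ?thesis unfolding \<sigma>_def[symmetric]
    by (subst summable_on_cong_neutral[where S = "rat_space k" and T = "int_lattice k" and g = "zterm (\<lambda>_. 1) (of_real \<sigma>)"])
      (use int_lattice_subset in \<open>auto simp: zterm_def lat_ind_def\<close>)
qed

text \<open>
  Right of the critical point \<open>\<sigma> = k/d\<close> the series of \<open>p powr (-\<sigma> - t)\<close> converges absolutely and has positive
  terms, so its sum \<open>Y (\<sigma> + t) / t\<close> dominates every finite partial sum. If \<open>Y\<close> vanishes at \<open>\<sigma>\<close>,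
  this quotient stays bounded as \<open>t\<close> tends to \<open>0\<close>, and the partial sums at \<open>t = 0\<close> are bounded.
\<close>

lemma zeta_num_one_finite_sums:
  assumes Y0: "zeta_num 0 (\<lambda>_. 1) (crit_point 0) = 0"
    and A: "finite A" "A \<subseteq> int_lattice k" "0 \<notin> A"
  shows "(\<Sum>x\<in>A. p x powr (- (real k / real d))) \<le> Re (deriv (zeta_num 0 (\<lambda>_. 1)) (crit_point 0))"
proof -
  define Y where "Y = zeta_num 0 (\<lambda>_. 1)"
  define \<sigma> where "\<sigma> = real k / real d"
  have cr: "crit_point 0 = of_real \<sigma>" by (simp add: crit_point_def \<sigma>_def)
  have pA: "p x > 0" if "x \<in> A" for x using p_pos[of x] A that by auto
  have lim1: "((\<lambda>t. \<Sum>x\<in>A. p x powr (- (\<sigma> + t))) \<longlongrightarrow> (\<Sum>x\<in>A. p x powr (- (\<sigma> + 0)))) (at_right (0::real))"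
    by (intro tendsto_sum tendsto_powr tendsto_const tendsto_minus tendsto_add tendsto_ident_at)
      (use pA in force)
  have "Y holomorphic_on UNIV" unfolding Y_def by (rule zeta_num(1)[OF hpoly_const])
  then have "(Y has_field_derivative deriv Y (of_real \<sigma>)) (at (of_real \<sigma>))"
    by (intro holomorphic_derivI[of Y UNIV]) auto
  then have "((\<lambda>h. (Y (of_real \<sigma> + h) - Y (of_real \<sigma>)) / h) \<longlongrightarrow> deriv Y (of_real \<sigma>)) (at 0)"
    by (simp only: DERIV_def)
  moreover have "filterlim (\<lambda>t. complex_of_real t) (at 0) (at_right (0::real))"
    unfolding filterlim_at
    by (auto intro!: tendsto_eq_intros simp: eventually_at_filter)
  ultimately have "((\<lambda>t. (Y (of_real \<sigma> + of_real t) - Y (of_real \<sigma>)) / of_real t) \<longlongrightarrow> deriv Y (of_real \<sigma>)) (at_right (0::real))"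
    by (rule filterlim_compose)
  then have lim2: "((\<lambda>t. Re (Y (of_real \<sigma> + of_real t) / of_real t)) \<longlongrightarrow> Re (deriv Y (of_real \<sigma>))) (at_right (0::real))"
    using Y0 by (intro tendsto_Re) (simp add: Y_def cr)
  have "\<forall>\<^sub>F t in at_right (0::real). t > 0" by (simp add: eventually_at_filter)
  then have ev: "\<forall>\<^sub>F t in at_right (0::real). (\<Sum>x\<in>A. p x powr (- (\<sigma> + t))) \<le> Re (Y (of_real \<sigma> + of_real t) / of_real t)"
  proof eventually_elim
    case (elim t)
    let ?z = "zterm (\<lambda>_. 1) (of_real (\<sigma> + t))"
    have "of_real (\<sigma> + t) \<noteq> crit_point 0" using elim by (simp add: cr)
    from zeta_num(2)[OF hpoly_const this]
    have 1: "h_has_sum k ?z (Y (of_real \<sigma> + of_real t) / of_real t)" by (simp add: cr Y_def)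
    have "(?z has_sum infsum ?z (rat_space k)) (rat_space k)"
      using zterm_one_has_sum[OF elim] by (simp add: \<sigma>_def has_sum_infsum)
    moreover from has_sum_imp_h_has_sum[OF this]
    have "infsum ?z (rat_space k) = Y (of_real \<sigma> + of_real t) / of_real t"
      using 1 by (rule h_has_sum_unique)
    ultimately have "(?z has_sum (Y (of_real \<sigma> + of_real t) / of_real t)) (rat_space k)" by simp
    then have hs: "((\<lambda>x. Re (?z x)) has_sum Re (Y (of_real \<sigma> + of_real t) / of_real t)) (rat_space k)"
      by (rule has_sum_Re)
    have zx: "Re (?z x) = (if x \<in> int_lattice k \<and> x \<noteq> 0 then p x powr (- (\<sigma> + t)) else 0)" for x
    proof (cases "x \<in> int_lattice k \<and> x \<noteq> 0")
      case True
      then have "p x > 0" using p_pos by blast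
      then have "complex_of_real (p x) powr - complex_of_real (\<sigma> + t) = of_real (p x powr (- (\<sigma> + t)))"
        using powr_of_real[of "p x" "- (\<sigma> + t)"] by (simp only: of_real_minus less_imp_le)
      then show ?thesis using True by (simp add: zterm_def pterm_def lat_ind_def)
    qed (auto simp: zterm_def pterm_def lat_ind_def)
    have "(\<Sum>x\<in>A. p x powr (- (\<sigma> + t))) = (\<Sum>x\<in>A. Re (?z x))"
    proof (rule sum.cong[OF refl])
      fix x assume "x \<in> A"
      then have "x \<in> int_lattice k \<and> x \<noteq> 0" using A by blast
      then show "p x powr (- (\<sigma> + t)) = Re (?z x)" unfolding zx by simp
    qed
    also have "\<dots> \<le> infsum (\<lambda>x. Re (?z x)) (rat_space k)"
    proof (rule finite_sum_le_infsum)
      show "(\<lambda>x. Re (?z x)) summable_on rat_space k" using hs by (rule has_sum_imp_summable)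
      show "finite A" "A \<subseteq> rat_space k" using A int_lattice_subset by blast+
      show "0 \<le> Re (?z x)" for x unfolding zx by simp
    qed
    also have "\<dots> = Re (Y (of_real \<sigma> + of_real t) / of_real t)" using hs by (rule infsumI)
    finally show ?case .
  qed
  have "(\<Sum>x\<in>A. p x powr (- (\<sigma> + 0))) \<le> Re (deriv Y (of_real \<sigma>))"
    by (rule tendsto_le[OF _ lim2 lim1 ev]) simp
  then show ?thesis by (simp add: Y_def cr \<sigma>_def)
qed

end

lemma mpoly_eval_single:
  "mpoly_eval (Poly_Mapping.single m c) x =
    c * (\<Prod>i\<in>Poly_Mapping.keys m. x i ^ Poly_Mapping.lookup m i)"
  by (simp add: mpoly_eval_def)

lemma homogeneous_add: "homogeneous e Q \<Longrightarrow> homogeneous e R \<Longrightarrow> homogeneous e (Q + R)"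
  using Poly_Mapping.keys_add[of Q R] unfolding homogeneous_def by blast

lemma mpolys_add: "Q \<in> mpolys k \<Longrightarrow> R \<in> mpolys k \<Longrightarrow> Q + R \<in> mpolys k"
  using Poly_Mapping.keys_add[of Q R] unfolding mpolys_def by blast

definition epstein_parts :: "nat \<Rightarrow> real_mpoly" where
  "epstein_parts i = (if i = 0 then Poly_Mapping.single 0 1
     else if i = 2 then Poly_Mapping.single (Poly_Mapping.single 0 2) 1 + Poly_Mapping.single (Poly_Mapping.single 1 2) 1
     else 0)"

definition epstein_poly :: real_mpoly where
  "epstein_poly = (\<Sum>i\<le>2. epstein_parts i)"

lemma epstein_parts_eval:
  "mpoly_eval (epstein_parts 0) x = 1" "mpoly_eval (epstein_parts (Suc 0)) x = 0"
  "mpoly_eval (epstein_parts 2) x = x 0 ^ 2 + x 1 ^ 2"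
  by (simp_all add: epstein_parts_def mpoly_eval_single mpoly_eval_add mpoly_eval_0
      del: single_one single_numeral)

lemma epstein_decomp: "elliptic_decomp 2 2 epstein_poly epstein_parts"
proof -
  have parts: "epstein_parts i \<in> mpolys 2 \<and> homogeneous i (epstein_parts i)" for i
    unfolding epstein_parts_def
    by (auto intro!: mpolys_add homogeneous_add simp del: single_one single_numeral)
      (auto simp: mpolys_def homogeneous_def simp del: single_one single_numeral)
  have sum: "(\<Sum>i\<in>A. epstein_parts i) \<in> mpolys 2" if "finite A" for A
    using that by (induction A rule: finite_induct) (auto intro!: mpolys_add simp: parts, simp add: mpolys_def)
  have "mpoly_eval (epstein_parts 2) x > 0"
    if x: "x \<in> topspace (Euclidean_space 2)" "x \<noteq> (\<lambda>_. 0)" for x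
  proof -
    have "x 0 \<noteq> 0 \<or> x 1 \<noteq> 0"
    proof (rule ccontr)
      assume a: "\<not> ?thesis"
      have "x i = 0" for i
      proof (cases "i \<ge> 2")
        case True
        then show ?thesis using x(1) by (simp add: topspace_Euclidean_space)
      next
        case False
        then have "i = 0 \<or> i = 1" by linarith
        with a show ?thesis by auto
      qed
      with x(2) show False by auto
    qed
    then show ?thesis unfolding epstein_parts_eval by (simp add: sum_power2_gt_zero_iff)
  qed
  then show ?thesis unfolding elliptic_decomp_def
    using parts sum[of "{..2}"] by (auto simp: epstein_poly_def)
qed

lemma epstein_excluded: "excluded_set 2 epstein_poly {}"
proof -
  have "mpoly_at epstein_poly n > 0" for n
  proof -
    have "mpoly_at epstein_poly n = (real_of_rat (n 0))\<^sup>2 + (real_of_rat (n 1))\<^sup>2 + 1"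
      unfolding mpoly_at_def mpoly_eval_decomp[OF epstein_decomp] epstein_parts_eval(3)
      by (simp add: numeral_2_eq_2 epstein_parts_eval(1,2) del: One_nat_def)
    then show ?thesis by (simp add: add_nonneg_pos)
  qed
  then show ?thesis by (simp add: excluded_set_def not_le)
qed

text \<open>
  The \<open>a\<close> points \<open>(a, b)\<close> with \<open>1 \<le> b \<le> a\<close> contribute at least \<open>a / (2 a\<^sup>2)\<close>, half a
  harmonic term.
\<close>

lemma epstein_sums_unbounded:
  obtains A where "finite A" "A \<subseteq> int_lattice 2" "0 \<notin> A"
    "(\<Sum>x\<in>A. mpoly_at (epstein_parts 2) x powr (- 1)) > b"
proof -
  define f :: "nat \<times> nat \<Rightarrow> nat \<Rightarrow> rat" where
    "f = (\<lambda>(a, b) i. if i = 0 then of_nat a else if i = 1 then of_nat b else 0)"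
  have f: "f (a, b) 0 = of_nat a" "f (a, b) 1 = of_nat b" for a b by (simp_all add: f_def)
  have inj: "inj f"
  proof (rule injI)
    fix u v assume "f u = f v"
    then have "f (fst u, snd u) = f (fst v, snd v)" by simp
    then have "f (fst u, snd u) 0 = f (fst v, snd v) 0" "f (fst u, snd u) 1 = f (fst v, snd v) 1"
      by (simp_all only:)
    then show "u = v" unfolding f by (simp add: prod_eq_iff)
  qed
  obtain n where n: "harm n > 2 * b"
  proof -
    have "filterlim (harm :: nat \<Rightarrow> real) at_top sequentially" by (rule harm_at_top)
    then have "\<forall>\<^sub>F n in sequentially. harm n > 2 * b" by (simp add: filterlim_at_top_dense)
    then show ?thesis using that eventually_happens'[OF sequentially_bot] by blast
  qed
  let ?I = "Sigma {1..n} (\<lambda>a. {1..a})"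
  show ?thesis
  proof (rule that[of "f ` ?I"])
    show "f ` ?I \<subseteq> int_lattice 2"
      by (auto simp: f_def int_lattice_def rat_space_def)
    show "0 \<notin> f ` ?I"
    proof
      assume "0 \<in> f ` ?I"
      then obtain a b' where ab: "a \<in> {1..n}" "0 = f (a, b')" by blast
      then have "f (a, b') 0 = 0" by (metis zero_fun_apply)
      then show False using ab(1) unfolding f by simp
    qed
    have "b < harm n / 2" using n by simp
    also have "harm n / 2 = (\<Sum>a=1..n. \<Sum>b'=1..a. 1 / (2 * real a ^ 2))"
      unfolding harm_def sum_divide_distrib by (rule sum.cong) (auto simp: field_simps power2_eq_square)
    also have "\<dots> = (\<Sum>u\<in>?I. 1 / (2 * real (fst u) ^ 2))"
      by (subst sum.Sigma) (auto intro: sum.cong)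
    also have "\<dots> \<le> (\<Sum>u\<in>?I. mpoly_at (epstein_parts 2) (f u) powr (- 1))"
    proof (rule sum_mono)
      fix u assume "u \<in> ?I"
      then obtain a b' where u: "u = (a, b')" "1 \<le> a" "1 \<le> b'" "b' \<le> a" by auto
      have v: "mpoly_at (epstein_parts 2) (f u) = real a ^ 2 + real b' ^ 2"
        unfolding mpoly_at_def epstein_parts_eval u(1) f by simp
      have "real b' ^ 2 \<le> real a ^ 2" using u by (intro power_mono) auto
      moreover have "real a ^ 2 > 0" using u by simp
      ultimately have "1 / (2 * real a ^ 2) \<le> 1 / (real a ^ 2 + real b' ^ 2)"
        by (intro divide_left_mono mult_pos_pos) (auto simp: add_pos_nonneg)
      then show "1 / (2 * real (fst u) ^ 2) \<le> mpoly_at (epstein_parts 2) (f u) powr (- 1)"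
        unfolding v using u \<open>real a ^ 2 > 0\<close> by (simp add: powr_minus_divide add_pos_nonneg)
    qed
    also have "\<dots> = (\<Sum>x\<in>f ` ?I. mpoly_at (epstein_parts 2) x powr (- 1))"
      by (subst sum.reindex) (auto intro: inj_on_subset[OF inj])
    finally show "b < (\<Sum>x\<in>f ` ?I. mpoly_at (epstein_parts 2) x powr (- 1))" .
  qed auto
qed

text \<open>
  At \<open>s = 0\<close> the series has h-sum \<open>0\<close> because no point is excluded. Among the terms with a pole at \<open>0\<close>,
  the linear one is \<open>-s\<close> times the Epstein zeta function at \<open>s + 1\<close>; the others contain a
  factor from the degree-one part of the polynomial, which is \<open>0\<close>.
\<close>

lemma epstein_counterexample:
  "\<exists>Gt. 0 \<in> exc_points 2 2 \<and> G_defined 2 epstein_poly {} 0 \<and>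
    mero_continuation (exc_points 2 2) (G 2 epstein_poly {}) Gt \<and> Gt 0 \<noteq> G 2 epstein_poly {} 0"
proof -
  obtain c where "elliptic_poly 2 2 (mpoly_at (epstein_parts 2)) c (mpoly_at epstein_poly)
      (\<lambda>r. mpoly_at (epstein_parts r)) {}"
    by (rule elliptic_poly_of_decomp[OF epstein_decomp epstein_excluded])
  then interpret E: elliptic_poly 2 2 "mpoly_at (epstein_parts 2)" c "mpoly_at epstein_poly"
      "\<lambda>r. mpoly_at (epstein_parts r)" "{}" .
  have Geq: "G 2 epstein_poly {} = E.series_sum" by (rule ext) (simp only: G_def E.series_sum_def)
  have Gd: "G_defined 2 epstein_poly {} s \<longleftrightarrow> E.series_summable s" for s by (simp only: G_defined_def E.series_summable_def)
  have V: "h_has_sum 2 (E.series_term 0) 0" using E.series_term_nonpos_int[of 0] by simp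
  have G0: "E.series_sum 0 = 0" by (rule E.series_sum_eq[OF V])
  obtain A \<rho> I B where I: "I \<ge> 2" and BI: "B \<subseteq> E.terms I"
    and B: "\<forall>\<tau>. \<tau> \<in> B \<longleftrightarrow> \<tau> \<in> E.terms I \<and> E.tpole \<tau> = 0 \<and> even (E.tdeg \<tau>)"
    and A: "A analytic_on {0}" and "\<rho> = (\<Sum>\<tau>\<in>B. E.tnum \<tau> 0)"
    and ev: "\<forall>\<^sub>F s in at 0. h_has_sum 2 (E.series_term s) (A s + \<rho> / (s - 0))"
    and "B = {} \<longrightarrow> h_has_sum 2 (E.series_term 0) (A 0)"
    and \<rho>: "\<forall>V. h_has_sum 2 (E.series_term 0) V \<longrightarrow> \<rho> = 0"
    and jump: "\<forall>V. h_has_sum 2 (E.series_term 0) V \<and> (\<forall>\<tau>\<in>B. E.tcoef \<tau> 0 = 0) \<longrightarrow>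
       A 0 - V = (\<Sum>\<tau>\<in>B. deriv (E.tnum \<tau>) 0)"
    by (rule E.local_structure[of 0]) (rule that)
  obtain Gt where Gt: "mero_continuation (exc_points 2 2) E.series_sum Gt"
    using E.ex_continuation by blast
  have "\<rho> = 0" using \<rho> V by blast
  from ev have "\<forall>\<^sub>F s in at 0. E.series_sum s = A s"
    by eventually_elim (use E.series_sum_eq \<open>\<rho> = 0\<close> in auto)
  from E.continuation_value(2)[OF Gt A this] have GtA: "Gt 0 = A 0" .
  have Bq: "2 * fst \<tau> = 2 + E.tdeg \<tau>" if "\<tau> \<in> B" for \<tau>
  proof -
    have "E.tpole \<tau> = 0" using that B by blast
    then have "of_nat (2 + E.tdeg \<tau>) = (of_nat (2 * fst \<tau>) :: complex)"
      by (simp add: E.tpole_def E.crit_point_def field_simps)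
    then show ?thesis by (simp only: of_nat_eq_iff)
  qed
  have c0: "E.tcoef \<tau> 0 = 0" if "\<tau> \<in> B" for \<tau>
  proof -
    have "fst \<tau> \<noteq> 0" using Bq[OF that] by linarith
    then obtain i where "fst \<tau> = Suc i" by (cases "fst \<tau>") auto
    then show ?thesis by (simp add: E.tcoef_def)
  qed
  have dnum: "deriv (E.tnum \<tau>) 0 = deriv (E.tcoef \<tau>) 0 * E.zeta_num (E.tdeg \<tau>) (E.tpoly \<tau>) (E.crit_point (E.tdeg \<tau>))"
    if "\<tau> \<in> B" for \<tau>
  proof -
    let ?z = "\<lambda>s. E.zeta_num (E.tdeg \<tau>) (E.tpoly \<tau>) (s + of_nat (fst \<tau>))"
    have \<tau>: "\<tau> \<in> E.terms I" "even (E.tdeg \<tau>)" "E.tpole \<tau> = 0" using that B by blast+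
    have "?z holomorphic_on UNIV"
      by (rule holomorphic_on_shift[OF E.zeta_num(1)[OF E.hpoly_tpoly[OF \<tau>(1)]]])
    then have "?z field_differentiable at 0" by (auto simp: holomorphic_on_def)
    moreover have "E.tcoef \<tau> field_differentiable at 0"
      using E.tcoef_holomorphic[of \<tau> UNIV] by (auto simp: holomorphic_on_def)
    ultimately have "deriv (\<lambda>s. E.tcoef \<tau> s * ?z s) 0 = E.tcoef \<tau> 0 * deriv ?z 0 + deriv (E.tcoef \<tau>) 0 * ?z 0"
      by (intro deriv_mult)
    moreover have "E.tnum \<tau> = (\<lambda>s. E.tcoef \<tau> s * ?z s)" using \<tau>(2) by (simp add: E.tnum_def fun_eq_iff)
    moreover have "0 + of_nat (fst \<tau>) = E.crit_point (E.tdeg \<tau>)" using \<tau>(3) by (simp add: E.tpole_def)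
    ultimately show ?thesis using c0[OF that] by simp
  qed
  \<comment> \<open>The linear term: \<open>i = 1\<close>, with the constant part of the polynomial as its only factor.\<close>
  define \<tau>1 :: "nat \<times> (nat \<Rightarrow> nat)" where "\<tau>1 = (1, restrict (\<lambda>_. 0) {..<1})"
  have \<tau>1: "E.tdeg \<tau>1 = 0" "E.tpoly \<tau>1 = (\<lambda>_. 1)"
    by (simp_all add: \<tau>1_def E.tdeg_def E.tpoly_def fun_eq_iff mpoly_at_def epstein_parts_eval)
  have \<tau>1B: "\<tau>1 \<in> B"
  proof -
    have "\<tau>1 \<in> E.terms I" using I by (simp add: E.terms_def \<tau>1_def)
    moreover have "E.tpole \<tau>1 = 0" by (simp add: E.tpole_def \<tau>1(1) E.crit_point_def) (simp add: \<tau>1_def)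
    ultimately show ?thesis using B[THEN spec, of \<tau>1] \<tau>1(1) by simp
  qed
  have others: "E.zeta_num (E.tdeg \<tau>) (E.tpoly \<tau>) (E.crit_point (E.tdeg \<tau>)) = 0" if "\<tau> \<in> B" "\<tau> \<noteq> \<tau>1" for \<tau>
  proof -
    have \<tau>: "\<tau> \<in> E.terms I" using that B by blast
    have "\<exists>l<fst \<tau>. snd \<tau> l \<noteq> 0"
    proof (rule ccontr)
      assume "\<not> ?thesis"
      then have z: "\<And>l. l < fst \<tau> \<Longrightarrow> snd \<tau> l = 0" by blast
      then have "E.tdeg \<tau> = 0" by (simp add: E.tdeg_def)
      then have f1: "fst \<tau> = 1" using Bq[OF that(1)] by simp
      have "snd \<tau> \<in> PiE {..<fst \<tau>} (\<lambda>_. {..<2})"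
        using \<tau> by (cases \<tau>) (simp add: E.terms_def)
      then have "snd \<tau> \<in> extensional {..<1}" unfolding f1 by (rule PiE_iff[THEN iffD1, THEN conjunct2])
      then have "snd \<tau> l = snd \<tau>1 l" for l
        using z[of l] f1 by (cases "l < 1") (simp_all add: \<tau>1_def extensional_def)
      then have "snd \<tau> = snd \<tau>1" by (rule ext)
      then have "\<tau> = \<tau>1" using f1 by (simp add: prod_eq_iff \<tau>1_def)
      with that(2) show False by blast
    qed
    then obtain l where l: "l < fst \<tau>" "snd \<tau> l \<noteq> 0" by blast
    then have "snd \<tau> l = Suc 0" using E.terms_memD[OF \<tau> l(1)] by simp
    then have "mpoly_at (epstein_parts (snd \<tau> l)) x = 0" for x
      by (simp add: mpoly_at_def epstein_parts_eval)
    then have "E.tpoly \<tau> x = 0" for x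
      unfolding E.tpoly_def using l(1) by (intro prod_zero) auto
    then have "E.tpoly \<tau> = (\<lambda>_. 0)" by (rule ext)
    then show ?thesis by (simp only: E.zeta_num_zero)
  qed
  have "finite B" using BI E.finite_terms by (rule finite_subset)
  have "A 0 - 0 = (\<Sum>\<tau>\<in>B. deriv (E.tnum \<tau>) 0)" using jump V c0 by blast
  also have "\<dots> = (\<Sum>\<tau>\<in>B. if \<tau> = \<tau>1 then deriv (E.tnum \<tau>1) 0 else 0)"
    by (rule sum.cong[OF refl]) (use dnum others in auto)
  also have "\<dots> = deriv (E.tnum \<tau>1) 0" using \<tau>1B \<open>finite B\<close> by simp
  also have "\<dots> = deriv (E.tcoef \<tau>1) 0 * E.zeta_num 0 (\<lambda>_. 1) (E.crit_point 0)"
    using dnum[OF \<tau>1B] by (simp only: \<tau>1)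
  also have "deriv (E.tcoef \<tau>1) 0 = - 1"
  proof -
    have "E.tcoef \<tau>1 = (\<lambda>s. - s)" by (simp add: E.tcoef_def \<tau>1_def fun_eq_iff)
    then show ?thesis by (simp add: deriv_minus)
  qed
  finally have A0: "A 0 = - E.zeta_num 0 (\<lambda>_. 1) (E.crit_point 0)" by simp
  have "E.zeta_num 0 (\<lambda>_. 1) (E.crit_point 0) \<noteq> 0"
  proof
    assume z: "E.zeta_num 0 (\<lambda>_. 1) (E.crit_point 0) = 0"
    obtain S where S: "finite S" "S \<subseteq> int_lattice 2" "0 \<notin> S"
      "(\<Sum>x\<in>S. mpoly_at (epstein_parts 2) x powr (- 1)) > Re (deriv (E.zeta_num 0 (\<lambda>_. 1)) (E.crit_point 0))"
      by (rule epstein_sums_unbounded)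
    from E.zeta_num_one_finite_sums[OF z S(1,2,3)] S(4) show False by simp
  qed
  then have "Gt 0 \<noteq> E.series_sum 0" using GtA A0 G0 by simp
  moreover have "0 \<in> exc_points 2 2"
    unfolding exc_points_def by (intro CollectI exI[of _ 2]) simp
  moreover have "E.series_summable 0" using V E.series_summable_iff by blast
  ultimately show ?thesis using Gt unfolding Geq Gd by blast
qed

section \<open>Series of complex powers of an elliptic polynomial\<close>

theorem theorem4p7:
  shows
    "(\<forall>k d P Pc. elliptic_decomp k d P Pc \<longrightarrow>
        compactin (Euclidean_space k) {x \<in> topspace (Euclidean_space k). mpoly_eval P x \<le> 0} \<and>
        (\<forall>F. excluded_set k P F \<longrightarrow>
           (\<forall>s. s \<notin> exc_points k d \<longrightarrow> G_defined k P F s) \<and>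
           G k P F holomorphic_on (- exc_points k d) \<and>
           (\<exists>Gt. mero_continuation (exc_points k d) (G k P F) Gt \<and> at_most_simple_poles Gt) \<and>
           (\<forall>Gt. mero_continuation (exc_points k d) (G k P F) Gt \<longrightarrow>
              (\<forall>s0\<in>exc_points k d. G_defined k P F s0 \<longrightarrow> Gt analytic_on {s0}) \<and>
              (\<forall>s::int. s \<le> 0 \<longrightarrow>
                 G_defined k P F (of_int s) \<and>
                 G k P F (of_int s) = - (\<Sum>n\<in>F. complex_of_real (mpoly_at P n) ^ nat (- s)) \<and>
                 Gt analytic_on {of_int s}) \<and>
              (odd k \<longrightarrow> (\<forall>s::int. s \<le> 0 \<longrightarrow>
                 Gt (of_int s) = - (\<Sum>n\<in>F. complex_of_real (mpoly_at P n) ^ nat (- s)))))))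
     \<and>
     (\<exists>k d P Pc F s0 Gt. elliptic_decomp k d P Pc \<and> excluded_set k P F \<and>
        s0 \<in> exc_points k d \<and> G_defined k P F s0 \<and>
        mero_continuation (exc_points k d) (G k P F) Gt \<and> Gt s0 \<noteq> G k P F s0)"
proof (intro conjI allI impI)
  fix k d P Pc assume dec: "elliptic_decomp k d P Pc"
  show "compactin (Euclidean_space k) {x \<in> topspace (Euclidean_space k). mpoly_eval P x \<le> 0}"
    by (rule compact_nonpositive_set[OF dec])
  fix F assume exc: "excluded_set k P F"
  obtain c where "elliptic_poly k d (mpoly_at (Pc d)) c (mpoly_at P) (\<lambda>r. mpoly_at (Pc r)) F"
    by (rule elliptic_poly_of_decomp[OF dec exc])
  then interpret E: elliptic_poly k d "mpoly_at (Pc d)" c "mpoly_at P" "\<lambda>r. mpoly_at (Pc r)" F .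
  have Geq: "G k P F = E.series_sum" by (rule ext) (simp only: G_def E.series_sum_def)
  have Gd: "G_defined k P F s \<longleftrightarrow> E.series_summable s" for s by (simp only: G_defined_def E.series_summable_def)
  have val: "E.series_summable (of_int s)"
    "E.series_sum (of_int s) = - (\<Sum>n\<in>F. complex_of_real (mpoly_at P n) ^ nat (- s))" if "s \<le> 0" for s :: int
    using E.series_term_nonpos_int[OF that] E.series_sum_eq E.series_summable_iff by blast+
  show "G_defined k P F s" if "s \<notin> exc_points k d" for s
    unfolding Gd by (rule E.series_summable_off_exc[OF that])
  show "G k P F holomorphic_on - exc_points k d" unfolding Geq by (rule E.series_sum_holomorphic)
  show "\<exists>Gt. mero_continuation (exc_points k d) (G k P F) Gt \<and> at_most_simple_poles Gt"
    unfolding Geq by (rule E.ex_continuation)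
  fix Gt assume "mero_continuation (exc_points k d) (G k P F) Gt"
  then have Gt: "mero_continuation (exc_points k d) E.series_sum Gt" unfolding Geq .
  show "\<forall>s0\<in>exc_points k d. G_defined k P F s0 \<longrightarrow> Gt analytic_on {s0}"
    unfolding Gd using E.continuation_analytic[OF Gt] by blast
  fix s :: int assume s: "s \<le> 0"
  show "G_defined k P F (of_int s)" unfolding Gd by (rule val(1)[OF s])
  show "G k P F (of_int s) = - (\<Sum>n\<in>F. complex_of_real (mpoly_at P n) ^ nat (- s))"
    unfolding Geq by (rule val(2)[OF s])
  show "Gt analytic_on {of_int s}" by (rule E.continuation_analytic[OF Gt val(1)[OF s]])
  assume "odd k"
  then have "of_int s \<notin> exc_points k d" by (rule E.nonpos_int_not_exc)
  then have "Gt (of_int s) = E.series_sum (of_int s)" using Gt by (simp add: mero_continuation_def)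
  then show "Gt (of_int s) = - (\<Sum>n\<in>F. complex_of_real (mpoly_at P n) ^ nat (- s))"
    using val(2)[OF s] by simp
next
  show "\<exists>k d P Pc F s0 Gt. elliptic_decomp k d P Pc \<and> excluded_set k P F \<and>
        s0 \<in> exc_points k d \<and> G_defined k P F s0 \<and>
        mero_continuation (exc_points k d) (G k P F) Gt \<and> Gt s0 \<noteq> G k P F s0"
    using epstein_counterexample epstein_decomp epstein_excluded by blast
qed

end
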